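(* Let $(u_n)_{n\in\mathbb{N}}$ be a sequence in $\mathcal{X}^1$ such that $[p](u_n)\to\frac{\pi}{2}$ in $\mathbb{R}/\pi\mathbb{Z}$ and $E(u_n)\to\mathfrak{E}_{\min}(\frac{\pi}{2})$ as $n\to+\infty$. Then there exist a subsequence $(u_{\sigma(n)})$, a sequence of real numbers $(a_n)$ and a real number $\theta$ such that, as $n\to+\infty$: $u_{\sigma(n)}(\cdot+a_{\sigma(n)})\to e^{i\theta}\mathfrak{v}_0$ uniformly on every compact subset of $\mathbb{R}$; $1-|u_{\sigma(n)}(\cdot+a_{\sigma(n)})|^2\to 1-|\mathfrak{v}_0|^2$ in $L^2(\mathbb{R})$; and $u_{\sigma(n)}'(\cdot+a_{\sigma(n)})\to e^{i\theta}\mathfrak{v}_0'$ in $L^2(\mathbb{R})$.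
   Context: $\mathcal{X}^1=\{w\in L^\infty(\mathbb{R};\mathbb{C}):\ w'\in L^2,\ 1-|w|^2\in L^2\}$. Energy: $E(v)=\frac12\int_\mathbb{R}|v'|^2+\frac14\int_\mathbb{R}(1-|v|^2)^2$. Notation $\langle a,b\rangle=\mathrm{Re}(a\bar b)$. Every $v\in\mathcal{X}^1$ satisfies $|v(x)|\to1$ as $|x|\to\infty$, so $v(\pm R)\neq0$ for $R$ large and $\arg v(\pm R)\in\mathbb{R}/2\pi\mathbb{Z}$ is defined. The untwisted momentum of $v\in\mathcal{X}^1$ is $[p](v)=\lim_{R\to+\infty}\Big(\frac12\int_{-R}^R\langle iv,v'\rangle-\frac12(\arg v(R)-\arg v(-R))\Big)\in\mathbb{R}/\pi\mathbb{Z}$ (this limit exists). Define $\mathfrak{E}_{\min}(\frac{\pi}{2})=\inf\{E(v):\ v\in\mathcal{X}^1,\ [p](v)=\frac{\pi}{2}\bmod\pi\}$. The kink is $\mathfrak{v}_0(x)=\tanh(x/\sqrt2)$. *)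

theory Defs
  imports "HOL-Analysis.Analysis"
begin

text \<open>Functions are represented by their continuous (locally absolutely continuous)
representative \<open>w :: real \<Rightarrow> complex\<close>. \<open>g\<close> is a weak derivative of \<open>w\<close> if
\<open>w y - w x = \<integral>_x^y g\<close> for all \<open>x \<le> y\<close>.\<close>

definition is_wderiv :: "(real \<Rightarrow> complex) \<Rightarrow> (real \<Rightarrow> complex) \<Rightarrow> bool" where
  "is_wderiv w g \<longleftrightarrow>
     (\<forall>x y. x \<le> y \<longrightarrow> set_integrable lborel {x..y} g \<and> w y - w x = (LBINT t:{x..y}. g t))"

definition X1 :: "(real \<Rightarrow> complex) \<Rightarrow> bool" where
  "X1 w \<longleftrightarrow> bounded (range w)
     \<and> (\<exists>g. is_wderiv w g \<and> integrable lborel (\<lambda>x. (norm (g x))\<^sup>2))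
     \<and> integrable lborel (\<lambda>x. (1 - (norm (w x))\<^sup>2)\<^sup>2)"

text \<open>A square-integrable weak derivative (unique up to null sets).\<close>
definition wderiv :: "(real \<Rightarrow> complex) \<Rightarrow> real \<Rightarrow> complex" where
  "wderiv w = (SOME g. is_wderiv w g \<and> integrable lborel (\<lambda>x. (norm (g x))\<^sup>2))"

definition energy :: "(real \<Rightarrow> complex) \<Rightarrow> real" where
  "energy v = 1/2 * (LINT x|lborel. (norm (wderiv v x))\<^sup>2)
            + 1/4 * (LINT x|lborel. (1 - (norm (v x))\<^sup>2)\<^sup>2)"

definition cinner :: "complex \<Rightarrow> complex \<Rightarrow> real" where
  "cinner a b = Re (a * cnj b)"

definition modpi_dist :: "real \<Rightarrow> real \<Rightarrow> real" where
  "modpi_dist a b = (INF k::int. \<bar>a - b - of_int k * pi\<bar>)"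

text \<open>Truncated untwisted momentum on \<open>[-R,R]\<close> (a real representative; the class mod \<open>\<pi>\<close>
does not depend on the choice of arguments).\<close>
definition pR :: "(real \<Rightarrow> complex) \<Rightarrow> real \<Rightarrow> real" where
  "pR v R = 1/2 * (LBINT x:{-R..R}. cinner (\<i> * v x) (wderiv v x))
            - 1/2 * (Arg (v R) - Arg (v (-R)))"

text \<open>Untwisted momentum \<open>[p](v)\<close>: a real representative of the limit in \<open>\<real>/\<pi>\<int>\<close>.\<close>
definition pmom :: "(real \<Rightarrow> complex) \<Rightarrow> real" where
  "pmom v = (SOME q. ((\<lambda>R. modpi_dist (pR v R) q) \<longlongrightarrow> 0) at_top)"

definition Emin_half_pi :: real where
  "Emin_half_pi = (INF v \<in> {v. X1 v \<and> modpi_dist (pmom v) (pi/2) = 0}. energy v)"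

definition kink :: "real \<Rightarrow> complex" where
  "kink x = complex_of_real (tanh (x / sqrt 2))"

end

theory Submission
  imports Defs
begin

text \<open>
  Write \<open>\<rho> = |v|\<close> and \<open>\<Psi>(r) = r - r\<^sup>3/3\<close>. Completing the square on each side of a point \<open>a\<close> gives
  \<open>2 E(v) = \<integral> |v' - \<rho>' v/\<rho>|\<^sup>2 + \<integral> (sgn(x - a) \<rho>' - (1 - \<rho>\<^sup>2)/\<surd>2)\<^sup>2 + \<surd>2 (4/3 - 2 \<Psi>(\<rho>(a)))\<close>,
  so a map that almost vanishes at \<open>a\<close> and has energy close to \<open>2\<surd>2/3 = E(kink)\<close> almost solves the
  kink equation \<open>\<rho>' = \<plusminus>(1 - \<rho>\<^sup>2)/\<surd>2\<close> with almost constant phase on each half-line.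

  A map bounded away from zero has \<open>[p](v) = -(1/2) \<integral> (1 - \<rho>\<^sup>2) \<phi>'\<close> modulo \<open>\<pi>\<close>, where \<open>\<phi>\<close> is its phase.
  Adding \<open>\<surd>2 \<lambda>\<close> times this integral to the energy, with \<open>\<lambda>\<close> just below \<open>m = inf \<rho>\<close>, and completing
  squares again yields \<open>E(v) \<ge> \<surd>2 m |p| + \<surd>2 \<integral>_m^1 (1 - r\<^sup>2) \<surd>(r\<^sup>2 - m\<^sup>2)/r dr\<close>. For \<open>|p| \<ge> \<pi>/2\<close> the right-hand side
  is strictly increasing in \<open>m\<close> with value \<open>2\<surd>2/3\<close> at \<open>m = 0\<close>. Hence along a minimizing sequence
  \<open>inf |u_n| \<longlonglongrightarrow> 0\<close>, and the identity applies at an almost-minimum point \<open>a_n\<close> of \<open>|u_n|\<close>. The momentum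
  constraint finally forces the phases on the two half-lines to differ by \<open>\<pi>\<close>.
\<close>

section \<open>Functions with an integrable weak derivative\<close>

text \<open>The obstacle is that the momentum makes sense only modulo \<pi> and that the phase is
  undefined where a map vanishes. Both are met by working with \<open>cis (2 * pmom v)\<close> and
  \<open>sgn (v x)\<close>: the energy identity makes the non-radial part of the derivative small
  without mention of a phase, and on an interval containing zeros the density \<langle>iv,
  v'\<rangle> is bounded by |v| times this part. So \<open>cis (2 * pmom v)\<close> is close to the
  quotient of the directions of v on the two sides, and its limit -1 is the phase jump \<pi>. The
  value of \<open>Emin_half_pi\<close> is a by-product: the kink bounds it above, and the two
  nonnegative squares of the identity, along the recentred sequence, bound it below. Why \<lambda>
  lies below inf \<rho>: completing the angular square leaves the potential with a factor (\<rho>^2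
  - \<lambda>^2)/\<rho>^2, which must be nonnegative to be matched with the radial square. Strict
  inequality keeps \<rho> where the square root of this factor is differentiable.\<close>

definition wd_on :: "real \<Rightarrow> real \<Rightarrow> (real \<Rightarrow> 'a::{banach, second_countable_topology}) \<Rightarrow> (real \<Rightarrow> 'a) \<Rightarrow> bool" where
  "wd_on a b w g \<longleftrightarrow>
     (\<forall>x y. a \<le> x \<longrightarrow> x \<le> y \<longrightarrow> y \<le> b \<longrightarrow>
        set_integrable lborel {x..y} g \<and> w y - w x = (LBINT t:{x..y}. g t))"

text \<open>Compact intervals supply the boundedness and uniform continuity used in the calculus
  rules, and they allow hypotheses valid on one interval only, such as nonvanishing in
  \<open>sgn_lifting\<close>.\<close>

lemma is_wderiv_iff_wd_on: "is_wderiv w g \<longleftrightarrow> (\<forall>a b. wd_on a b w g)"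
  unfolding is_wderiv_def wd_on_def by (meson order_refl)

lemma wd_onD:
  assumes "wd_on a b w g" "a \<le> x" "x \<le> y" "y \<le> b"
  shows "set_integrable lborel {x..y} g" "w y - w x = (LBINT t:{x..y}. g t)"
  using assms unfolding wd_on_def by blast+

lemma wd_on_subset: "wd_on a b w g \<Longrightarrow> a \<le> a' \<Longrightarrow> b' \<le> b \<Longrightarrow> wd_on a' b' w g"
  unfolding wd_on_def by (meson order_trans)

lemma set_integral_combine:
  fixes f :: "real \<Rightarrow> 'a::{banach, second_countable_topology}"
  assumes "set_integrable lborel {a..c} f" "a \<le> b" "b \<le> c"
  shows "(LBINT t:{a..c}. f t) = (LBINT t:{a..b}. f t) + (LBINT t:{b..c}. f t)"
proof -
  have "{a..c} = {a..b} \<union> {b..c}" using assms by auto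
  moreover have "(LBINT t:{a..b} \<union> {b..c}. f t) = (LBINT t:{a..b}. f t) + (LBINT t:{b..c}. f t)"
  proof (rule set_integral_Un_AE)
    show "AE x in lborel. \<not> (x \<in> {a..b} \<and> x \<in> {b..c})"
      by (rule AE_I'[of "{b}"]) auto
  qed (use assms in \<open>auto intro: set_integrable_subset\<close>)
  ultimately show ?thesis by simp
qed

lemma wd_onI:
  fixes w :: "real \<Rightarrow> 'a::{banach, second_countable_topology}"
  assumes "a \<le> b \<Longrightarrow> set_integrable lborel {a..b} g"
    and "\<And>x y. a \<le> x \<Longrightarrow> x \<le> y \<Longrightarrow> y \<le> b \<Longrightarrow> w y - w x = (LBINT t:{x..y}. g t)"
  shows "wd_on a b w g"
  unfolding wd_on_def
proof (intro allI impI conjI)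
  fix x y assume xy: "a \<le> x" "x \<le> y" "y \<le> b"
  then show "set_integrable lborel {x..y} g"
    by (intro set_integrable_subset[OF assms(1)]) auto
qed (use assms in auto)

lemma continuous_on_wd:
  fixes w :: "real \<Rightarrow> 'a::{euclidean_space}"
  assumes "wd_on a b w g"
  shows "continuous_on {a..b} w"
proof (cases "a \<le> b")
  case True
  have si: "set_integrable lborel {a..b} g" using wd_onD(1)[OF assms] True by auto
  have "g integrable_on {a..b}" by (rule set_borel_integral_eq_integral(1)[OF si])
  then have "continuous_on {a..b} (\<lambda>x. w a + integral {a..x} g)"
    by (intro continuous_intros indefinite_integral_continuous_1)
  moreover have "w x = w a + integral {a..x} g" if "x \<in> {a..b}" for x
  proof -
    have "set_integrable lborel {a..x} g" using wd_onD(1)[OF assms, of a x] that by auto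
    then have "integral {a..x} g = (LBINT t:{a..x}. g t)"
      by (simp add: set_borel_integral_eq_integral(2))
    then show ?thesis using wd_onD(2)[OF assms, of a x] that by (simp add: algebra_simps)
  qed
  ultimately show ?thesis using continuous_on_cong[OF refl, of "{a..b}" w "\<lambda>x. w a + integral {a..x} g"] by blast
qed auto

lemma uniform_modulus_wd:
  fixes w :: "real \<Rightarrow> 'a::{euclidean_space}"
  assumes "wd_on a b w g" "e > 0"
  obtains d where "d > 0" "\<And>x y. a \<le> x \<Longrightarrow> x \<le> b \<Longrightarrow> a \<le> y \<Longrightarrow> y \<le> b \<Longrightarrow> \<bar>x - y\<bar> < d \<Longrightarrow> norm (w x - w y) < e"
proof -
  have "uniformly_continuous_on {a..b} w"
    by (intro compact_uniformly_continuous continuous_on_wd[OF assms(1)]) auto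
  then obtain d where "d > 0" "\<forall>x\<in>{a..b}. \<forall>x'\<in>{a..b}. dist x' x < d \<longrightarrow> dist (w x') (w x) < e"
    unfolding uniformly_continuous_on_def using \<open>e > 0\<close> by meson
  then show thesis by (intro that[of d]) (auto simp: dist_norm)
qed

section \<open>Product and chain rules for weak derivatives\<close>

lemma set_integrable_bilinear_continuous:
  fixes prod :: "'a::euclidean_space \<Rightarrow> 'b::euclidean_space \<Rightarrow> 'c::euclidean_space"
  assumes "bounded_bilinear prod" "set_integrable lborel {a..b::real} f" "continuous_on {a..b} G"
  shows "set_integrable lborel {a..b} (\<lambda>t. prod (f t) (G t))"
proof -
  interpret bounded_bilinear prod by fact
  obtain K where K: "\<And>u v. norm (prod u v) \<le> norm u * norm v * K" "K \<ge> 0"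
    using nonneg_bounded by blast
  have "compact (G ` {a..b})" using assms(3) by (intro compact_continuous_image) auto
  then obtain B where B: "\<And>t. t \<in> {a..b} \<Longrightarrow> norm (G t) \<le> B" "B > 0"
    by (metis compact_imp_bounded bounded_pos imageI)
  have mf: "(\<lambda>t. indicator {a..b} t *\<^sub>R f t) \<in> borel_measurable lborel"
    using assms(2) unfolding set_integrable_def by (rule borel_measurable_integrable)
  have mG: "(\<lambda>t. indicator {a..b} t *\<^sub>R G t) \<in> borel_measurable lborel"
    using borel_measurable_continuous_on_indicator[OF _ assms(3)] by simp
  \<comment> \<open>\<open>f\<close> and \<open>G\<close> are controlled on \<open>{a..b}\<close>
    only, so both factors are cut off first; by bilinearity the product of the cut-offs is the
    cut-off of the product.\<close>
  have "(\<lambda>t. prod (indicator {a..b} t *\<^sub>R f t) (indicator {a..b} t *\<^sub>R G t)) \<in> borel_measurable lborel"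
    by (intro borel_measurable_continuous_Pair[OF mf mG] continuous_on continuous_on_fst continuous_on_snd continuous_on_id)
  moreover have "prod (indicator {a..b} t *\<^sub>R f t) (indicator {a..b} t *\<^sub>R G t)
      = indicator {a..b} t *\<^sub>R prod (f t) (G t)" for t
    by (auto simp: indicator_def zero_left)
  ultimately have m: "(\<lambda>t. indicator {a..b} t *\<^sub>R prod (f t) (G t)) \<in> borel_measurable lborel" by simp
  have i: "set_integrable lborel {a..b} (\<lambda>t. (B * K) *\<^sub>R f t)"
    using assms(2) by (intro set_integrable_scaleR_right)
  show ?thesis
  proof (rule set_integrable_bound[OF i])
    show "set_borel_measurable lborel {a..b} (\<lambda>t. prod (f t) (G t))"
      using m by (simp add: set_borel_measurable_def)
    have "norm (prod (f t) (G t)) \<le> norm ((B * K) *\<^sub>R f t)" if "t \<in> {a..b}" for t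
    proof -
      have "norm (prod (f t) (G t)) \<le> norm (f t) * norm (G t) * K" by (rule K)
      also have "\<dots> \<le> norm (f t) * B * K"
        using B(1)[OF that] K(2) by (intro mult_right_mono mult_left_mono) auto
      finally show ?thesis using B K by (simp add: mult_ac)
    qed
    then show "AE x in lborel. x \<in> {a..b} \<longrightarrow> norm (prod (f x) (G x)) \<le> norm ((B * K) *\<^sub>R f x)" by auto
  qed
qed

text \<open>An additive interval function that is \<open>o\<close> of an integrable weight on short intervals vanishes:
  this replaces differentiation almost everywhere in the calculus rules below.\<close>

lemma additive_interval_function_eq_0:
  fixes D :: "real \<Rightarrow> real \<Rightarrow> 'b::real_normed_vector" and k :: "real \<Rightarrow> real"
  assumes ab: "a \<le> b" and k: "set_integrable lborel {a..b} k"
    and add: "\<And>x y z. a \<le> x \<Longrightarrow> x \<le> y \<Longrightarrow> y \<le> z \<Longrightarrow> z \<le> b \<Longrightarrow> D x z = D x y + D y z"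
    and small: "\<And>e. e > 0 \<Longrightarrow> \<exists>d>0. \<forall>x y. a \<le> x \<longrightarrow> x \<le> y \<longrightarrow> y \<le> b \<longrightarrow> y - x < d
        \<longrightarrow> norm (D x y) \<le> e * (LBINT t:{x..y}. k t)"
  shows "D a b = 0"
proof -
  define I where "I = (LBINT t:{a..b}. k t)"
  have bound: "norm (D a b) \<le> e * I" if "e > 0" for e
  proof -
    obtain d where d: "d > 0" "\<And>x y. a \<le> x \<Longrightarrow> x \<le> y \<Longrightarrow> y \<le> b \<Longrightarrow> y - x < d
        \<Longrightarrow> norm (D x y) \<le> e * (LBINT t:{x..y}. k t)" using small[OF \<open>e > 0\<close>] by blast
    obtain N :: nat where N: "(b - a) / d < real N" using reals_Archimedean2 by blast
    have N0: "N > 0" using N ab d(1) by (cases N) (auto simp: divide_less_0_iff not_less)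
    define h where "h = (b - a) / real N"
    have h: "h \<ge> 0" "h < d" "a + real N * h = b"
      using N N0 ab d(1) by (auto simp: h_def field_simps)
    have le: "a + real i * h \<le> b" if "i \<le> N" for i
      using h(1,3) mult_right_mono[of "real i" "real N" h] that by auto
    have ge: "a \<le> a + real i * h" for i using h(1) by simp
    have D0: "D a a = 0" using add[of a a a] ab by simp
    have "norm (D a (a + real i * h)) \<le> e * (LBINT t:{a..a + real i * h}. k t)" if "i \<le> N" for i
      using that
    proof (induction i)
      case 0
      have "(LBINT t:{a..a}. k t) = 0" using set_borel_integral_eq_integral(2)[OF set_integrable_subset[OF k, of "{a..a}"]] ab by simp
      then show ?case by (simp add: D0)
    next
      case (Suc i)
      let ?p = "a + real i * h" and ?q = "a + real (Suc i) * h"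
      have pq: "?p \<le> ?q" "?q - ?p < d" using h by (auto simp: algebra_simps)
      have qb: "?q \<le> b" using le[OF Suc.prems] .
      have "D a ?q = D a ?p + D ?p ?q" using ge pq qb by (intro add) auto
      then have "norm (D a ?q) \<le> norm (D a ?p) + norm (D ?p ?q)" by (simp add: norm_triangle_ineq)
      also have "\<dots> \<le> e * (LBINT t:{a..?p}. k t) + e * (LBINT t:{?p..?q}. k t)"
        using Suc d(2)[of ?p ?q] ge pq qb by (intro add_mono) auto
      also have "\<dots> = e * (LBINT t:{a..?q}. k t)"
      proof -
        have "set_integrable lborel {a..?q} k" using qb by (intro set_integrable_subset[OF k]) auto
        from set_integral_combine[OF this ge[of i] pq(1)] show ?thesis by (simp add: distrib_left)
      qed
      finally show ?case .
    qed
    from this[of N] show ?thesis by (simp add: h I_def)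
  qed
  have "norm (D a b) \<le> 0"
  proof (rule field_le_epsilon)
    fix e :: real assume "e > 0"
    have "norm (D a b) \<le> (e / (\<bar>I\<bar> + 1)) * I" using \<open>e > 0\<close> by (intro bound) auto
    also have "\<dots> \<le> (e / (\<bar>I\<bar> + 1)) * (\<bar>I\<bar> + 1)" using \<open>e > 0\<close> by (intro mult_left_mono) auto
    also have "\<dots> = e" using abs_ge_zero[of I] by (simp add: field_simps)
    finally show "norm (D a b) \<le> 0 + e" by simp
  qed
  then show ?thesis by simp
qed

lemma norm_set_integral_le:
  fixes f :: "real \<Rightarrow> 'a::{banach, second_countable_topology}"
  assumes "set_integrable lborel A f" "set_integrable lborel A k"
    and "\<And>t. t \<in> A \<Longrightarrow> norm (f t) \<le> k t"
  shows "norm (LBINT t:A. f t) \<le> (LBINT t:A. k t)"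
proof -
  have "norm (LBINT t:A. f t) \<le> (LBINT t:A. norm (f t))"
    by (rule set_integral_norm_bound[OF assms(1)])
  also have "\<dots> \<le> (LBINT t:A. k t)"
    by (rule set_integral_mono) (use assms in \<open>auto intro: set_integrable_norm\<close>)
  finally show ?thesis .
qed

text \<open>The remainder \<open>W y - W x - (LBINT t:{x..y}. g t)\<close> is additive over adjacent
  intervals, so smallness relative to the integral of one fixed weight \<open>k\<close> on short
  intervals makes it vanish. Both calculus rules below reduce to this.\<close>

lemma wd_on_by_modulus:
  fixes W :: "real \<Rightarrow> 'a::euclidean_space"
  assumes g: "a \<le> b \<Longrightarrow> set_integrable lborel {a..b} g" and k: "a \<le> b \<Longrightarrow> set_integrable lborel {a..b} k"
    and small: "\<And>e. e > 0 \<Longrightarrow> \<exists>d>0. \<forall>x y. a \<le> x \<longrightarrow> x \<le> y \<longrightarrow> y \<le> b \<longrightarrow> y - x < d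
        \<longrightarrow> norm (W y - W x - (LBINT t:{x..y}. g t)) \<le> e * (LBINT t:{x..y}. k t)"
  shows "wd_on a b W g"
proof (rule wd_onI)
  fix x y assume xy: "a \<le> x" "x \<le> y" "y \<le> b"
  have gi: "set_integrable lborel {p..q} g" if "a \<le> p" "q \<le> b" for p q
    using that xy by (intro set_integrable_subset[OF g]) auto
  have "W y - W x - (LBINT t:{x..y}. g t) = 0"
  proof (rule additive_interval_function_eq_0[where D="\<lambda>x y. W y - W x - (LBINT t:{x..y}. g t)" and k=k])
    show "set_integrable lborel {x..y} k" using xy by (intro set_integrable_subset[OF k]) auto
    show "W r - W p - (LBINT t:{p..r}. g t) =
          W q - W p - (LBINT t:{p..q}. g t) + (W r - W q - (LBINT t:{q..r}. g t))"
      if "x \<le> p" "p \<le> q" "q \<le> r" "r \<le> y" for p q r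
      using set_integral_combine[OF gi that(2,3)] that xy by simp
    show "\<exists>d>0. \<forall>p q. x \<le> p \<longrightarrow> p \<le> q \<longrightarrow> q \<le> y \<longrightarrow> q - p < d \<longrightarrow>
      norm (W q - W p - (LBINT t:{p..q}. g t)) \<le> e * (LBINT t:{p..q}. k t)" if "e > 0" for e
      using small[OF that] xy by (meson order_trans)
  qed (use xy in auto)
  then show "W y - W x = (LBINT t:{x..y}. g t)" by simp
qed (use g in auto)

lemma set_integral_bounded_linear:
  fixes T :: "'a::{banach, second_countable_topology} \<Rightarrow> 'b::{banach, second_countable_topology}"
  assumes "bounded_linear T" "set_integrable M A f"
  shows "set_integrable M A (\<lambda>x. T (f x))" "(LINT x:A|M. T (f x)) = T (LINT x:A|M. f x)"
proof -
  interpret bounded_linear T by fact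
  have eq: "(\<lambda>x. indicator A x *\<^sub>R T (f x)) = (\<lambda>x. T (indicator A x *\<^sub>R f x))" by (simp add: scaleR)
  show "set_integrable M A (\<lambda>x. T (f x))"
    using assms unfolding set_integrable_def eq by (rule integrable_bounded_linear)
  show "(LINT x:A|M. T (f x)) = T (LINT x:A|M. f x)"
    using assms unfolding set_integrable_def set_lebesgue_integral_def eq
    by (rule integral_bounded_linear)
qed

lemma wd_on_diff:
  assumes "wd_on a b v f" "wd_on a b w g"
  shows "wd_on a b (\<lambda>x. v x - w x) (\<lambda>x. f x - g x)"
  unfolding wd_on_def
proof (intro allI impI conjI)
  fix x y assume xy: "a \<le> x" "x \<le> y" "y \<le> b"
  note F = wd_onD[OF assms(1) xy] and G = wd_onD[OF assms(2) xy]
  show "set_integrable lborel {x..y} (\<lambda>x. f x - g x)" by (rule set_integral_diff(1)[OF F(1) G(1)])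
  show "v y - w y - (v x - w x) = (LBINT t:{x..y}. f t - g t)"
    using F(2) G(2) by (simp add: set_integral_diff(2)[OF F(1) G(1)] algebra_simps)
qed

text \<open>With \<open>G\<close> frozen at the right end and \<open>F\<close> at the left end,
  \<open>prod (F y - F x) (G y) + prod (F x) (G y - G x)\<close> is the exact increment. Unfreezing
  inside the integral costs a modulus of continuity times
  \<open>norm (f t) + norm (g t)\<close>.\<close>

lemma wd_on_bilinear:
  fixes prod :: "'a::euclidean_space \<Rightarrow> 'b::euclidean_space \<Rightarrow> 'c::euclidean_space"
  assumes bil: "bounded_bilinear prod" and F: "wd_on a b F f" and G: "wd_on a b G g"
  shows "wd_on a b (\<lambda>x. prod (F x) (G x)) (\<lambda>x. prod (f x) (G x) + prod (F x) (g x))"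
proof -
  interpret bounded_bilinear prod by fact
  obtain K where K: "\<And>u v. norm (prod u v) \<le> norm u * norm v * K" "K \<ge> 0"
    using nonneg_bounded by blast
  have i1: "set_integrable lborel {x..y} (\<lambda>t. prod (f t) (G t))" if "a \<le> x" "x \<le> y" "y \<le> b" for x y
    by (rule set_integrable_bilinear_continuous[OF bil wd_onD(1)[OF F that] continuous_on_wd[OF wd_on_subset[OF G]]])
      (use that in auto)
  have i2: "set_integrable lborel {x..y} (\<lambda>t. prod (F t) (g t))" if "a \<le> x" "x \<le> y" "y \<le> b" for x y
    by (rule set_integrable_bilinear_continuous[OF flip wd_onD(1)[OF G that] continuous_on_wd[OF wd_on_subset[OF F]]])
      (use that in auto)
  show ?thesis
  proof (rule wd_on_by_modulus[where k="\<lambda>t. norm (f t) + norm (g t)"])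
    show "set_integrable lborel {a..b} (\<lambda>x. prod (f x) (G x) + prod (F x) (g x))" if "a \<le> b"
      using that by (intro set_integral_add(1) i1 i2) auto
    show "set_integrable lborel {a..b} (\<lambda>t. norm (f t) + norm (g t))" if "a \<le> b"
      using that by (intro set_integral_add(1) set_integrable_norm wd_onD[OF F] wd_onD[OF G]) auto
    fix e :: real assume "e > 0"
    define e' where "e' = e / (K + 1)"
    have e': "e' > 0" "e' * K \<le> e" using \<open>e > 0\<close> K(2) by (auto simp: e'_def field_simps)
    obtain d1 where d1: "d1 > 0" "\<And>x y. a \<le> x \<Longrightarrow> x \<le> b \<Longrightarrow> a \<le> y \<Longrightarrow> y \<le> b \<Longrightarrow> \<bar>x - y\<bar> < d1 \<Longrightarrow> norm (F x - F y) < e'"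
      using uniform_modulus_wd[OF F e'(1)] by metis
    obtain d2 where d2: "d2 > 0" "\<And>x y. a \<le> x \<Longrightarrow> x \<le> b \<Longrightarrow> a \<le> y \<Longrightarrow> y \<le> b \<Longrightarrow> \<bar>x - y\<bar> < d2 \<Longrightarrow> norm (G x - G y) < e'"
      using uniform_modulus_wd[OF G e'(1)] by metis
    show "\<exists>d>0. \<forall>x y. a \<le> x \<longrightarrow> x \<le> y \<longrightarrow> y \<le> b \<longrightarrow> y - x < d \<longrightarrow>
        norm (prod (F y) (G y) - prod (F x) (G x) - (LBINT t:{x..y}. prod (f t) (G t) + prod (F t) (g t)))
        \<le> e * (LBINT t:{x..y}. norm (f t) + norm (g t))"
    proof (intro exI[of _ "min d1 d2"] conjI allI impI)
      fix x y assume xy: "a \<le> x" "x \<le> y" "y \<le> b" and d: "y - x < min d1 d2"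
      note fi = wd_onD[OF F xy] and gi = wd_onD[OF G xy]
      have bl: "bounded_linear (\<lambda>u. prod u (G y))" "bounded_linear (\<lambda>u. prod (F x) u)"
        by (rule bounded_linear_left bounded_linear_right)+
      have j1: "set_integrable lborel {x..y} (\<lambda>t. prod (f t) (G y))"
        and e1: "(LBINT t:{x..y}. prod (f t) (G y)) = prod (F y - F x) (G y)"
        using set_integral_bounded_linear[OF bl(1) fi(1)] fi(2) by simp_all
      have j2: "set_integrable lborel {x..y} (\<lambda>t. prod (F x) (g t))"
        and e2: "(LBINT t:{x..y}. prod (F x) (g t)) = prod (F x) (G y - G x)"
        using set_integral_bounded_linear[OF bl(2) gi(1)] gi(2) by simp_all
      note ii = i1[OF xy] i2[OF xy]
      have "prod (F y) (G y) - prod (F x) (G x) - (LBINT t:{x..y}. prod (f t) (G t) + prod (F t) (g t))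
          = (LBINT t:{x..y}. prod (f t) (G y) + prod (F x) (g t)) - (LBINT t:{x..y}. prod (f t) (G t) + prod (F t) (g t))"
        by (simp add: set_integral_add(2)[OF j1 j2] e1 e2 diff_left diff_right)
      also have "\<dots> = (LBINT t:{x..y}. (prod (f t) (G y) + prod (F x) (g t)) - (prod (f t) (G t) + prod (F t) (g t)))"
        by (rule set_integral_diff(2)[symmetric, OF set_integral_add(1)[OF j1 j2] set_integral_add(1)[OF ii]])
      finally have eq: "prod (F y) (G y) - prod (F x) (G x) - (LBINT t:{x..y}. prod (f t) (G t) + prod (F t) (g t)) = \<dots>" .
      have "norm (LBINT t:{x..y}. (prod (f t) (G y) + prod (F x) (g t)) - (prod (f t) (G t) + prod (F t) (g t)))
          \<le> (LBINT t:{x..y}. e * (norm (f t) + norm (g t)))"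
      proof (rule norm_set_integral_le)
        show "set_integrable lborel {x..y} (\<lambda>t. (prod (f t) (G y) + prod (F x) (g t)) - (prod (f t) (G t) + prod (F t) (g t)))"
          by (intro set_integral_diff(1) set_integral_add(1) j1 j2 ii)
        show "set_integrable lborel {x..y} (\<lambda>t. e * (norm (f t) + norm (g t)))"
          by (intro set_integrable_mult_right set_integral_add(1) set_integrable_norm fi gi)
        fix t assume t: "t \<in> {x..y}"
        have n1: "norm (G y - G t) \<le> e'" using t d xy by (intro less_imp_le[OF d2(2)]) auto
        have n2: "norm (F x - F t) \<le> e'" using t d xy by (intro less_imp_le[OF d1(2)]) auto
        have "(prod (f t) (G y) + prod (F x) (g t)) - (prod (f t) (G t) + prod (F t) (g t))
            = prod (f t) (G y - G t) + prod (F x - F t) (g t)" by (simp add: diff_left diff_right)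
        also have "norm \<dots> \<le> norm (f t) * norm (G y - G t) * K + norm (F x - F t) * norm (g t) * K"
          by (intro order_trans[OF norm_triangle_ineq] add_mono K(1))
        also have "\<dots> \<le> norm (f t) * e' * K + e' * norm (g t) * K"
          using n1 n2 K(2) by (intro add_mono mult_right_mono mult_left_mono) auto
        also have "\<dots> = (e' * K) * (norm (f t) + norm (g t))" by (simp add: algebra_simps)
        also have "\<dots> \<le> e * (norm (f t) + norm (g t))" using e' by (intro mult_right_mono) auto
        finally show "norm (prod (f t) (G y) + prod (F x) (g t) - (prod (f t) (G t) + prod (F t) (g t)))
           \<le> e * (norm (f t) + norm (g t))" .
      qed
      then show "norm (prod (F y) (G y) - prod (F x) (G x) - (LBINT t:{x..y}. prod (f t) (G t) + prod (F t) (g t)))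
        \<le> e * (LBINT t:{x..y}. norm (f t) + norm (g t))" unfolding eq by simp
    qed (use d1 d2 in auto)
  qed
qed

text \<open>The increment is compared with the linear term
  \<open>(f y - f x) *\<^sub>R \<Phi>' (f x)\<close>. A derivative within a convex \<open>S\<close>
  covers the closed half-line of a regularised square root as well as the open half-lines on which
  \<open>inverse\<close> or \<open>calib\<close> is smooth.\<close>

lemma wd_on_chain:
  fixes \<Phi> :: "real \<Rightarrow> 'b::euclidean_space" and f :: "real \<Rightarrow> real"
  assumes f: "wd_on a b f f'" and S: "convex S" "\<And>x. a \<le> x \<Longrightarrow> x \<le> b \<Longrightarrow> f x \<in> S"
    and \<Phi>: "\<And>r. r \<in> S \<Longrightarrow> (\<Phi> has_vector_derivative \<Phi>' r) (at r within S)"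
    and cont: "continuous_on S \<Phi>'"
  shows "wd_on a b (\<lambda>x. \<Phi> (f x)) (\<lambda>x. f' x *\<^sub>R \<Phi>' (f x))"
proof -
  have bil: "bounded_bilinear (scaleR :: real \<Rightarrow> 'b \<Rightarrow> 'b)" by (rule bounded_bilinear_scaleR)
  have cf: "continuous_on {a..b} f" by (rule continuous_on_wd[OF f])
  have cc: "continuous_on {a..b} (\<lambda>x. \<Phi>' (f x))"
    using S(2) by (intro continuous_on_compose2[OF cont cf]) auto
  have ii: "set_integrable lborel {x..y} (\<lambda>t. f' t *\<^sub>R \<Phi>' (f t))" if "a \<le> x" "x \<le> y" "y \<le> b" for x y
    by (rule set_integrable_bilinear_continuous[OF bil wd_onD(1)[OF f that] continuous_on_subset[OF cc]])
      (use that in auto)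
  show ?thesis
  proof (rule wd_on_by_modulus[where k="\<lambda>t. norm (f' t)"])
    show "set_integrable lborel {a..b} (\<lambda>x. f' x *\<^sub>R \<Phi>' (f x))" if "a \<le> b" using that by (intro ii) auto
    show "set_integrable lborel {a..b} (\<lambda>t. norm (f' t))" if "a \<le> b"
      using that by (intro set_integrable_norm wd_onD[OF f]) auto
    fix e :: real assume "e > 0"
    have "uniformly_continuous_on {a..b} (\<lambda>x. \<Phi>' (f x))"
      by (intro compact_uniformly_continuous cc) auto
    then obtain d where d: "d > 0" "\<And>x y. x \<in> {a..b} \<Longrightarrow> y \<in> {a..b} \<Longrightarrow> \<bar>x - y\<bar> < d \<Longrightarrow> norm (\<Phi>' (f x) - \<Phi>' (f y)) < e / 2"
      unfolding uniformly_continuous_on_def dist_norm using \<open>e > 0\<close> by (metis half_gt_zero real_norm_def)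
    show "\<exists>d>0. \<forall>x y. a \<le> x \<longrightarrow> x \<le> y \<longrightarrow> y \<le> b \<longrightarrow> y - x < d \<longrightarrow>
        norm (\<Phi> (f y) - \<Phi> (f x) - (LBINT t:{x..y}. f' t *\<^sub>R \<Phi>' (f t))) \<le> e * (LBINT t:{x..y}. norm (f' t))"
    proof (intro exI[of _ d] conjI allI impI d(1))
      fix x y assume xy: "a \<le> x" "x \<le> y" "y \<le> b" and yx: "y - x < d"
      note fi = wd_onD[OF f xy]
      have sub: "{x..y} \<subseteq> {a..b}" using xy by auto
      define p where "p = \<Phi>' (f x)"
      define J where "J = closed_segment (f x) (f y)"
      \<comment> \<open>Every point of the segment is a value \<open>f t\<close> with
        \<open>t\<close> in \<open>{x..y}\<close>, so the modulus of continuity of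
        \<open>\<Phi>' \<circ> f\<close> on \<open>{a..b}\<close> controls \<open>\<Phi>'\<close> on
        the segment.\<close>
      have img: "\<exists>t\<in>{x..y}. f t = r" if "r \<in> J" for r
      proof -
        have cx: "continuous_on {x..y} f" using cf sub by (rule continuous_on_subset)
        have "connected (f ` {x..y})" using cx by (intro connected_continuous_image) auto
        then have "convex (f ` {x..y})" by (simp add: is_interval_connected_1[symmetric] is_interval_convex)
        then have "J \<subseteq> f ` {x..y}" unfolding J_def using xy by (intro closed_segment_subset) auto
        then show ?thesis using that by auto
      qed
      have JS: "J \<subseteq> S" unfolding J_def using xy by (intro closed_segment_subset S) auto
      \<comment> \<open>Mean value inequality for \<open>\<Phi>\<close> minus its linear part of
        slope \<open>p\<close>.\<close>
      have tay: "norm (\<Phi> (f y) - \<Phi> (f x) - (f y - f x) *\<^sub>R p) \<le> (e/2) * norm (f y - f x)"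
      proof -
        have "norm ((\<Phi> (f y) - f y *\<^sub>R p) - (\<Phi> (f x) - f x *\<^sub>R p)) \<le> (e/2) * norm (f y - f x)"
        proof (rule differentiable_bound[where S=J and f'="\<lambda>r u. u *\<^sub>R (\<Phi>' r - p)"])
          show "convex J" "f x \<in> J" "f y \<in> J" by (auto simp: J_def)
          show "((\<lambda>r. \<Phi> r - r *\<^sub>R p) has_derivative (\<lambda>u. u *\<^sub>R (\<Phi>' r - p))) (at r within J)" if "r \<in> J" for r
          proof -
            have "(\<Phi> has_vector_derivative \<Phi>' r) (at r within J)"
              using \<Phi> JS that by (meson has_vector_derivative_within_subset subsetD)
            then show ?thesis unfolding has_vector_derivative_def
              by (auto intro!: derivative_eq_intros simp: scaleR_diff_right)
          qed
          show "onorm (\<lambda>u. u *\<^sub>R (\<Phi>' r - p)) \<le> e/2" if rJ: "r \<in> J" for r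
          proof -
            obtain t where "t \<in> {x..y}" "f t = r" using img[OF rJ] by auto
            then have "norm (\<Phi>' r - p) < e/2" unfolding p_def using d(2)[of t x] sub yx xy by auto
            then have "norm (u *\<^sub>R (\<Phi>' r - p)) \<le> (e/2) * norm u" for u :: real
              using mult_left_mono[of "norm (\<Phi>' r - p)" "e/2" "\<bar>u\<bar>"] by (simp add: mult.commute)
            then show ?thesis by (intro onorm_le)
          qed
        qed
        moreover have "(\<Phi> (f y) - f y *\<^sub>R p) - (\<Phi> (f x) - f x *\<^sub>R p) = \<Phi> (f y) - \<Phi> (f x) - (f y - f x) *\<^sub>R p"
          by (simp only: scaleR_diff_left) simp
        ultimately show ?thesis by simp
      qed
      have j: "set_integrable lborel {x..y} (\<lambda>t. f' t *\<^sub>R p)"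
        and je: "(LBINT t:{x..y}. f' t *\<^sub>R p) = (f y - f x) *\<^sub>R p"
        using set_integral_bounded_linear[OF bounded_linear_scaleR_left fi(1), of p] fi(2) by simp_all
      have "norm ((LBINT t:{x..y}. f' t *\<^sub>R p) - (LBINT t:{x..y}. f' t *\<^sub>R \<Phi>' (f t)))
          = norm (LBINT t:{x..y}. f' t *\<^sub>R p - f' t *\<^sub>R \<Phi>' (f t))"
        by (simp add: set_integral_diff(2)[OF j ii[OF xy]])
      also have "\<dots> \<le> (LBINT t:{x..y}. (e/2) * norm (f' t))"
      proof (rule norm_set_integral_le)
        show "set_integrable lborel {x..y} (\<lambda>t. f' t *\<^sub>R p - f' t *\<^sub>R \<Phi>' (f t))"
          by (intro set_integral_diff(1) j ii xy)
        show "set_integrable lborel {x..y} (\<lambda>t. (e/2) * norm (f' t))"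
          by (intro set_integrable_mult_right set_integrable_norm fi)
        fix t assume "t \<in> {x..y}"
        then have "norm (p - \<Phi>' (f t)) \<le> e/2" unfolding p_def using sub yx xy by (intro less_imp_le[OF d(2)]) auto
        then have "norm (f' t) * norm (p - \<Phi>' (f t)) \<le> norm (f' t) * (e/2)" by (intro mult_left_mono) auto
        then show "norm (f' t *\<^sub>R p - f' t *\<^sub>R \<Phi>' (f t)) \<le> (e/2) * norm (f' t)"
          by (simp add: scaleR_diff_right[symmetric] mult.commute)
      qed
      finally have A: "norm ((f y - f x) *\<^sub>R p - (LBINT t:{x..y}. f' t *\<^sub>R \<Phi>' (f t)))
          \<le> (e/2) * (LBINT t:{x..y}. norm (f' t))" by (simp add: je)
      have "norm (f y - f x) \<le> (LBINT t:{x..y}. norm (f' t))"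
        unfolding fi(2) by (rule set_integral_norm_bound[OF fi(1)])
      then have "(e/2) * norm (f y - f x) \<le> (e/2) * (LBINT t:{x..y}. norm (f' t))"
        using \<open>e > 0\<close> by (intro mult_left_mono) auto
      then have B: "norm (\<Phi> (f y) - \<Phi> (f x) - (f y - f x) *\<^sub>R p) \<le> (e/2) * (LBINT t:{x..y}. norm (f' t))"
        using tay by (rule order_trans[rotated])
      have "norm (\<Phi> (f y) - \<Phi> (f x) - (LBINT t:{x..y}. f' t *\<^sub>R \<Phi>' (f t)))
          \<le> (e/2) * (LBINT t:{x..y}. norm (f' t)) + (e/2) * (LBINT t:{x..y}. norm (f' t))"
        using norm_triangle_mono[OF B A] by simp
      then show "norm (\<Phi> (f y) - \<Phi> (f x) - (LBINT t:{x..y}. f' t *\<^sub>R \<Phi>' (f t))) \<le> e * (LBINT t:{x..y}. norm (f' t))"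
        by (simp only: distrib_right[symmetric]) simp
    qed
  qed
qed

section \<open>Modulus and phase\<close>

lemma wd_on_indefinite:
  fixes f :: "real \<Rightarrow> 'a::{banach, second_countable_topology}"
  assumes "a \<le> b \<Longrightarrow> set_integrable lborel {a..b} f"
  shows "wd_on a b (\<lambda>x. LBINT t:{a..x}. f t) f"
proof (rule wd_onI[OF assms])
  fix x y assume xy: "a \<le> x" "x \<le> y" "y \<le> b"
  have "set_integrable lborel {a..y} f" using xy by (intro set_integrable_subset[OF assms]) auto
  from set_integral_combine[OF this xy(1,2)]
  show "(LBINT t:{a..y}. f t) - (LBINT t:{a..x}. f t) = (LBINT t:{x..y}. f t)" by simp
qed

lemma wd_on_cong:
  assumes "wd_on a b w g" "\<And>x. a \<le> x \<Longrightarrow> x \<le> b \<Longrightarrow> w x = w' x" "\<And>x. a \<le> x \<Longrightarrow> x \<le> b \<Longrightarrow> g x = g' x"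
  shows "wd_on a b w' g'"
  unfolding wd_on_def
proof (intro allI impI conjI)
  fix x y assume xy: "a \<le> x" "x \<le> y" "y \<le> b"
  note W = wd_onD[OF assms(1) xy]
  have eq: "\<And>t. t \<in> {x..y} \<Longrightarrow> g t = g' t" using xy assms(3) by auto
  have "(\<lambda>t. indicator {x..y} t *\<^sub>R g t) = (\<lambda>t. indicator {x..y} t *\<^sub>R g' t)"
    using eq by (auto simp: indicator_def fun_eq_iff)
  then show "set_integrable lborel {x..y} g'" using W(1) by (simp add: set_integrable_def)
  have "(LBINT t:{x..y}. g t) = (LBINT t:{x..y}. g' t)"
    by (rule set_lebesgue_integral_cong) (use eq in auto)
  then show "w' y - w' x = (LBINT t:{x..y}. g' t)" using W(2) assms(2) xy by simp
qed

lemma norm_square_complex: "(norm (z::complex))\<^sup>2 = inner z z"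
  by (simp add: power2_norm_eq_inner)

text \<open>The norm is not differentiable at 0, so it is replaced by
  \<open>sqrt ((norm (w x))\<^sup>2 + 1/(n+1))\<close>, whose derivative is dominated by
  \<open>norm (d x)\<close>. Dominated convergence gives the limit; at a zero of \<open>w\<close>
  every approximating derivative is 0, in agreement with \<open>sgn 0 = 0\<close>.\<close>

lemma wd_on_norm:
  fixes w d :: "real \<Rightarrow> complex"
  assumes w: "wd_on a b w d"
  shows "wd_on a b (\<lambda>x. norm (w x)) (\<lambda>x. inner (sgn (w x)) (d x))"
proof -
  define s where "s n x = sqrt ((norm (w x))\<^sup>2 + inverse (real (Suc n)))" for n x
  define k where "k n x = inner (w x) (d x) / s n x" for n x
  have pos: "(norm (w x))\<^sup>2 + inverse (real (Suc n)) > 0" for n x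
    by (intro add_nonneg_pos) auto
  have s_pos: "s n x > 0" for n x using pos by (simp add: s_def)
  have wk: "wd_on a b (s n) (k n)" for n
  proof -
    have "wd_on a b (\<lambda>x. inner (w x) (w x)) (\<lambda>x. inner (d x) (w x) + inner (w x) (d x))"
      by (rule wd_on_bilinear[OF bounded_bilinear_inner w w])
    then have 1: "wd_on a b (\<lambda>x. (norm (w x))\<^sup>2) (\<lambda>x. 2 * inner (w x) (d x))"
      by (simp add: norm_square_complex inner_commute[of "d _" "w _"])
    have "wd_on a b (\<lambda>x. sqrt ((norm (w x))\<^sup>2 + inverse (real (Suc n))))
        (\<lambda>x. (2 * inner (w x) (d x)) *\<^sub>R (inverse (sqrt ((norm (w x))\<^sup>2 + inverse (real (Suc n)))) / 2))"
    proof (rule wd_on_chain[OF 1, where S="{0..}" and \<Phi>="\<lambda>r. sqrt (r + inverse (real (Suc n)))"])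
      fix r :: real assume "r \<in> {0..}"
      then have "r + inverse (real (Suc n)) > 0" by (intro add_nonneg_pos) auto
      then show "((\<lambda>r. sqrt (r + inverse (real (Suc n)))) has_vector_derivative
          inverse (sqrt (r + inverse (real (Suc n)))) / 2) (at r within {0..})"
        unfolding has_real_derivative_iff_has_vector_derivative[symmetric]
        by (auto intro!: derivative_eq_intros)
    next
      have "sqrt (r + inverse (real (Suc n))) \<noteq> 0" if "r \<ge> 0" for r
        using that add_nonneg_pos[of r "inverse (real (Suc n))"] by simp
      then show "continuous_on {0..} (\<lambda>r. inverse (sqrt (r + inverse (real (Suc n)))) / 2)"
        by (intro continuous_intros) auto
    qed auto
    then show ?thesis by (rule wd_on_cong) (auto simp: s_def k_def field_simps)
  qed
  have k_bound: "norm (k n x) \<le> norm (d x)" for n x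
  proof -
    have "norm (w x) \<le> s n x" unfolding s_def by (rule real_le_rsqrt) simp
    moreover have "\<bar>inner (w x) (d x)\<bar> \<le> norm (w x) * norm (d x)" by (rule Cauchy_Schwarz_ineq2)
    ultimately have "\<bar>inner (w x) (d x)\<bar> \<le> s n x * norm (d x)"
      by (meson mult_right_mono norm_ge_zero order_trans)
    then show ?thesis using s_pos[of n x] by (simp add: k_def pos_divide_le_eq mult.commute)
  qed
  have s_lim: "(\<lambda>n. s n x) \<longlonglongrightarrow> norm (w x)" for x
  proof -
    have "(\<lambda>n. sqrt ((norm (w x))\<^sup>2 + inverse (real (Suc n)))) \<longlonglongrightarrow> sqrt ((norm (w x))\<^sup>2 + 0)"
      by (intro tendsto_intros LIMSEQ_inverse_real_of_nat)
    then show ?thesis by (simp add: s_def)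
  qed
  have k_lim: "(\<lambda>n. k n x) \<longlonglongrightarrow> inner (sgn (w x)) (d x)" for x
  proof (cases "w x = 0")
    case False
    then have "(\<lambda>n. inner (w x) (d x) / s n x) \<longlonglongrightarrow> inner (w x) (d x) / norm (w x)"
      by (intro tendsto_intros s_lim) auto
    then show ?thesis by (simp add: k_def sgn_div_norm divide_inverse mult.commute)
  qed (simp add: k_def)
  show ?thesis
    unfolding wd_on_def
  proof (intro allI impI)
    fix x y assume xy: "a \<le> x" "x \<le> y" "y \<le> b"
    let ?I = "indicator {x..y} :: real \<Rightarrow> real"
    have di: "integrable lborel (\<lambda>t. norm (?I t *\<^sub>R d t))"
      using wd_onD(1)[OF w xy] unfolding set_integrable_def by (rule integrable_norm)
    have ki: "integrable lborel (\<lambda>t. ?I t *\<^sub>R k n t)" for n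
      using wd_onD(1)[OF wk xy] unfolding set_integrable_def .
    have mk: "(\<lambda>t. ?I t *\<^sub>R k n t) \<in> borel_measurable lborel" for n
      using ki by (rule borel_measurable_integrable)
    then have mk': "(\<lambda>t. ?I t *\<^sub>R k n t) \<in> borel_measurable borel" for n by simp
    have lim: "(\<lambda>n. ?I t *\<^sub>R k n t) \<longlonglongrightarrow> ?I t *\<^sub>R inner (sgn (w t)) (d t)" for t
      by (intro tendsto_intros k_lim)
    have ml: "(\<lambda>t. ?I t *\<^sub>R inner (sgn (w t)) (d t)) \<in> borel_measurable lborel"
      by (rule borel_measurable_LIMSEQ_real[OF lim mk])
    have bnd: "norm (?I t *\<^sub>R k n t) \<le> norm (?I t *\<^sub>R d t)" for n t
      using k_bound[of n t] by (auto simp: indicator_def)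
    have I1: "integrable lborel (\<lambda>t. ?I t *\<^sub>R inner (sgn (w t)) (d t))"
      by (rule integrable_dominated_convergence[OF ml _ di, where s="\<lambda>n t. ?I t *\<^sub>R k n t"])
        (auto intro!: AE_I2 lim bnd mk' simp del: real_scaleR_def norm_scaleR real_norm_def)
    have I2: "(\<lambda>n. LBINT t. ?I t *\<^sub>R k n t) \<longlonglongrightarrow> (LBINT t. ?I t *\<^sub>R inner (sgn (w t)) (d t))"
      by (rule integral_dominated_convergence[OF ml _ di])
        (auto intro!: AE_I2 lim bnd mk' simp del: real_scaleR_def norm_scaleR real_norm_def)
    have "(LBINT t. ?I t *\<^sub>R k n t) = s n y - s n x" for n
      using wd_onD(2)[OF wk xy] by (simp add: set_lebesgue_integral_def)
    then have "(\<lambda>n. s n y - s n x) \<longlonglongrightarrow> (LBINT t. ?I t *\<^sub>R inner (sgn (w t)) (d t))" using I2 by simp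
    moreover have "(\<lambda>n. s n y - s n x) \<longlonglongrightarrow> norm (w y) - norm (w x)" by (intro tendsto_intros s_lim)
    ultimately have "norm (w y) - norm (w x) = (LBINT t. ?I t *\<^sub>R inner (sgn (w t)) (d t))"
      using LIMSEQ_unique by blast
    then show "set_integrable lborel {x..y} (\<lambda>x. inner (sgn (w x)) (d x)) \<and>
       norm (w y) - norm (w x) = (LBINT t:{x..y}. inner (sgn (w t)) (d t))"
      using I1 by (simp add: set_integrable_def set_lebesgue_integral_def)
  qed
qed

text \<open>For \<open>v = \<rho> e\<^sup>i\<^sup>\<phi>\<close> with derivative \<open>d\<close>, \<open>rad\<close> is \<open>\<rho>'\<close>, \<open>ang\<close> is \<open>\<rho>\<phi>'\<close>, and \<open>ort\<close> is the non-radial part of \<open>d\<close>.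
  Where \<open>v = 0\<close> we have \<open>sgn v = 0\<close>, so \<open>rad\<close> and \<open>ang\<close> vanish there and \<open>ort\<close> is all of \<open>d\<close>.\<close>

definition rad :: "(real \<Rightarrow> complex) \<Rightarrow> (real \<Rightarrow> complex) \<Rightarrow> real \<Rightarrow> real" where
  "rad v d x = inner (sgn (v x)) (d x)"

definition ang :: "(real \<Rightarrow> complex) \<Rightarrow> (real \<Rightarrow> complex) \<Rightarrow> real \<Rightarrow> real" where
  "ang v d x = inner (\<i> * sgn (v x)) (d x)"

definition ort :: "(real \<Rightarrow> complex) \<Rightarrow> (real \<Rightarrow> complex) \<Rightarrow> real \<Rightarrow> complex" where
  "ort v d x = d x - rad v d x *\<^sub>R sgn (v x)"

lemma cinner_ang: "cinner (\<i> * v x) (d x) = norm (v x) * ang v d x"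
proof (cases "v x = 0")
  case False
  have "norm (v x) *\<^sub>R sgn (v x) = v x" using False by (simp add: sgn_div_norm)
  then have "cinner (\<i> * v x) (d x) = inner (\<i> * (norm (v x) *\<^sub>R sgn (v x))) (d x)"
    by (simp add: cinner_def inner_complex_def)
  also have "\<dots> = norm (v x) * ang v d x" by (simp add: ang_def)
  finally show ?thesis .
qed (simp add: cinner_def)

text \<open>Off the zeros, \<open>sgn (v x)\<close> and \<open>\<i> * sgn (v x)\<close> form a real
  orthonormal basis of the plane.\<close>

lemma ort_eq_ang: "v x \<noteq> 0 \<Longrightarrow> ort v d x = ang v d x *\<^sub>R (\<i> * sgn (v x))"
proof -
  assume "v x \<noteq> 0"
  then have "norm (sgn (v x)) = 1" by (simp add: norm_sgn)
  then have "(Re (sgn (v x)))\<^sup>2 + (Im (sgn (v x)))\<^sup>2 = 1"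
    by (metis cmod_power2 one_power2)
  then show ?thesis
    by (simp add: ort_def rad_def ang_def inner_complex_def complex_eq_iff) algebra
qed

lemma norm_ort_sq: "(norm (ort v d x))\<^sup>2 = (norm (d x))\<^sup>2 - (rad v d x)\<^sup>2"
proof (cases "v x = 0")
  case False
  then have 1: "inner (sgn (v x)) (sgn (v x)) = 1"
    by (simp add: norm_square_complex[symmetric] norm_sgn)
  show ?thesis
    unfolding norm_square_complex ort_def
    by (simp add: inner_diff_left inner_diff_right 1 inner_commute[of "d x" "sgn (v x)"] rad_def power2_eq_square)
qed (simp add: ort_def rad_def)

lemma abs_ang_le: "\<bar>ang v d x\<bar> \<le> norm (ort v d x)"
  by (cases "v x = 0") (auto simp: ang_def ort_eq_ang norm_mult norm_sgn)

lemma abs_rad_le: "\<bar>rad v d x\<bar> \<le> norm (d x)"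
  using Cauchy_Schwarz_ineq2[of "sgn (v x)" "d x"] by (auto simp: rad_def norm_sgn split: if_splits)

lemma norm_ort_le: "norm (ort v d x) \<le> norm (d x)"
  by (rule power2_le_imp_le) (auto simp: norm_ort_sq)

text \<open>The direction \<open>s = sgn v\<close> solves \<open>s' = f * \<i> * s\<close> with
  \<open>f = ang / norm v\<close>, so \<open>s\<close> times \<open>cis\<close> of minus the
  primitive of \<open>f\<close> has zero weak derivative. The phase thus appears as an integral
  rather than as a branch of \<open>Arg\<close>.\<close>

lemma sgn_lifting:
  assumes v: "wd_on a b v d" and ab: "a \<le> b" and nz: "\<And>x. a \<le> x \<Longrightarrow> x \<le> b \<Longrightarrow> v x \<noteq> 0"
  shows "set_integrable lborel {a..b} (\<lambda>t. ang v d t / norm (v t))"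
    and "sgn (v b) = sgn (v a) * cis (LBINT t:{a..b}. ang v d t / norm (v t))"
proof -
  let ?f = "\<lambda>t. ang v d t / norm (v t)"
  have cv: "continuous_on {a..b} v" by (rule continuous_on_wd[OF v])
  have "continuous_on {a..b} (\<lambda>x. (1 / norm (v x)) *\<^sub>R (\<i> * ((1 / norm (v x)) *\<^sub>R v x)))"
    using nz by (intro continuous_intros cv) auto
  from set_integrable_bilinear_continuous[OF bounded_bilinear_inner wd_onD(1)[OF v] this]
  have "set_integrable lborel {a..b} (\<lambda>t. inner (d t) ((1 / norm (v t)) *\<^sub>R (\<i> * ((1 / norm (v t)) *\<^sub>R v t))))"
    using ab by auto
  then show fi: "set_integrable lborel {a..b} ?f"
    by (simp add: ang_def inner_commute sgn_div_norm divide_inverse mult_ac)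
  define \<phi> where "\<phi> x = (LBINT t:{a..x}. ?f t)" for x
  have \<phi>: "wd_on a b \<phi> ?f" unfolding \<phi>_def by (rule wd_on_indefinite[OF fi])
  have rho: "wd_on a b (\<lambda>x. norm (v x)) (rad v d)" using wd_on_norm[OF v] by (simp add: rad_def[abs_def])
  have "wd_on a b (\<lambda>x. inverse (norm (v x))) (\<lambda>x. rad v d x *\<^sub>R - (inverse (norm (v x)))\<^sup>2)"
  proof (rule wd_on_chain[OF rho, where S="{0<..}" and \<Phi>=inverse])
    show "(inverse has_vector_derivative - (inverse r)\<^sup>2) (at r within {0<..})" if "r \<in> {0<..}" for r :: real
      unfolding has_real_derivative_iff_has_vector_derivative[symmetric] using that
      by (auto intro!: derivative_eq_intros simp: power2_eq_square)
    show "continuous_on {0<..} (\<lambda>r. - (inverse r)\<^sup>2 :: real)" by (intro continuous_intros) auto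
  qed (use nz in auto)
  from wd_on_bilinear[OF bounded_bilinear_scaleR this v]
  have sg: "wd_on a b (\<lambda>x. sgn (v x)) (\<lambda>x. ?f x *\<^sub>R (\<i> * sgn (v x)))"
  proof (rule wd_on_cong)
    fix x assume x: "a \<le> x" "x \<le> b"
    have "(rad v d x *\<^sub>R - (inverse (norm (v x)))\<^sup>2) *\<^sub>R v x + inverse (norm (v x)) *\<^sub>R d x
        = inverse (norm (v x)) *\<^sub>R ort v d x"
      by (simp add: ort_def sgn_div_norm power2_eq_square scaleR_diff_right mult_ac)
    then show "(rad v d x *\<^sub>R - (inverse (norm (v x)))\<^sup>2) *\<^sub>R v x + inverse (norm (v x)) *\<^sub>R d x
        = ?f x *\<^sub>R (\<i> * sgn (v x))"
      by (simp add: ort_eq_ang[where v=v and d=d, OF nz[OF x]] divide_inverse mult.commute)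
  qed (auto simp: sgn_div_norm)
  have cs: "wd_on a b (\<lambda>x. cis (- \<phi> x)) (\<lambda>x. ?f x *\<^sub>R (- \<i> * cis (- \<phi> x)))"
  proof (rule wd_on_chain[OF \<phi>, where S=UNIV and \<Phi>="\<lambda>r. cis (- r)"])
    show "((\<lambda>r. cis (- r)) has_vector_derivative - \<i> * cis (- r)) (at r within UNIV)" for r
      unfolding has_vector_derivative_def by (auto intro!: derivative_eq_intros)
    show "continuous_on UNIV (\<lambda>r. - \<i> * cis (- r))" by (intro continuous_intros)
  qed auto
  from wd_on_bilinear[OF bounded_bilinear_mult sg cs]
  have "wd_on a b (\<lambda>x. sgn (v x) * cis (- \<phi> x)) (\<lambda>x. 0)"
    by (rule wd_on_cong) (auto simp: scaleR_conv_of_real algebra_simps)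
  from wd_onD(2)[OF this, of a b] ab
  have "sgn (v b) * cis (- \<phi> b) = sgn (v a) * cis (- \<phi> a)" by simp
  moreover have "\<phi> a = 0"
    using wd_onD(2)[OF \<phi>, of a a] ab by (simp add: \<phi>_def)
  ultimately have "sgn (v b) * cis (- \<phi> b) * cis (\<phi> b) = sgn (v a) * cis (\<phi> b)" by simp
  then have "sgn (v b) * (cis (- \<phi> b) * cis (\<phi> b)) = sgn (v a) * cis (\<phi> b)" by (simp add: mult.assoc)
  then show "sgn (v b) = sgn (v a) * cis (LBINT t:{a..b}. ?f t)" by (simp add: \<phi>_def cis_mult)
qed

section \<open>Square-integrable functions and finite energy\<close>

definition L2 :: "(real \<Rightarrow> real) \<Rightarrow> bool" where
  "L2 f \<longleftrightarrow> f \<in> borel_measurable lborel \<and> integrable lborel (\<lambda>x. (f x)\<^sup>2)"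

definition nL2 :: "(real \<Rightarrow> real) \<Rightarrow> real" where
  "nL2 f = sqrt (LBINT x. (f x)\<^sup>2)"

lemma nL2_nonneg [simp]: "0 \<le> nL2 f"
  by (simp add: nL2_def)

lemma nL2_sq: "(nL2 f)\<^sup>2 = (LBINT x. (f x)\<^sup>2)"
  by (simp add: nL2_def)

lemma L2_integrable_mult:
  assumes "L2 f" "L2 g"
  shows "integrable lborel (\<lambda>x. f x * g x)"
proof (rule Bochner_Integration.integrable_bound)
  show "integrable lborel (\<lambda>x. (f x)\<^sup>2 + (g x)\<^sup>2)"
    using assms by (auto simp: L2_def intro: Bochner_Integration.integrable_add)
  show "(\<lambda>x. f x * g x) \<in> borel_measurable lborel" using assms by (auto simp: L2_def)
  have "\<bar>f x * g x\<bar> \<le> (f x)\<^sup>2 + (g x)\<^sup>2" for x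
  proof -
    have "0 \<le> (\<bar>f x\<bar> - \<bar>g x\<bar>)\<^sup>2" "0 \<le> \<bar>f x\<bar> * \<bar>g x\<bar>" by auto
    then show ?thesis unfolding power2_diff abs_mult power2_abs by linarith
  qed
  then show "AE x in lborel. norm (f x * g x) \<le> norm ((f x)\<^sup>2 + (g x)\<^sup>2)" by auto
qed

lemma L2_Cauchy_Schwarz:
  assumes "L2 f" "L2 g"
  shows "\<bar>LBINT x. f x * g x\<bar> \<le> nL2 f * nL2 g"
proof -
  define A where "A = (LBINT x. (f x)\<^sup>2)"
  define B where "B = (LBINT x. (g x)\<^sup>2)"
  define C where "C = (LBINT x. f x * g x)"
  have i: "integrable lborel (\<lambda>x. (f x)\<^sup>2)" "integrable lborel (\<lambda>x. (g x)\<^sup>2)" "integrable lborel (\<lambda>x. f x * g x)"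
    using assms L2_integrable_mult by (auto simp: L2_def)
  have A0: "A \<ge> 0" and B0: "B \<ge> 0" by (auto simp: A_def B_def)
  have q: "0 \<le> t\<^sup>2 * A - 2 * t * C + B" for t
  proof -
    have "0 \<le> (LBINT x. (t * f x - g x)\<^sup>2)" by simp
    also have "(\<lambda>x. (t * f x - g x)\<^sup>2) = (\<lambda>x. t\<^sup>2 * (f x)\<^sup>2 - 2 * t * (f x * g x) + (g x)\<^sup>2)"
      by (auto simp: power2_eq_square algebra_simps)
    also have "(LBINT x. t\<^sup>2 * (f x)\<^sup>2 - 2 * t * (f x * g x) + (g x)\<^sup>2) = t\<^sup>2 * A - 2 * t * C + B"
      using i by (simp add: A_def B_def C_def)
    finally show ?thesis .
  qed
  have "C\<^sup>2 \<le> A * B"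
  proof (cases "A = 0")
    case True
    have "C = 0"
    proof (rule ccontr)
      assume "C \<noteq> 0"
      \<comment> \<open>With \<open>A = 0\<close> this value of \<open>t\<close> turns
        \<open>q\<close> into \<open>0 \<le> -1\<close>.\<close>
      then show False using q[of "(B + 1) / (2 * C)"] True by simp
    qed
    then show ?thesis using A0 B0 by simp
  next
    case False
    then show ?thesis using q[of "C / A"] A0 by (simp add: power2_eq_square field_simps)
  qed
  then have "\<bar>C\<bar> \<le> sqrt (A * B)" using real_sqrt_le_mono[of "C\<^sup>2"] by simp
  then show ?thesis by (simp add: nL2_def A_def B_def C_def real_sqrt_mult)
qed

lemma L2_bound:
  assumes "L2 f" "g \<in> borel_measurable lborel" "\<And>x. \<bar>g x\<bar> \<le> \<bar>f x\<bar>"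
  shows "L2 g"
  unfolding L2_def
proof
  show "integrable lborel (\<lambda>x. (g x)\<^sup>2)"
  proof (rule Bochner_Integration.integrable_bound)
    show "integrable lborel (\<lambda>x. (f x)\<^sup>2)" using assms by (simp add: L2_def)
    show "AE x in lborel. norm ((g x)\<^sup>2) \<le> norm ((f x)\<^sup>2)"
      using assms(3) by (auto simp: abs_le_square_iff)
  qed (use assms in auto)
qed (use assms in auto)

lemma L2_scale: "L2 f \<Longrightarrow> L2 (\<lambda>x. c * f x)"
  by (auto simp: L2_def power_mult_distrib)

lemma L2_add: "L2 f \<Longrightarrow> L2 g \<Longrightarrow> L2 (\<lambda>x. f x + g x)"
  using L2_integrable_mult[of f g] by (auto simp: L2_def power2_sum mult.assoc)

lemma L2_diff: "L2 f \<Longrightarrow> L2 g \<Longrightarrow> L2 (\<lambda>x. f x - g x)"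
  using L2_add[of f "\<lambda>x. (-1) * g x"] L2_scale[of g "-1"] by simp

lemma L2_abs: "L2 f \<Longrightarrow> L2 (\<lambda>x. \<bar>f x\<bar>)"
  by (auto simp: L2_def)

lemma nL2_abs: "nL2 (\<lambda>x. \<bar>f x\<bar>) = nL2 f"
  by (simp add: nL2_def)

lemma L2_indicator:
  assumes "a \<le> b"
  shows "L2 (indicator {a..b})" "nL2 (indicator {a..b}) = sqrt (b - a)"
proof -
  have "(indicator {a..b} x :: real)\<^sup>2 = indicator {a..b} x" for x :: real by (auto simp: indicator_def)
  then show "L2 (indicator {a..b})" "nL2 (indicator {a..b}) = sqrt (b - a)"
    using assms by (auto simp: L2_def nL2_def)
qed

lemma L2_set_integral_le:
  assumes f: "L2 f" and "a \<le> b"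
  shows "set_integrable lborel {a..b} f" "(LBINT x:{a..b}. \<bar>f x\<bar>) \<le> sqrt (b - a) * nL2 f"
proof -
  show "set_integrable lborel {a..b} f"
    using L2_integrable_mult[OF L2_indicator(1)[OF assms(2)] f] by (simp add: set_integrable_def)
  show "(LBINT x:{a..b}. \<bar>f x\<bar>) \<le> sqrt (b - a) * nL2 f"
    using L2_Cauchy_Schwarz[OF L2_indicator(1)[OF assms(2)] L2_abs[OF f]] L2_indicator(2)[OF assms(2)]
    by (simp add: set_lebesgue_integral_def nL2_abs)
qed

lemma abs_integral_le_L2:
  assumes "L2 f" "L2 g" "k \<in> borel_measurable lborel" "\<And>x. x \<in> S \<Longrightarrow> \<bar>k x\<bar> \<le> \<bar>f x * g x\<bar>" "S \<in> sets lborel"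
  shows "set_integrable lborel S k" "\<bar>LBINT x:S. k x\<bar> \<le> nL2 f * nL2 g"
proof -
  have fg: "integrable lborel (\<lambda>x. \<bar>f x\<bar> * \<bar>g x\<bar>)" using assms(1,2) by (intro L2_integrable_mult L2_abs)
  have le: "\<bar>indicator S x *\<^sub>R k x\<bar> \<le> \<bar>f x\<bar> * \<bar>g x\<bar>" for x
    using assms(4)[of x] by (auto simp: indicator_def abs_mult)
  have [measurable]: "S \<in> sets borel" "k \<in> borel_measurable borel" using assms by auto
  show si: "set_integrable lborel S k"
    unfolding set_integrable_def
    by (rule Bochner_Integration.integrable_bound[OF fg]) (use le in auto)
  have "\<bar>LBINT x:S. k x\<bar> \<le> (LBINT x. \<bar>indicator S x *\<^sub>R k x\<bar>)"
    unfolding set_lebesgue_integral_def by (rule integral_abs_bound)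
  also have "\<dots> \<le> (LBINT x. \<bar>f x\<bar> * \<bar>g x\<bar>)"
    using si le fg by (intro integral_mono) (auto simp: set_integrable_def)
  also have "\<dots> \<le> nL2 f * nL2 g"
    using L2_Cauchy_Schwarz[OF L2_abs[OF assms(1)] L2_abs[OF assms(2)]] by (simp add: nL2_abs)
  finally show "\<bar>LBINT x:S. k x\<bar> \<le> nL2 f * nL2 g" .
qed

section \<open>Limits at infinity\<close>

lemma half_line_integrals:
  fixes F f :: "real \<Rightarrow> real"
  assumes "\<And>a b. wd_on a b F f" "integrable lborel f"
  shows "(F \<longlongrightarrow> F a + (LBINT x:{a..}. f x)) at_top"
    and "(F \<longlongrightarrow> F a - (LBINT x:{..a}. f x)) at_bot"
proof -
  have si: "set_integrable lborel S f" if "S \<in> sets lborel" for S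
    using assms(2) that unfolding set_integrable_def by (intro integrable_mult_indicator) auto
  have "((\<lambda>b. F a + (LBINT x:{a..b}. f x)) \<longlongrightarrow> F a + (LBINT x:{a..}. f x)) at_top"
    by (intro tendsto_intros tendsto_set_lebesgue_integral_at_top si) auto
  moreover have "eventually (\<lambda>b. F a + (LBINT x:{a..b}. f x) = F b) at_top"
    using eventually_ge_at_top[of a]
  proof eventually_elim
    case (elim b) then show ?case using wd_onD(2)[OF assms(1)[of a b], of a b] by simp
  qed
  ultimately show "(F \<longlongrightarrow> F a + (LBINT x:{a..}. f x)) at_top" by (rule Lim_transform_eventually)
  have "((\<lambda>b. F a - (LBINT x:{b..a}. f x)) \<longlongrightarrow> F a - (LBINT x:{..a}. f x)) at_bot"
    by (intro tendsto_intros tendsto_set_lebesgue_integral_at_bot si) auto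
  moreover have "eventually (\<lambda>b. F a - (LBINT x:{b..a}. f x) = F b) at_bot"
    using eventually_le_at_bot[of a]
  proof eventually_elim
    case (elim b) then show ?case using wd_onD(2)[OF assms(1)[of b a], of b a] by simp
  qed
  ultimately show "(F \<longlongrightarrow> F a - (LBINT x:{..a}. f x)) at_bot" by (rule Lim_transform_eventually)
qed

lemma set_integral_reflect_Icc:
  fixes f :: "real \<Rightarrow> 'a::{banach, second_countable_topology}"
  shows "set_integrable lborel {-b..-a} f \<Longrightarrow> set_integrable lborel {a..b} (\<lambda>x. f (- x))"
    and "(LBINT x:{a..b}. f (- x)) = (LBINT x:{-b..-a}. f x)"
proof -
  have eq: "{x. - x \<in> {- b..- a}} = {a..b}" by auto
  show "(LBINT x:{a..b}. f (- x)) = (LBINT x:{-b..-a}. f x)"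
    by (subst (2) set_integral_reflect) (simp only: eq)
  assume "set_integrable lborel {-b..-a} f"
  then have "integrable lborel (\<lambda>x. indicator {-b..-a} (0 + (-1) * x) *\<^sub>R f (0 + (-1) * x))"
    unfolding set_integrable_def by (rule lborel_integrable_real_affine) simp
  moreover have "indicator {-b..-a} (0 + (-1) * x) = (indicator {a..b} x :: real)" for x
    by (auto simp: indicator_def)
  ultimately show "set_integrable lborel {a..b} (\<lambda>x. f (- x))" by (simp add: set_integrable_def)
qed

lemma wd_on_reflect:
  assumes "wd_on (-b) (-a) w g"
  shows "wd_on a b (\<lambda>x. w (- x)) (\<lambda>x. - g (- x))"
  unfolding wd_on_def
proof (intro allI impI conjI)
  fix x y assume xy: "a \<le> x" "x \<le> y" "y \<le> b"
  note W = wd_onD[OF assms, of "-y" "-x"]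
  have i: "set_integrable lborel {x..y} (\<lambda>t. g (- t))"
    using W xy by (intro set_integral_reflect_Icc(1)) auto
  then show "set_integrable lborel {x..y} (\<lambda>x. - g (- x))" by (simp add: set_integrable_def)
  have "(LBINT t:{x..y}. - g (- t)) = - (LBINT t:{-y..-x}. g t)"
    by (simp add: set_integral_uminus[OF i] set_integral_reflect_Icc(2))
  then show "w (- y) - w (- x) = (LBINT t:{x..y}. - g (- t))"
    using W(2) xy by (simp add: algebra_simps)
qed

text \<open>An integrable derivative makes \<open>F\<close> converge, and a nonzero limit
  contradicts integrability of \<open>F\<close>. The limit at minus infinity follows by
  reflection.\<close>

lemma integrable_wd_tendsto_0:
  fixes F f :: "real \<Rightarrow> real"
  assumes F: "\<And>a b. wd_on a b F f" "integrable lborel f" "integrable lborel F" "\<And>x. F x \<ge> 0"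
  shows "(F \<longlongrightarrow> 0) at_top" "(F \<longlongrightarrow> 0) at_bot"
proof -
  have top: "(G \<longlongrightarrow> 0) at_top"
    if G: "\<And>a b. wd_on a b G g" "integrable lborel g" "integrable lborel G" "\<And>x. G x \<ge> 0" for G g :: "real \<Rightarrow> real"
  proof -
    define L where "L = G 0 + (LBINT x:{0..}. g x)"
    have lim: "(G \<longlongrightarrow> L) at_top" unfolding L_def by (rule half_line_integrals[OF G(1,2)])
    have "L \<ge> 0" using lim G(4) by (intro tendsto_lowerbound[OF lim]) auto
    have "\<not> L > 0"
    proof
      assume "L > 0"
      then have "eventually (\<lambda>x. G x > L / 2) at_top" using order_tendstoD(1)[OF lim, of "L/2"] by simp
      then obtain R where R: "\<And>x. x \<ge> R \<Longrightarrow> G x > L / 2" by (auto simp: eventually_at_top_linorder)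
      define I where "I = (LBINT x. G x)"
      \<comment> \<open>Chosen so that a rectangle of height \<open>L / 2\<close> and width
        \<open>T\<close> has area \<open>I + 1/2\<close>, more than the whole integral.\<close>
      define T where "T = (2 * I + 1) / L"
      have "I \<ge> 0" using G(4) by (simp add: I_def)
      then have T: "T > 0" using \<open>L > 0\<close> by (simp add: T_def)
      have "(LBINT x. indicator {R..R+T} x * (L / 2)) \<le> I" unfolding I_def
      proof (rule integral_mono[OF _ G(3)])
        show "integrable lborel (\<lambda>x. indicator {R..R + T} x * (L / 2))"
          by (intro integrable_mult_left integrable_real_indicator) (auto simp: emeasure_lborel_Icc_eq)
        show "indicator {R..R + T} x * (L / 2) \<le> G x" for x
          using R[of x] G(4)[of x] by (auto simp: indicator_def)
      qed
      also have "(LBINT x. indicator {R..R+T} x * (L / 2)) = T * (L / 2)" using T by simp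
      finally show False using \<open>L > 0\<close> by (simp add: T_def)
    qed
    then show ?thesis using lim \<open>L \<ge> 0\<close> by simp
  qed
  show "(F \<longlongrightarrow> 0) at_top" by (rule top[OF F])
  have "((\<lambda>x. F (- x)) \<longlongrightarrow> 0) at_top"
  proof (rule top)
    show "wd_on a b (\<lambda>x. F (- x)) (\<lambda>x. - f (- x))" for a b by (rule wd_on_reflect[OF F(1)])
    show "integrable lborel (\<lambda>x. - f (- x))" "integrable lborel (\<lambda>x. F (- x))"
      using lborel_integrable_real_affine[OF F(2), of "-1" 0] lborel_integrable_real_affine[OF F(3), of "-1" 0] by auto
  qed (use F(4) in auto)
  then show "(F \<longlongrightarrow> 0) at_bot" by (simp add: filterlim_at_bot_mirror)
qed

text \<open>Scaled so that the potential density is \<open>(hh v x)\<^sup>2 / 2\<close>, on the same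
  footing as the kinetic one; the kink equation becomes \<rho>' = \<plusminus>
  \<open>hh v\<close>.\<close>

definition hh :: "(real \<Rightarrow> complex) \<Rightarrow> real \<Rightarrow> real" where
  "hh v x = (1 - (norm (v x))\<^sup>2) / sqrt 2"

text \<open>The derivative is an argument because \<open>wderiv\<close> is a choice: translates,
  reflections and the kink come with explicit derivatives of their own.\<close>

definition en :: "(real \<Rightarrow> complex) \<Rightarrow> (real \<Rightarrow> complex) \<Rightarrow> real" where
  "en v d = 1/2 * (LBINT x. (norm (d x))\<^sup>2) + 1/4 * (LBINT x. (1 - (norm (v x))\<^sup>2)\<^sup>2)"

locale finite_energy =
  fixes v d :: "real \<Rightarrow> complex"
  assumes wderiv_v: "is_wderiv v d"
    and integrable_d: "integrable lborel (\<lambda>x. (norm (d x))\<^sup>2)"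
    and bounded_v: "bounded (range v)"
    and integrable_pot: "integrable lborel (\<lambda>x. (1 - (norm (v x))\<^sup>2)\<^sup>2)"
begin

lemma wd_v: "wd_on a b v d"
  using wderiv_v by (simp add: is_wderiv_iff_wd_on)

lemma wd_rho: "wd_on a b (\<lambda>x. norm (v x)) (rad v d)"
  using wd_on_norm[OF wd_v] by (simp add: rad_def[abs_def])

lemma continuous_v: "continuous_on UNIV v"
  unfolding continuous_on_eq_continuous_within
proof
  fix x :: real
  have "continuous_on {x-1<..<x+1} v"
    by (rule continuous_on_subset[OF continuous_on_wd[OF wd_v[of "x-1" "x+1"]]]) auto
  then show "isCont v x" by (simp add: continuous_on_eq_continuous_at)
qed

lemma measurable_v [measurable]: "v \<in> borel_measurable borel"
  by (rule borel_measurable_continuous_onI[OF continuous_v])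

lemma measurable_d [measurable]: "d \<in> borel_measurable borel"
proof (rule borel_measurable_LIMSEQ_metric[where f="\<lambda>n x. indicator {- real n..real n} x *\<^sub>R d x"])
  show "(\<lambda>x. indicator {- real n..real n} x *\<^sub>R d x) \<in> borel_measurable borel" for n
    using borel_measurable_integrable[OF wd_onD(1)[OF wd_v, unfolded set_integrable_def, of "- real n" "- real n" "real n" "real n"]]
    by simp
  show "(\<lambda>n. indicator {- real n..real n} x *\<^sub>R d x) \<longlonglongrightarrow> d x" for x
  proof (rule tendsto_eventually)
    show "\<forall>\<^sub>F n in sequentially. indicator {- real n..real n} x *\<^sub>R d x = d x"
      using eventually_ge_at_top[of "nat \<lceil>\<bar>x\<bar>\<rceil>"]
      by eventually_elim (auto simp: indicator_def)
  qed
qed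

lemma measurable_sgn_v [measurable]: "(\<lambda>x. sgn (v x)) \<in> borel_measurable borel"
  unfolding sgn_div_norm by measurable

lemma measurable_parts [measurable]:
  "rad v d \<in> borel_measurable borel" "ang v d \<in> borel_measurable borel"
  "ort v d \<in> borel_measurable borel" "hh v \<in> borel_measurable borel"
proof -
  show [measurable]: "rad v d \<in> borel_measurable borel" unfolding rad_def[abs_def] by measurable
  show "ang v d \<in> borel_measurable borel" unfolding ang_def[abs_def] by measurable
  show "ort v d \<in> borel_measurable borel" unfolding ort_def[abs_def] by measurable
  show "hh v \<in> borel_measurable borel" unfolding hh_def[abs_def] by measurable
qed

lemma L2_d: "L2 (\<lambda>x. norm (d x))" using integrable_d by (simp add: L2_def)

lemma L2_rad: "L2 (rad v d)" and L2_ang: "L2 (ang v d)" and L2_ort: "L2 (\<lambda>x. norm (ort v d x))"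
proof -
  show "L2 (rad v d)" by (rule L2_bound[OF L2_d]) (use abs_rad_le in auto)
  show "L2 (\<lambda>x. norm (ort v d x))" by (rule L2_bound[OF L2_d]) (use norm_ort_le in auto)
  show "L2 (ang v d)" by (rule L2_bound[OF L2_d]) (use order_trans[OF abs_ang_le norm_ort_le] in auto)
qed

lemma L2_hh: "L2 (hh v)"
  using integrable_pot by (auto simp: L2_def hh_def[abs_def] power_divide)

lemma hh_sq: "(hh v x)\<^sup>2 = (1 - (norm (v x))\<^sup>2)\<^sup>2 / 2"
  by (simp add: hh_def power_divide)

lemma en_eq: "en v d = 1/2 * (nL2 (\<lambda>x. norm (d x)))\<^sup>2 + 1/2 * (nL2 (hh v))\<^sup>2"
  by (simp add: en_def nL2_sq hh_sq)

lemma nL2_le_en: "(nL2 (\<lambda>x. norm (d x)))\<^sup>2 \<le> 2 * en v d" "(nL2 (hh v))\<^sup>2 \<le> 2 * en v d"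
  by (auto simp: en_eq)

text \<open>(1 - \<rho>^2)^2 is integrable, and so is its derivative -4 \<rho> \<rho>' (1 -
  \<rho>^2), a bounded function times a product of two square-integrable ones.\<close>

lemma tendsto_norm_v: "((\<lambda>x. norm (v x)) \<longlongrightarrow> 1) at_top" "((\<lambda>x. norm (v x)) \<longlongrightarrow> 1) at_bot"
proof -
  obtain B where B: "\<And>x. norm (v x) \<le> B" using bounded_v by (auto simp: bounded_iff)
  let ?F = "\<lambda>x. (1 - (norm (v x))\<^sup>2)\<^sup>2"
  let ?f = "\<lambda>x. rad v d x *\<^sub>R (-4 * norm (v x) * (1 - (norm (v x))\<^sup>2))"
  have w: "wd_on a b ?F ?f" for a b
  proof (rule wd_on_chain[OF wd_rho, where S=UNIV and \<Phi>="\<lambda>r. (1 - r\<^sup>2)\<^sup>2" and \<Phi>'="\<lambda>r. -4 * r * (1 - r\<^sup>2)"])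
    show "((\<lambda>r. (1 - r\<^sup>2)\<^sup>2) has_vector_derivative -4 * r * (1 - r\<^sup>2)) (at r within UNIV)" for r :: real
      unfolding has_real_derivative_iff_has_vector_derivative[symmetric]
      by (auto intro!: derivative_eq_intros simp: algebra_simps)
    show "continuous_on UNIV (\<lambda>r. -4 * r * (1 - r\<^sup>2) :: real)" by (intro continuous_intros)
  qed auto
  have i: "integrable lborel ?f"
  proof -
    have "set_integrable lborel UNIV ?f"
    proof (rule abs_integral_le_L2(1)[OF L2_rad L2_scale[OF L2_hh, of "4 * B * sqrt 2"]])
      fix x :: real
      have "norm (v x) \<le> \<bar>B\<bar>" using B[of x] by linarith
      then show "\<bar>?f x\<bar> \<le> \<bar>rad v d x * (4 * B * sqrt 2 * hh v x)\<bar>"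
        by (auto simp: hh_def abs_mult intro!: mult_left_mono mult_right_mono)
    qed measurable
    then show ?thesis by (simp add: set_integrable_def)
  qed
  have *: "((\<lambda>x. norm (v x)) \<longlongrightarrow> 1) F" if "(?F \<longlongrightarrow> 0) F" for F
  proof -
    have "((\<lambda>x. sqrt (?F x)) \<longlongrightarrow> sqrt 0) F" by (intro tendsto_intros that)
    then have "((\<lambda>x. 1 - (norm (v x))\<^sup>2) \<longlongrightarrow> 0) F" by (simp add: tendsto_rabs_zero_iff)
    then have "((\<lambda>x. sqrt (1 - (1 - (norm (v x))\<^sup>2))) \<longlongrightarrow> sqrt (1 - 0)) F" by (intro tendsto_intros)
    then show ?thesis by simp
  qed
  show "((\<lambda>x. norm (v x)) \<longlongrightarrow> 1) at_top" "((\<lambda>x. norm (v x)) \<longlongrightarrow> 1) at_bot"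
    by (intro * integrable_wd_tendsto_0[OF w i integrable_pot]; simp)+
qed

end

section \<open>The energy identity and the untwisted momentum\<close>

text \<open>A primitive of \<open>1 - r\<^sup>2\<close>, so that \<open>Psi \<rho>\<close> has
  derivative \<open>sqrt 2 * \<rho>' * hh v\<close>, the cross term of the completed square. Its
  value at infinity is \<open>Psi 1 = 2/3\<close>.\<close>

definition Psi :: "real \<Rightarrow> real" where
  "Psi r = r - r ^ 3 / 3"

context finite_energy
begin

lemma wd_Psi: "wd_on a b (\<lambda>x. Psi (norm (v x))) (\<lambda>x. sqrt 2 * (rad v d x * hh v x))"
proof -
  have "wd_on a b (\<lambda>x. Psi (norm (v x))) (\<lambda>x. rad v d x *\<^sub>R (1 - (norm (v x))\<^sup>2))"
  proof (rule wd_on_chain[OF wd_rho, where S=UNIV and \<Phi>=Psi])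
    show "(Psi has_vector_derivative (1 - r\<^sup>2)) (at r within UNIV)" for r :: real
      unfolding has_real_derivative_iff_has_vector_derivative[symmetric] Psi_def[abs_def]
      by (auto intro!: derivative_eq_intros)
    show "continuous_on UNIV (\<lambda>r. 1 - r\<^sup>2 :: real)" by (intro continuous_intros)
  qed auto
  then show ?thesis by (rule wd_on_cong) (auto simp: hh_def)
qed

lemma integrable_rad_hh: "integrable lborel (\<lambda>x. rad v d x * hh v x)"
  by (rule L2_integrable_mult[OF L2_rad L2_hh])

lemma half_line_rad_hh:
  "(LBINT x:{a..}. rad v d x * hh v x) = (2/3 - Psi (norm (v a))) / sqrt 2"
  "(LBINT x:{..a}. rad v d x * hh v x) = (Psi (norm (v a)) - 2/3) / sqrt 2"
proof -
  have i: "integrable lborel (\<lambda>x. sqrt 2 * (rad v d x * hh v x))" using integrable_rad_hh by simp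
  have lim: "((\<lambda>x. Psi (norm (v x))) \<longlongrightarrow> 2/3) F" if "((\<lambda>x. norm (v x)) \<longlongrightarrow> 1) F" for F
  proof -
    have "((\<lambda>x. norm (v x) - (norm (v x)) ^ 3 / 3) \<longlongrightarrow> 1 - 1 ^ 3 / 3) F" by (intro tendsto_intros that) simp
    then show ?thesis by (simp add: Psi_def)
  qed
  have "2/3 = Psi (norm (v a)) + (LBINT x:{a..}. sqrt 2 * (rad v d x * hh v x))"
    by (rule tendsto_unique[OF _ lim[OF tendsto_norm_v(1)] half_line_integrals(1)[OF wd_Psi i]]) simp
  then have "2/3 - Psi (norm (v a)) = sqrt 2 * (LBINT x:{a..}. rad v d x * hh v x)" by simp
  then show "(LBINT x:{a..}. rad v d x * hh v x) = (2/3 - Psi (norm (v a))) / sqrt 2" by simp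
  have "2/3 = Psi (norm (v a)) - (LBINT x:{..a}. sqrt 2 * (rad v d x * hh v x))"
    by (rule tendsto_unique[OF _ lim[OF tendsto_norm_v(2)] half_line_integrals(2)[OF wd_Psi i]]) simp
  then have "Psi (norm (v a)) - 2/3 = sqrt 2 * (LBINT x:{..a}. rad v d x * hh v x)" by simp
  then show "(LBINT x:{..a}. rad v d x * hh v x) = (Psi (norm (v a)) - 2/3) / sqrt 2" by simp
qed

lemma signed_integral:
  "integrable lborel (\<lambda>x. sgn (x - a) * (rad v d x * hh v x))"
  "(LBINT x. sgn (x - a) * (rad v d x * hh v x)) = (4/3 - 2 * Psi (norm (v a))) / sqrt 2"
proof -
  have eq: "sgn (x - a) * (rad v d x * hh v x)
     = indicator {a..} x *\<^sub>R (rad v d x * hh v x) - indicator {..a} x *\<^sub>R (rad v d x * hh v x)" for x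
    by (auto simp: indicator_def sgn_if)
  have i: "integrable lborel (\<lambda>x. indicator S x *\<^sub>R (rad v d x * hh v x))" if "S \<in> sets lborel" for S
    by (rule integrable_mult_indicator[OF that integrable_rad_hh])
  have "(LBINT x. sgn (x - a) * (rad v d x * hh v x))
     = (LBINT x:{a..}. rad v d x * hh v x) - (LBINT x:{..a}. rad v d x * hh v x)"
    unfolding eq set_lebesgue_integral_def by (rule Bochner_Integration.integral_diff; rule i; simp)
  then show "(LBINT x. sgn (x - a) * (rad v d x * hh v x)) = (4/3 - 2 * Psi (norm (v a))) / sqrt 2"
    by (simp add: half_line_rad_hh diff_divide_distrib[symmetric])
  show "integrable lborel (\<lambda>x. sgn (x - a) * (rad v d x * hh v x))"
    unfolding eq by (rule Bochner_Integration.integrable_diff; rule i; simp)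
qed

text \<open>The amount by which \<rho> misses the kink equation for a kink centred at
  \<open>a\<close>.\<close>

definition defect :: "real \<Rightarrow> real \<Rightarrow> real" where
  "defect a x = sgn (x - a) * rad v d x - hh v x"

lemma measurable_sgn_shift [measurable]: "(\<lambda>x. sgn (x - a) :: real) \<in> borel_measurable borel" for a :: real
  unfolding sgn_if by measurable

lemma measurable_defect [measurable]: "defect a \<in> borel_measurable borel"
  unfolding defect_def[abs_def] by measurable

lemma L2_defect: "L2 (defect a)"
proof -
  have "L2 (\<lambda>x. sgn (x - a) * rad v d x)"
    by (rule L2_bound[OF L2_rad]) (auto simp: abs_mult sgn_if)
  then show ?thesis unfolding defect_def[abs_def] by (rule L2_diff[OF _ L2_hh])
qed

lemma energy_identity:
  "(nL2 (\<lambda>x. norm (ort v d x)))\<^sup>2 + (nL2 (defect a))\<^sup>2 = 2 * en v d - sqrt 2 * (4/3 - 2 * Psi (norm (v a)))"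
proof -
  let ?p = "\<lambda>x. sgn (x - a) * (rad v d x * hh v x)"
  have i: "integrable lborel (\<lambda>x. (norm (ort v d x))\<^sup>2)" "integrable lborel (\<lambda>x. (defect a x)\<^sup>2)"
    "integrable lborel ?p" "integrable lborel (\<lambda>x. (norm (d x))\<^sup>2)" "integrable lborel (\<lambda>x. (hh v x)\<^sup>2)"
    using L2_ort L2_defect L2_d L2_hh signed_integral(1) by (auto simp: L2_def)
  \<comment> \<open>The identity can fail at \<open>x = a\<close>, where \<open>sgn 0 = 0\<close>;
    this point is null.\<close>
  have ae: "AE x in lborel. (norm (d x))\<^sup>2 + (hh v x)\<^sup>2 = (norm (ort v d x))\<^sup>2 + (defect a x)\<^sup>2 + 2 * ?p x"
  proof (rule AE_I'[of "{a}"])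
    have "(norm (d x))\<^sup>2 + (hh v x)\<^sup>2 = (norm (ort v d x))\<^sup>2 + (defect a x)\<^sup>2 + 2 * ?p x" if "x \<noteq> a" for x
    proof -
      have "(sgn (x - a) * rad v d x)\<^sup>2 = (rad v d x)\<^sup>2" using that by (auto simp: sgn_if)
      then show ?thesis unfolding defect_def power2_diff norm_ort_sq by simp
    qed
    then show "{x \<in> space lborel. (norm (d x))\<^sup>2 + (hh v x)\<^sup>2 \<noteq> (norm (ort v d x))\<^sup>2 + (defect a x)\<^sup>2 + 2 * ?p x} \<subseteq> {a}"
      by blast
  qed auto
  have "(LBINT x. (norm (d x))\<^sup>2 + (hh v x)\<^sup>2) = (LBINT x. (norm (ort v d x))\<^sup>2 + (defect a x)\<^sup>2 + 2 * ?p x)"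
    by (rule integral_cong_AE[OF _ _ ae]) measurable
  then have "(LBINT x. (norm (d x))\<^sup>2) + (LBINT x. (hh v x)\<^sup>2)
      = (LBINT x. (norm (ort v d x))\<^sup>2) + (LBINT x. (defect a x)\<^sup>2) + 2 * (LBINT x. ?p x)"
    using i by simp
  then have "(nL2 (\<lambda>x. norm (d x)))\<^sup>2 + (nL2 (hh v))\<^sup>2
      = (nL2 (\<lambda>x. norm (ort v d x)))\<^sup>2 + (nL2 (defect a))\<^sup>2 + 2 * ((4/3 - 2 * Psi (norm (v a))) / sqrt 2)"
    unfolding nL2_sq signed_integral(2) .
  moreover have "2 * ((4/3 - 2 * Psi (norm (v a))) / sqrt 2) = sqrt 2 * (4/3 - 2 * Psi (norm (v a)))"
    using arg_cong[OF real_div_sqrt[of 2], of "\<lambda>s. s * (4/3 - 2 * Psi (norm (v a)))"] by simp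
  ultimately show ?thesis by (simp add: en_eq)
qed

end

section \<open>Classes modulo \<pi> as points of the unit circle\<close>

lemma norm_cis_minus_1_le: "norm (cis t - 1) \<le> \<bar>t\<bar>"
proof -
  have "(norm (cis t - 1))\<^sup>2 = (cos t - 1)\<^sup>2 + (sin t)\<^sup>2" by (simp add: cmod_power2)
  also have "\<dots> = 2 - 2 * cos t"
    using sin_cos_squared_add[of t] by (simp add: power2_diff)
  also have "\<dots> = (2 * sin (t / 2))\<^sup>2"
    using cos_double_sin[of "t / 2"] by (simp add: power_mult_distrib)
  also have "\<dots> \<le> t\<^sup>2" using abs_sin_x_le_abs_x[of "t / 2"] by (intro abs_le_square_iff[THEN iffD1]) (auto simp: abs_mult)
  finally show ?thesis by (simp add: abs_le_square_iff[symmetric])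
qed

lemma norm_cis_diff_le: "norm (cis s - cis t) \<le> \<bar>s - t\<bar>"
proof -
  have "cis s - cis t = cis t * (cis (s - t) - 1)" by (simp add: cis_mult right_diff_distrib)
  then show ?thesis using norm_cis_minus_1_le[of "s - t"] by (simp add: norm_mult)
qed

lemma cis_plus_int_2pi: "cis (x + 2 * pi * of_int k) = cis x"
  by (simp add: cis_mult[symmetric] cis_multiple_2pi)

text \<open>Doubling the angle turns a class modulo \<pi> into a point of the circle; for each
  representative the chord is at most the arc.\<close>

lemma modpi_dist_ge: "norm (cis (2 * a) - cis (2 * b)) \<le> 2 * modpi_dist a b"
proof -
  have "norm (cis (2 * a) - cis (2 * b)) / 2 \<le> modpi_dist a b"
    unfolding modpi_dist_def
  proof (rule cINF_greatest)
    fix k :: int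
    have "cis (2 * b) = cis (2 * b + 2 * pi * of_int k)" by (simp only: cis_plus_int_2pi)
    then have "norm (cis (2 * a) - cis (2 * b)) \<le> \<bar>2 * a - (2 * b + 2 * pi * of_int k)\<bar>"
      by (metis norm_cis_diff_le)
    also have "\<bar>2 * a - (2 * b + 2 * pi * of_int k)\<bar> = 2 * \<bar>a - b - of_int k * pi\<bar>"
    proof -
      have "2 * a - (2 * b + 2 * pi * of_int k) = 2 * (a - b - of_int k * pi)" by (simp add: algebra_simps)
      then show ?thesis by (simp only: abs_mult abs_numeral)
    qed
    finally show "norm (cis (2 * a) - cis (2 * b)) / 2 \<le> \<bar>a - b - of_int k * pi\<bar>" by simp
  qed auto
  then show ?thesis by simp
qed

lemma modpi_dist_nonneg: "0 \<le> modpi_dist a b"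
  unfolding modpi_dist_def by (rule cINF_greatest) auto

text \<open>\<open>Arg\<close> of the quotient of the two points singles out one integer
  \<open>k\<close> in the infimum.\<close>

lemma modpi_dist_le: "modpi_dist a b \<le> \<bar>Arg (cis (2 * a) * cis (- (2 * b)))\<bar> / 2"
proof -
  define s where "s = 2 * a - 2 * b"
  have e: "cis (2 * a) * cis (- (2 * b)) = cis s" by (simp add: s_def cis_mult)
  have "cis (Arg (cis s)) = cis s" by (simp add: cis_Arg)
  then have "sin s = sin (Arg (cis s)) \<and> cos s = cos (Arg (cis s))" by (simp add: complex_eq_iff)
  then obtain k :: int where k: "s = Arg (cis s) + 2 * pi * of_int k"
    by (metis sin_cos_eq_iff)
  have "modpi_dist a b \<le> \<bar>a - b - of_int k * pi\<bar>"
    unfolding modpi_dist_def by (rule cINF_lower) (auto intro!: bdd_belowI[of _ 0])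
  also have "a - b - of_int k * pi = Arg (cis s) / 2" using k by (simp add: s_def field_simps)
  finally show ?thesis by (simp add: e)
qed

text \<open>Momentum limits pass through this translation, which removes the choice of a
  representative. The direction from the circle back to the distance uses continuity of
  \<open>Arg\<close> at 1.\<close>

lemma tendsto_modpi_iff:
  "((\<lambda>x. modpi_dist (f x) q) \<longlongrightarrow> 0) F \<longleftrightarrow> ((\<lambda>x. cis (2 * f x)) \<longlongrightarrow> cis (2 * q)) F"
proof
  assume L: "((\<lambda>x. modpi_dist (f x) q) \<longlongrightarrow> 0) F"
  have "((\<lambda>x. cis (2 * f x) - cis (2 * q)) \<longlongrightarrow> 0) F"
  proof (rule Lim_null_comparison)
    show "\<forall>\<^sub>F x in F. norm (cis (2 * f x) - cis (2 * q)) \<le> 2 * modpi_dist (f x) q"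
      using modpi_dist_ge by (intro always_eventually) auto
    show "((\<lambda>x. 2 * modpi_dist (f x) q) \<longlongrightarrow> 0) F" using tendsto_mult_right_zero[OF L] by simp
  qed
  then show "((\<lambda>x. cis (2 * f x)) \<longlongrightarrow> cis (2 * q)) F" by (simp add: LIM_zero_iff)
next
  assume R: "((\<lambda>x. cis (2 * f x)) \<longlongrightarrow> cis (2 * q)) F"
  have "((\<lambda>x. cis (2 * f x) * cis (- (2 * q))) \<longlongrightarrow> cis (2 * q) * cis (- (2 * q))) F"
    by (intro tendsto_intros R)
  then have "((\<lambda>x. cis (2 * f x) * cis (- (2 * q))) \<longlongrightarrow> 1) F" by (simp add: cis_mult)
  moreover have "isCont Arg 1" by (rule continuous_at_Arg) (auto simp: complex_nonpos_Reals_iff)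
  ultimately have "((\<lambda>x. Arg (cis (2 * f x) * cis (- (2 * q)))) \<longlongrightarrow> Arg 1) F" by (rule isCont_tendsto_compose[rotated])
  then have "((\<lambda>x. \<bar>Arg (cis (2 * f x) * cis (- (2 * q)))\<bar> / 2) \<longlongrightarrow> \<bar>Arg 1\<bar> / 2) F" by (intro tendsto_divide tendsto_rabs tendsto_const) auto
  then have Z: "((\<lambda>x. \<bar>Arg (cis (2 * f x) * cis (- (2 * q)))\<bar> / 2) \<longlongrightarrow> 0) F" by (simp add: Arg_of_real[of 1, simplified])
  show "((\<lambda>x. modpi_dist (f x) q) \<longlongrightarrow> 0) F"
    by (rule tendsto_sandwich[OF _ _ tendsto_const Z])
      (use modpi_dist_le modpi_dist_nonneg in \<open>auto intro!: always_eventually\<close>)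
qed


lemma nL2_scale: "nL2 (\<lambda>x. c * f x) = \<bar>c\<bar> * nL2 f"
  by (simp add: nL2_def power_mult_distrib real_sqrt_mult)

section \<open>The momentum in terms of the non-radial part\<close>

context finite_energy
begin

text \<open>In polar form this is \<open>(1 - \<rho>\<^sup>2) \<phi>'\<close>.\<close>

definition outer_mom :: "real \<Rightarrow> real" where
  "outer_mom x = (1 - (norm (v x))\<^sup>2) * ang v d x / norm (v x)"

text \<open>Since |\<open>ang\<close>| is at most the norm of \<open>ort\<close>, Cauchy-Schwarz
  makes the bound linear in the norm of the non-radial part, the quantity that will tend to
  0.\<close>

lemma outer_mom_bound:
  assumes "c > 0" "S \<in> sets lborel" "\<And>x. x \<in> S \<Longrightarrow> c \<le> norm (v x)"
  shows "set_integrable lborel S outer_mom"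
    and "\<bar>LBINT x:S. outer_mom x\<bar> \<le> sqrt 2 / c * nL2 (hh v) * nL2 (\<lambda>x. norm (ort v d x))"
proof -
  have m: "outer_mom \<in> borel_measurable lborel" unfolding outer_mom_def[abs_def] by measurable
  have le: "\<bar>outer_mom x\<bar> \<le> \<bar>(sqrt 2 / c * hh v x) * norm (ort v d x)\<bar>" if "x \<in> S" for x
  proof -
    have "\<bar>outer_mom x\<bar> = \<bar>1 - (norm (v x))\<^sup>2\<bar> * \<bar>ang v d x\<bar> / norm (v x)"
      by (simp add: outer_mom_def abs_mult)
    also have "\<dots> \<le> \<bar>1 - (norm (v x))\<^sup>2\<bar> * norm (ort v d x) / c"
      using assms(1) assms(3)[OF that] abs_ang_le[of v d x] by (intro frac_le mult_left_mono) auto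
    also have "\<dots> = \<bar>(sqrt 2 / c * hh v x) * norm (ort v d x)\<bar>"
      using assms(1) by (simp add: hh_def abs_mult)
    finally show ?thesis .
  qed
  show "set_integrable lborel S outer_mom"
    by (rule abs_integral_le_L2(1)[OF L2_scale[OF L2_hh] L2_ort m le assms(2)])
  show "\<bar>LBINT x:S. outer_mom x\<bar> \<le> sqrt 2 / c * nL2 (hh v) * nL2 (\<lambda>x. norm (ort v d x))"
    using abs_integral_le_L2(2)[OF L2_scale[OF L2_hh] L2_ort m le assms(2), unfolded nL2_scale] assms(1) by simp
qed

lemma set_integrable_cinner:
  "a \<le> b \<Longrightarrow> set_integrable lborel {a..b} (\<lambda>x. cinner (\<i> * v x) (d x))"
proof -
  assume ab: "a \<le> b"
  have "continuous_on {a..b} (\<lambda>x. norm (v x))"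
    by (intro continuous_intros continuous_on_subset[OF continuous_v]) auto
  from set_integrable_bilinear_continuous[OF bounded_bilinear_mult L2_set_integral_le(1)[OF L2_ang ab] this]
  show ?thesis by (simp add: cinner_ang mult.commute)
qed

text \<open>In polar form \<langle>iv, v'\<rangle> = \<rho>^2 \<phi>', while the two boundary
  directions contribute \<open>cis\<close> of minus the integral of \<phi>'; together they leave -(1
  - \<rho>^2) \<phi>'.\<close>

lemma cis_segment:
  assumes "a \<le> b" "\<And>x. a \<le> x \<Longrightarrow> x \<le> b \<Longrightarrow> v x \<noteq> 0"
  shows "cis (LBINT x:{a..b}. cinner (\<i> * v x) (d x)) * sgn (v a) * cnj (sgn (v b))
       = cis (- (LBINT x:{a..b}. outer_mom x))"
proof -
  note L = sgn_lifting[OF wd_v assms]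
  have "(LBINT x:{a..b}. cinner (\<i> * v x) (d x)) - (LBINT x:{a..b}. ang v d x / norm (v x))
      = (LBINT x:{a..b}. cinner (\<i> * v x) (d x) - ang v d x / norm (v x))"
    by (rule set_integral_diff(2)[symmetric, OF set_integrable_cinner[OF assms(1)] L(1)])
  also have "\<dots> = (LBINT x:{a..b}. (-1) * outer_mom x)"
  proof (rule set_lebesgue_integral_cong)
    show "\<forall>x. x \<in> {a..b} \<longrightarrow> cinner (\<i> * v x) (d x) - ang v d x / norm (v x) = (-1) * outer_mom x"
      using assms(2) by (auto simp: cinner_ang outer_mom_def power2_eq_square field_simps)
  qed auto
  also have "\<dots> = - (LBINT x:{a..b}. outer_mom x)" by (subst set_integral_mult_right) simp
  finally have e: "(LBINT x:{a..b}. cinner (\<i> * v x) (d x)) - (LBINT x:{a..b}. ang v d x / norm (v x))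
      = - (LBINT x:{a..b}. outer_mom x)" .
  have s: "sgn (v a) * cnj (sgn (v a)) = 1"
    using assms complex_norm_square[of "sgn (v a)"] by (simp add: norm_sgn)
  have "cis (LBINT x:{a..b}. cinner (\<i> * v x) (d x)) * sgn (v a) * cnj (sgn (v b))
      = cis (LBINT x:{a..b}. cinner (\<i> * v x) (d x)) * cis (- (LBINT x:{a..b}. ang v d x / norm (v x))) * (sgn (v a) * cnj (sgn (v a)))"
    by (simp only: L(2) complex_cnj_mult cis_cnj mult_ac)
  also have "\<dots> = cis (- (LBINT x:{a..b}. outer_mom x))" by (simp add: s cis_mult e[symmetric])
  finally show ?thesis .
qed

text \<open>Direction factors at \<open>x1\<close> and \<open>x2\<close> are inserted and cancel, so
  that \<open>cis_segment\<close> applies to the two outer pieces, whose integrands are integrable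
  up to infinity. The middle piece keeps its raw integrand because \<open>v\<close> may vanish
  there.\<close>

lemma momentum_limit:
  assumes x12: "x1 \<le> x2" and c: "c > 0" "\<And>x. x \<le> x1 \<Longrightarrow> c \<le> norm (v x)" "\<And>x. x2 \<le> x \<Longrightarrow> c \<le> norm (v x)"
  shows "((\<lambda>R. cis (LBINT x:{-R..R}. cinner (\<i> * v x) (d x)) * sgn (v (-R)) * cnj (sgn (v R))) \<longlongrightarrow>
      cis (LBINT x:{x1..x2}. cinner (\<i> * v x) (d x)) * sgn (v x1) * cnj (sgn (v x2))
       * cis (- (LBINT x:{..x1}. outer_mom x)) * cis (- (LBINT x:{x2..}. outer_mom x))) at_top"
proof -
  let ?f = "\<lambda>x. cinner (\<i> * v x) (d x)"
  have nz: "v x \<noteq> 0" if "x \<le> x1 \<or> x2 \<le> x" for x using c that by fastforce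
  have ev: "eventually (\<lambda>R. cis (LBINT x:{x1..x2}. ?f x) * sgn (v x1) * cnj (sgn (v x2))
       * cis (- (LBINT x:{-R..x1}. outer_mom x)) * cis (- (LBINT x:{x2..R}. outer_mom x))
      = cis (LBINT x:{-R..R}. ?f x) * sgn (v (-R)) * cnj (sgn (v R))) at_top"
    using eventually_ge_at_top[of "max \<bar>x1\<bar> \<bar>x2\<bar>"]
  proof eventually_elim
    case (elim R)
    then have R: "- R \<le> x1" "x2 \<le> R" "- R \<le> x2" by auto
    have "(LBINT x:{-R..R}. ?f x) = (LBINT x:{-R..x2}. ?f x) + (LBINT x:{x2..R}. ?f x)"
      using R by (intro set_integral_combine set_integrable_cinner) auto
    also have "(LBINT x:{-R..x2}. ?f x) = (LBINT x:{-R..x1}. ?f x) + (LBINT x:{x1..x2}. ?f x)"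
      using R x12 by (intro set_integral_combine set_integrable_cinner) auto
    finally have I: "(LBINT x:{-R..R}. ?f x) = (LBINT x:{-R..x1}. ?f x) + (LBINT x:{x1..x2}. ?f x) + (LBINT x:{x2..R}. ?f x)" .
    have 1: "cis (LBINT x:{-R..x1}. ?f x) * sgn (v (-R)) * cnj (sgn (v x1)) = cis (- (LBINT x:{-R..x1}. outer_mom x))"
      using R nz by (intro cis_segment) auto
    have 2: "cis (LBINT x:{x2..R}. ?f x) * sgn (v x2) * cnj (sgn (v R)) = cis (- (LBINT x:{x2..R}. outer_mom x))"
      using R nz by (intro cis_segment) auto
    have s: "sgn (v x1) * cnj (sgn (v x1)) = 1" "sgn (v x2) * cnj (sgn (v x2)) = 1"
      using nz[of x1] nz[of x2] complex_norm_square[of "sgn (v x1)"] complex_norm_square[of "sgn (v x2)"]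
      by (simp_all add: norm_sgn)
    have "cis (LBINT x:{x1..x2}. ?f x) * sgn (v x1) * cnj (sgn (v x2))
       * cis (- (LBINT x:{-R..x1}. outer_mom x)) * cis (- (LBINT x:{x2..R}. outer_mom x))
       = (cis (LBINT x:{-R..x1}. ?f x) * (cis (LBINT x:{x1..x2}. ?f x) * cis (LBINT x:{x2..R}. ?f x)))
         * sgn (v (-R)) * cnj (sgn (v R)) * (sgn (v x1) * cnj (sgn (v x1))) * (sgn (v x2) * cnj (sgn (v x2)))"
      unfolding 1[symmetric] 2[symmetric] by (simp only: mult_ac)
    also have "\<dots> = cis (LBINT x:{-R..R}. ?f x) * sgn (v (-R)) * cnj (sgn (v R))"
      unfolding s I by (simp add: cis_mult add.assoc)
    finally show ?case .
  qed
  have so: "set_integrable lborel {..x1} outer_mom" "set_integrable lborel {x2..} outer_mom"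
    using c by (auto intro!: outer_mom_bound(1)[of c])
  have "((\<lambda>y. LBINT x:{y..x1}. outer_mom x) \<longlongrightarrow> (LBINT x:{..x1}. outer_mom x)) at_bot"
    by (intro tendsto_set_lebesgue_integral_at_bot so) auto
  then have t1: "((\<lambda>R. LBINT x:{-R..x1}. outer_mom x) \<longlongrightarrow> (LBINT x:{..x1}. outer_mom x)) at_top"
    by (simp add: filterlim_at_bot_mirror)
  have t2: "((\<lambda>R. LBINT x:{x2..R}. outer_mom x) \<longlongrightarrow> (LBINT x:{x2..}. outer_mom x)) at_top"
    by (intro tendsto_set_lebesgue_integral_at_top so) auto
  show ?thesis
    by (rule Lim_transform_eventually[OF _ ev]) (intro tendsto_intros t1 t2)
qed

end

lemma unit_eq_cis: "norm (z::complex) = 1 \<Longrightarrow> z = cis (2 * (Arg z / 2))"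
  using cis_Arg[of z] by (cases "z = 0") (auto simp: sgn_div_norm)

lemma X1_finite_energy: "X1 v \<Longrightarrow> finite_energy v (wderiv v)"
proof -
  assume X: "X1 v"
  then have "\<exists>g. is_wderiv v g \<and> integrable lborel (\<lambda>x. (norm (g x))\<^sup>2)" by (simp add: X1_def)
  then have "is_wderiv v (wderiv v) \<and> integrable lborel (\<lambda>x. (norm (wderiv v x))\<^sup>2)"
    unfolding wderiv_def by (rule someI_ex)
  with X show ?thesis by unfold_locales (auto simp: X1_def)
qed

lemma energy_eq_en: "energy v = en v (wderiv v)"
  by (simp add: energy_def en_def)

text \<open>The \<open>SOME\<close> in \<open>pmom\<close> satisfies its defining property once one
  \<open>q\<close> does; half the \<open>Arg\<close> of the limit is such a
  \<open>q\<close>.\<close>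

lemma cis_pmom:
  assumes X: "X1 v" and x12: "x1 \<le> x2" and c: "c > 0" "\<And>x. x \<le> x1 \<Longrightarrow> c \<le> norm (v x)" "\<And>x. x2 \<le> x \<Longrightarrow> c \<le> norm (v x)"
  shows "cis (2 * pmom v) = cis (LBINT x:{x1..x2}. cinner (\<i> * v x) (wderiv v x)) * sgn (v x1) * cnj (sgn (v x2))
       * cis (- (LBINT x:{..x1}. finite_energy.outer_mom v (wderiv v) x))
       * cis (- (LBINT x:{x2..}. finite_energy.outer_mom v (wderiv v) x))" (is "_ = ?z")
proof -
  interpret finite_energy v "wderiv v" by (rule X1_finite_energy[OF X])
  have ev: "eventually (\<lambda>R. cis (LBINT x:{-R..R}. cinner (\<i> * v x) (wderiv v x)) * sgn (v (-R)) * cnj (sgn (v R)) = cis (2 * pR v R)) at_top"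
    using eventually_ge_at_top[of "max \<bar>x1\<bar> \<bar>x2\<bar>"]
  proof eventually_elim
    case (elim R)
    then have "- R \<le> x1" "x2 \<le> R" by auto
    then have "v R \<noteq> 0" "v (-R) \<noteq> 0" using c(1) c(2)[of "-R"] c(3)[of R] by auto
    then have a: "sgn (v R) = cis (Arg (v R))" "sgn (v (-R)) = cis (Arg (v (-R)))" by (auto simp: cis_Arg)
    show ?case unfolding a by (simp add: pR_def cis_cnj cis_mult algebra_simps)
  qed
  have lim: "((\<lambda>R. cis (2 * pR v R)) \<longlongrightarrow> ?z) at_top"
    by (rule Lim_transform_eventually[OF momentum_limit[OF x12 c] ev])
  have "v x1 \<noteq> 0" "v x2 \<noteq> 0" using c(1) c(2)[of x1] c(3)[of x2] by auto
  then have nz: "norm ?z = 1" by (simp add: norm_mult norm_sgn)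
  obtain q where q: "?z = cis (2 * q)" using unit_eq_cis[OF nz] by blast
  have "((\<lambda>R. modpi_dist (pR v R) q) \<longlongrightarrow> 0) at_top" using lim unfolding tendsto_modpi_iff q .
  then have "((\<lambda>R. modpi_dist (pR v R) (pmom v)) \<longlongrightarrow> 0) at_top"
    unfolding pmom_def by (rule someI)
  then have "((\<lambda>R. cis (2 * pR v R)) \<longlongrightarrow> cis (2 * pmom v)) at_top" by (simp add: tendsto_modpi_iff)
  from tendsto_unique[OF _ this lim] show ?thesis by simp
qed

section \<open>The kink\<close>

text \<open>All three exponents in \<open>cis_pmom\<close> are bounded by the non-radial part, on
  the middle interval even across zeros of \<open>v\<close>. When that part is small, only the
  change of direction from \<open>x1\<close> to \<open>x2\<close> survives.\<close>

lemma cis_pmom_estimate: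
  assumes X: "X1 v" and x12: "x1 \<le> x2" and c: "c > 0" "\<And>x. x \<le> x1 \<Longrightarrow> c \<le> norm (v x)" "\<And>x. x2 \<le> x \<Longrightarrow> c \<le> norm (v x)"
    and M: "\<And>x. x1 \<le> x \<Longrightarrow> x \<le> x2 \<Longrightarrow> norm (v x) \<le> M"
  shows "norm (cis (2 * pmom v) - sgn (v x1) * cnj (sgn (v x2)))
    \<le> (M * sqrt (x2 - x1) + 2 * (sqrt 2 / c * nL2 (hh v))) * nL2 (\<lambda>x. norm (ort v (wderiv v) x))"
proof -
  interpret finite_energy v "wderiv v" by (rule X1_finite_energy[OF X])
  let ?N = "nL2 (\<lambda>x. norm (ort v (wderiv v) x))"
  define A where "A = (LBINT x:{x1..x2}. cinner (\<i> * v x) (wderiv v x))"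
  define B where "B = - (LBINT x:{..x1}. outer_mom x)"
  define C where "C = - (LBINT x:{x2..}. outer_mom x)"
  define s where "s = sgn (v x1) * cnj (sgn (v x2))"
  have "v x1 \<noteq> 0" "v x2 \<noteq> 0" using c(1) c(2)[of x1] c(3)[of x2] by auto
  then have s1: "norm s = 1" by (simp add: s_def norm_mult norm_sgn)
  have "cis (2 * pmom v) = cis A * sgn (v x1) * cnj (sgn (v x2)) * cis B * cis C"
    unfolding A_def B_def C_def by (rule cis_pmom[OF X x12 c])
  also have "\<dots> = s * (cis A * cis B * cis C)" by (simp only: s_def mult_ac)
  also have "\<dots> = s * cis (A + B + C)" by (simp add: cis_mult)
  finally have "cis (2 * pmom v) - s = s * (cis (A + B + C) - 1)" by (simp add: right_diff_distrib)
  then have "norm (cis (2 * pmom v) - s) \<le> \<bar>A + B + C\<bar>"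
    using norm_cis_minus_1_le[of "A + B + C"] by (simp add: norm_mult s1)
  also have "\<dots> \<le> \<bar>A\<bar> + \<bar>B\<bar> + \<bar>C\<bar>" by linarith
  also have "\<dots> \<le> M * sqrt (x2 - x1) * ?N + sqrt 2 / c * nL2 (hh v) * ?N + sqrt 2 / c * nL2 (hh v) * ?N"
  proof (intro add_mono)
    have M0: "M \<ge> 0" using M[of x1] x12 by (meson norm_ge_zero order_refl order_trans)
    have io: "set_integrable lborel {x1..x2} (\<lambda>x. norm (ort v (wderiv v) x))"
      by (rule L2_set_integral_le(1)[OF L2_ort x12])
    have "\<bar>A\<bar> \<le> (LBINT x:{x1..x2}. M * norm (ort v (wderiv v) x))"
      unfolding A_def real_norm_def[symmetric]
    proof (rule norm_set_integral_le[OF set_integrable_cinner[OF x12]])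
      show "set_integrable lborel {x1..x2} (\<lambda>x. M * norm (ort v (wderiv v) x))"
        using io by (intro set_integrable_mult_right)
      fix t assume t: "t \<in> {x1..x2}"
      show "norm (cinner (\<i> * v t) (wderiv v t)) \<le> M * norm (ort v (wderiv v) t)"
        unfolding cinner_ang real_norm_def abs_mult using t M[of t] M0 abs_ang_le by (intro mult_mono) auto
    qed
    also have "\<dots> = M * (LBINT x:{x1..x2}. \<bar>norm (ort v (wderiv v) x)\<bar>)" by simp
    also have "\<dots> \<le> M * (sqrt (x2 - x1) * ?N)"
      by (intro mult_left_mono L2_set_integral_le(2) L2_ort x12 M0)
    finally show "\<bar>A\<bar> \<le> M * sqrt (x2 - x1) * ?N" by (simp add: mult.assoc)
    show "\<bar>B\<bar> \<le> sqrt 2 / c * nL2 (hh v) * ?N"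
      unfolding B_def abs_minus_cancel by (rule outer_mom_bound(2)[OF c(1)]) (use c in auto)
    show "\<bar>C\<bar> \<le> sqrt 2 / c * nL2 (hh v) * ?N"
      unfolding C_def abs_minus_cancel by (rule outer_mom_bound(2)[OF c(1)]) (use c in auto)
  qed
  also have "\<dots> = (M * sqrt (x2 - x1) + 2 * (sqrt 2 / c * nL2 (hh v))) * ?N" by (simp add: algebra_simps)
  finally show ?thesis by (simp add: s_def)
qed

section \<open>Almost everywhere uniqueness of weak derivatives\<close>

lemma AE_eq_0_if_interval_integrals_0:
  fixes f :: "real \<Rightarrow> 'a::{banach, second_countable_topology}"
  assumes si: "\<And>a b. a \<le> b \<Longrightarrow> set_integrable lborel {a..b} f"
    and z: "\<And>a b. a \<le> b \<Longrightarrow> (LBINT x:{a..b}. f x) = 0"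
  shows "AE x in lborel. f x = 0"
proof -
  have "AE x in lborel. indicator {- real n..real n} x *\<^sub>R f x = 0" for n :: nat
  proof (rule sigma_finite_measure.density_zero[OF sigma_finite_lborel])
    let ?g = "\<lambda>x. indicator {- real n..real n} x *\<^sub>R f x"
    show gi: "integrable lborel ?g" using si[of "- real n" "real n"] by (simp add: set_integrable_def)
    have gS: "set_integrable lborel S ?g" if "S \<in> sets borel" for S
      unfolding set_integrable_def by (rule integrable_mult_indicator[OF _ gi]) (use that in simp)
    have gU: "(LBINT x. ?g x) = 0" using z[of "- real n" "real n"] by (simp add: set_lebesgue_integral_def)
    fix A :: "real set" assume "A \<in> sets lborel"
    \<comment> \<open>The half-lines \<open>{..a}\<close> are stable under intersection and generate
      the Borel sets, so a Dynkin induction carries the vanishing integrals from them to every Borel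
      set.\<close>
    then have sA: "A \<in> sigma_sets UNIV (range (\<lambda>a. {..a}))" by (simp add: borel_eq_atMost)
    have IS: "Int_stable (range (\<lambda>a::real. {..a}))" and Pw: "range (\<lambda>a::real. {..a}) \<subseteq> Pow UNIV"
      by (auto simp: Int_stable_def)
    from IS Pw sA show "(LBINT x:A. ?g x) = 0"
    proof (induction rule: sigma_sets_induct_disjoint)
      case (basic A)
      then obtain a where A: "A = {..a}" by auto
      have eq: "indicator {..a} x *\<^sub>R ?g x = indicator {- real n..min a (real n)} x *\<^sub>R f x" for x
        by (auto simp: indicator_def)
      show ?case
      proof (cases "- real n \<le> min a (real n)")
        case True
        then show ?thesis using z[OF True] unfolding A set_lebesgue_integral_def eq by simp
      next
        case False
        then have "{- real n..min a (real n)} = {}" by auto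
        then show ?thesis unfolding A set_lebesgue_integral_def eq by simp
      qed
    next
      case (compl A)
      then have Ab: "A \<in> sets borel" by (simp add: borel_eq_atMost)
      have "(LBINT x:UNIV - A. ?g x) = (LBINT x. ?g x - indicator A x *\<^sub>R ?g x)"
        unfolding set_lebesgue_integral_def by (rule Bochner_Integration.integral_cong) (auto simp: indicator_def)
      also have "\<dots> = (LBINT x. ?g x) - (LBINT x:A. ?g x)"
        unfolding set_lebesgue_integral_def
        by (rule Bochner_Integration.integral_diff[OF gi gS[OF Ab, unfolded set_integrable_def]])
      finally show ?case using compl gU by simp
    next
      case (union A)
      then have Ab: "A i \<in> sets borel" for i by (auto simp: borel_eq_atMost)
      have "(LBINT x:(\<Union>i. A i). ?g x) = (\<Sum>i. (LBINT x:A i. ?g x))"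
        by (rule lebesgue_integral_countable_add) (use union(1) Ab in \<open>auto simp: disjoint_family_on_def intro!: gS\<close>)
      then show ?case using union by simp
    qed (simp add: set_lebesgue_integral_def)
  qed
  then have "AE x in lborel. \<forall>n::nat. indicator {- real n..real n} x *\<^sub>R f x = 0"
    unfolding AE_all_countable by blast
  then show ?thesis
  proof eventually_elim
    case (elim x)
    have "x \<in> {- real (nat \<lceil>\<bar>x\<bar>\<rceil>)..real (nat \<lceil>\<bar>x\<bar>\<rceil>)}" by (auto; linarith)
    then show ?case using elim[rule_format, of "nat \<lceil>\<bar>x\<bar>\<rceil>"] by simp
  qed
qed

text \<open>\<open>wderiv kink\<close> is a chosen function; this identifies it with the explicit
  derivative up to a null set, which suffices for integrals.\<close>

lemma is_wderiv_AE_unique: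
  assumes "is_wderiv w g" "is_wderiv w k"
  shows "AE x in lborel. g x = k x"
proof -
  have "AE x in lborel. g x - k x = 0"
    by (rule AE_eq_0_if_interval_integrals_0) (use assms in \<open>auto simp: is_wderiv_def set_integral_diff\<close>)
  then show ?thesis by simp
qed

text \<open>Both the derivative of the kink and \<open>hh kink\<close>; the coincidence is the kink
  equation.\<close>

definition kinkd :: "real \<Rightarrow> real" where
  "kinkd x = (1 - (tanh (x / sqrt 2))\<^sup>2) / sqrt 2"

lemma tanh_sq_less_1: "(tanh (x::real))\<^sup>2 < 1"
  using tanh_real_lt_1[of x] tanh_real_gt_neg1[of x] by (simp add: abs_square_less_1)

lemma kinkd_pos: "kinkd x > 0"
  using tanh_sq_less_1[of "x / sqrt 2"] by (simp add: kinkd_def)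

lemma kinkd_le_1: "kinkd x \<le> 1"
proof -
  have "1 - (tanh (x / sqrt 2))\<^sup>2 \<le> 1" by simp
  also have "1 \<le> sqrt (2::real)" by simp
  finally show ?thesis by (simp add: kinkd_def)
qed

lemma DERIV_tanh_scaled: "((\<lambda>x. tanh (x / sqrt 2)) has_real_derivative kinkd x) (at x)"
proof -
  have "((\<lambda>x. tanh (x * c)) has_real_derivative (1 - (tanh (x * c))\<^sup>2) * c) (at x)" for c :: real
    by (auto intro!: derivative_eq_intros)
  from this[of "1 / sqrt 2"] show ?thesis by (simp add: kinkd_def)
qed

lemma continuous_tanh_scaled: "continuous_on A (\<lambda>x::real. tanh (x / sqrt 2))"
  by (rule DERIV_continuous_on[OF has_field_derivative_at_within[OF DERIV_tanh_scaled]])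

lemma continuous_kinkd: "continuous_on A kinkd"
  unfolding kinkd_def[abs_def] by (intro continuous_intros continuous_tanh_scaled) auto

lemma measurable_kinkd [measurable]: "kinkd \<in> borel_measurable borel"
  by (rule borel_measurable_continuous_onI[OF continuous_kinkd])

lemma vector_derivative_kink: "vector_derivative kink (at x) = of_real (kinkd x)"
proof -
  have "((\<lambda>x. of_real (tanh (x / sqrt 2)) :: complex) has_vector_derivative of_real (kinkd x)) (at x)"
    using DERIV_tanh_scaled by (intro has_vector_derivative_of_real) (simp add: has_real_derivative_iff_has_vector_derivative)
  then show ?thesis by (simp add: kink_def[abs_def] vector_derivative_at)
qed

lemma tanh_scaled_at_top: "((\<lambda>x::real. tanh (x / sqrt 2)) \<longlongrightarrow> 1) at_top"
  and tanh_scaled_at_bot: "((\<lambda>x::real. tanh (x / sqrt 2)) \<longlongrightarrow> -1) at_bot"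
proof -
  have "filterlim (\<lambda>x::real. x / sqrt 2) at_top at_top" "filterlim (\<lambda>x::real. x / sqrt 2) at_bot at_bot"
    unfolding divide_inverse
    by (auto intro!: filterlim_tendsto_pos_mult_at_top filterlim_tendsto_pos_mult_at_bot filterlim_ident simp: mult.commute[of _ "inverse _"])
  then show "((\<lambda>x::real. tanh (x / sqrt 2)) \<longlongrightarrow> 1) at_top" "((\<lambda>x::real. tanh (x / sqrt 2)) \<longlongrightarrow> -1) at_bot"
    by (auto intro: filterlim_compose[OF tanh_real_at_top] filterlim_compose[OF tanh_real_at_bot])
qed

lemma integrable_kinkd: "integrable lborel kinkd"
proof -
  have "set_integrable lborel (einterval (-\<infinity>) \<infinity>) kinkd"
  proof (rule interval_integral_FTC_nonneg(1)[where F="\<lambda>x. tanh (x / sqrt 2)" and A="-1" and B=1])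
    show "isCont kinkd x" for x using continuous_kinkd[of UNIV] by (simp add: continuous_on_eq_continuous_at)
    show "(((\<lambda>x. tanh (x / sqrt 2)) \<circ> real_of_ereal) \<longlongrightarrow> -1) (at_right (-\<infinity>))"
      "(((\<lambda>x. tanh (x / sqrt 2)) \<circ> real_of_ereal) \<longlongrightarrow> 1) (at_left \<infinity>)"
      unfolding ereal_tendsto_simps using tanh_scaled_at_top tanh_scaled_at_bot by auto
  qed (auto simp: DERIV_tanh_scaled less_imp_le[OF kinkd_pos])
  then show ?thesis by (simp add: set_integrable_def)
qed

lemma L2_kinkd: "L2 kinkd"
  unfolding L2_def
proof
  show "integrable lborel (\<lambda>x. (kinkd x)\<^sup>2)"
  proof (rule Bochner_Integration.integrable_bound[OF integrable_kinkd])
    show "AE x in lborel. norm ((kinkd x)\<^sup>2) \<le> norm (kinkd x)"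
      using kinkd_le_1 less_imp_le[OF kinkd_pos] by (auto simp: power2_eq_square intro!: mult_left_le)
  qed measurable
qed measurable

text \<open>The chain rule with the identity as inner function.\<close>

lemma wd_on_C1:
  fixes \<Phi> :: "real \<Rightarrow> 'b::euclidean_space"
  assumes "\<And>x. (\<Phi> has_vector_derivative \<Phi>' x) (at x)" "continuous_on UNIV \<Phi>'"
  shows "wd_on a b \<Phi> \<Phi>'"
proof -
  have i: "set_integrable lborel {x..y::real} (\<lambda>_. 1::real)" for x y
    using borel_integrable_atLeastAtMost'[of x y "\<lambda>_. 1::real"] by auto
  have "wd_on a b (\<lambda>x. x) (\<lambda>x. 1::real)"
    unfolding wd_on_def by (auto simp: i set_lebesgue_integral_def)
  from wd_on_chain[OF this, where S=UNIV and \<Phi>=\<Phi> and \<Phi>'=\<Phi>'] show ?thesis using assms by auto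
qed

lemma hh_kink: "hh kink = kinkd"
  by (auto simp: hh_def kink_def kinkd_def fun_eq_iff)

lemma finite_energy_kink: "finite_energy kink (\<lambda>x. of_real (kinkd x))"
proof
  show "is_wderiv kink (\<lambda>x. of_real (kinkd x))"
    unfolding is_wderiv_iff_wd_on
  proof (intro allI wd_on_C1)
    fix x show "(kink has_vector_derivative of_real (kinkd x)) (at x)"
      unfolding kink_def[abs_def] using DERIV_tanh_scaled
      by (intro has_vector_derivative_of_real) (simp add: has_real_derivative_iff_has_vector_derivative)
  qed (intro continuous_intros continuous_kinkd)
  show "integrable lborel (\<lambda>x. (norm (of_real (kinkd x) :: complex))\<^sup>2)"
    using L2_kinkd by (simp add: L2_def)
  show "bounded (range kink)"
    unfolding bounded_iff using tanh_sq_less_1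
    by (intro exI[of _ 1]) (auto simp: kink_def abs_square_le_1[symmetric] less_imp_le)
  have "(1 - (norm (kink x))\<^sup>2)\<^sup>2 = 2 * (kinkd x)\<^sup>2" for x
    by (simp add: kink_def kinkd_def power_divide)
  then show "integrable lborel (\<lambda>x. (1 - (norm (kink x))\<^sup>2)\<^sup>2)" using L2_kinkd by (simp add: L2_def)
qed

lemma X1_kink: "X1 kink"
proof -
  interpret finite_energy kink "\<lambda>x. of_real (kinkd x)" by (rule finite_energy_kink)
  show ?thesis using wderiv_v integrable_d bounded_v integrable_pot by (auto simp: X1_def)
qed

lemma sgn_kink: "sgn (kink x) = of_real (sgn x)"
proof -
  have "sgn (kink x) = of_real (sgn (tanh (x / sqrt 2)))" by (simp add: kink_def sgn_of_real)
  moreover have "sgn (tanh (x / sqrt 2)) = sgn x"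
    by (simp add: sgn_if zero_less_divide_iff)
  ultimately show ?thesis by simp
qed

text \<open>With the explicit derivative both squares of the energy identity centred at 0 vanish off
  the origin, which leaves \<open>sqrt 2 * (4/3) / 2\<close>. Almost everywhere uniqueness transfers
  this to \<open>wderiv\<close>, and the identity read backwards then gives a zero non-radial
  part.\<close>

lemma energy_kink: "energy kink = 2 * sqrt 2 / 3"
  and ort_kink: "nL2 (\<lambda>x. norm (ort kink (wderiv kink) x)) = 0"
  and nL2_kinkd: "(nL2 kinkd)\<^sup>2 = 2 * sqrt 2 / 3"
proof -
  let ?d = "\<lambda>x. of_real (kinkd x) :: complex"
  interpret K: finite_energy kink ?d by (rule finite_energy_kink)
  interpret W: finite_energy kink "wderiv kink" by (rule X1_finite_energy[OF X1_kink])
  have rad: "rad kink ?d x = sgn x * kinkd x" for x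
    by (simp add: rad_def sgn_kink inner_complex_def)
  have "(LBINT x. (norm (ort kink ?d x))\<^sup>2) = 0"
  proof (rule integral_eq_zero_AE)
    show "AE x in lborel. (norm (ort kink ?d x))\<^sup>2 = 0"
    proof (rule AE_I'[of "{0}"])
      show "{x \<in> space lborel. (norm (ort kink ?d x))\<^sup>2 \<noteq> 0} \<subseteq> {0}"
        unfolding norm_ort_sq rad by (auto simp: power_mult_distrib sgn_if split: if_splits)
    qed auto
  qed
  then have o: "nL2 (\<lambda>x. norm (ort kink ?d x)) = 0" by (simp add: nL2_def)
  have "(LBINT x. (K.defect 0 x)\<^sup>2) = 0"
  proof (rule integral_eq_zero_AE)
    show "AE x in lborel. (K.defect 0 x)\<^sup>2 = 0"
    proof (rule AE_I'[of "{0}"])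
      show "{x \<in> space lborel. (K.defect 0 x)\<^sup>2 \<noteq> 0} \<subseteq> {0}"
        unfolding K.defect_def rad hh_kink by (auto simp: sgn_if split: if_splits)
    qed auto
  qed
  then have "nL2 (K.defect 0) = 0" by (simp add: nL2_def)
  with o K.energy_identity[of 0] have e: "en kink ?d = 2 * sqrt 2 / 3" by (simp add: kink_def Psi_def)
  have "(LBINT x. (norm (wderiv kink x))\<^sup>2) = (LBINT x. (norm (?d x))\<^sup>2)"
    using is_wderiv_AE_unique[OF W.wderiv_v K.wderiv_v] by (intro integral_cong_AE) auto
  then have "en kink (wderiv kink) = en kink ?d" by (simp add: en_def)
  with e show E: "energy kink = 2 * sqrt 2 / 3" by (simp add: energy_eq_en)
  have "(nL2 (\<lambda>x. norm (ort kink (wderiv kink) x)))\<^sup>2 + (nL2 (W.defect 0))\<^sup>2 = 0"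
    using W.energy_identity[of 0] E by (simp add: energy_eq_en kink_def Psi_def)
  then show "nL2 (\<lambda>x. norm (ort kink (wderiv kink) x)) = 0" by (simp add: sum_power2_eq_zero_iff)
  have "(nL2 (\<lambda>x. norm (?d x)))\<^sup>2 = (nL2 kinkd)\<^sup>2" by (simp add: nL2_sq)
  then show "(nL2 kinkd)\<^sup>2 = 2 * sqrt 2 / 3" using e by (simp add: K.en_eq hh_kink)
qed

text \<open>The non-radial part vanishes, so the momentum estimate on \<open>{-1..1}\<close> is
  exact and only the sign change of the kink remains.\<close>

lemma cis_pmom_kink: "cis (2 * pmom kink) = -1"
proof -
  have T: "tanh (1 / sqrt 2) > (0::real)" by simp
  have k: "norm (kink x) = \<bar>tanh (x / sqrt 2)\<bar>" for x by (simp add: kink_def)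
  have "norm (cis (2 * pmom kink) - sgn (kink (-1)) * cnj (sgn (kink 1)))
    \<le> (1 * sqrt (1 - (-1)) + 2 * (sqrt 2 / tanh (1 / sqrt 2) * nL2 (hh kink))) * nL2 (\<lambda>x. norm (ort kink (wderiv kink) x))"
  proof (rule cis_pmom_estimate[OF X1_kink _ T])
    fix x :: real
    show "tanh (1 / sqrt 2) \<le> norm (kink x)" if "1 \<le> x"
    proof -
      have "tanh (1 / sqrt 2) \<le> tanh (x / sqrt 2)" using that by (subst tanh_real_le_iff) (simp add: divide_right_mono)
      then show ?thesis unfolding k by (rule order_trans[OF _ abs_ge_self])
    qed
    show "tanh (1 / sqrt 2) \<le> norm (kink x)" if "x \<le> -1"
    proof -
      have "tanh (1 / sqrt 2) \<le> tanh (- x / sqrt 2)"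
        using that by (subst tanh_real_le_iff, intro divide_right_mono) auto
      also have "\<dots> \<le> \<bar>tanh (x / sqrt 2)\<bar>" by (simp add: abs_if)
      finally show ?thesis unfolding k .
    qed
    show "norm (kink x) \<le> 1" using tanh_real_lt_1[of "x / sqrt 2"] tanh_real_gt_neg1[of "x / sqrt 2"] by (simp add: k)
  qed auto
  then show ?thesis by (simp add: ort_kink sgn_kink eq_neg_iff_add_eq_0)
qed

lemma energy_nonneg: "0 \<le> energy v"
  by (simp add: energy_def)

text \<open>The kink is a competitor. The reverse inequality emerges in the final proof from the
  nonnegativity of the two squares.\<close>

lemma Emin_le: "Emin_half_pi \<le> 2 * sqrt 2 / 3"
proof -
  have "cis (2 * pmom kink) * cis (- (2 * (pi / 2))) = 1"
    by (simp add: cis_pmom_kink cis_cnj[symmetric])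
  then have "modpi_dist (pmom kink) (pi / 2) \<le> 0"
    using modpi_dist_le[of "pmom kink" "pi / 2"] by (simp add: Arg_of_real[of 1, simplified])
  then have "modpi_dist (pmom kink) (pi / 2) = 0" using modpi_dist_nonneg[of "pmom kink" "pi/2"] by simp
  then have "Emin_half_pi \<le> energy kink"
    unfolding Emin_half_pi_def using X1_kink energy_nonneg by (intro cINF_lower bdd_belowI[of _ 0]) auto
  then show ?thesis by (simp add: energy_kink)
qed

section \<open>Energy gap for maps bounded away from zero\<close>

text \<open>The antiderivative in \<open>r\<close> of \<open>(1 - r\<^sup>2) \<surd>(r\<^sup>2 - l\<^sup>2) / r\<close> vanishing at \<open>r = l\<close>.\<close>

definition calib :: "real \<Rightarrow> real \<Rightarrow> real" where
  "calib l r = sqrt (r\<^sup>2 - l\<^sup>2) - l * arctan (sqrt (r\<^sup>2 - l\<^sup>2) / l) - (sqrt (r\<^sup>2 - l\<^sup>2)) ^ 3 / 3"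

lemma DERIV_calib:
  assumes "0 < l" "l < r"
  shows "(calib l has_real_derivative (1 - r\<^sup>2) * sqrt (r\<^sup>2 - l\<^sup>2) / r) (at r)"
proof -
  have pos: "r\<^sup>2 - l\<^sup>2 > 0" using assms by (simp add: power_strict_mono)
  define S where "S = sqrt (r\<^sup>2 - l\<^sup>2)"
  have S: "S > 0" "S\<^sup>2 = r\<^sup>2 - l\<^sup>2" using pos by (auto simp: S_def)
  have dS: "((\<lambda>r. sqrt (r\<^sup>2 - l\<^sup>2)) has_real_derivative r / S) (at r)"
    unfolding S_def using pos by (auto intro!: derivative_eq_intros simp: field_simps)
  have dA: "((\<lambda>r. arctan (sqrt (r\<^sup>2 - l\<^sup>2) / l)) has_real_derivative l / (r * S)) (at r)"
  proof -
    have "((\<lambda>r. arctan (sqrt (r\<^sup>2 - l\<^sup>2) / l)) has_real_derivative inverse (1 + (S / l)\<^sup>2) * (r / S / l)) (at r)"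
      unfolding S_def using assms by (intro DERIV_chain2[OF DERIV_arctan] DERIV_cdivide dS[unfolded S_def])
    moreover have "1 + (S / l)\<^sup>2 = r\<^sup>2 / l\<^sup>2" using assms by (simp add: power_divide S(2) field_simps)
    moreover have "inverse (r\<^sup>2 / l\<^sup>2) * (r / S / l) = l / (r * S)"
      using assms S(1) by (simp add: power2_eq_square)
    ultimately show ?thesis by simp
  qed
  have "(calib l has_real_derivative r / S - l * (l / (r * S)) - (3 * S\<^sup>2 * (r / S)) / 3) (at r)"
    unfolding calib_def[abs_def]
  proof (intro DERIV_diff DERIV_cdivide dS DERIV_cmult dA)
    show "((\<lambda>x. sqrt (x\<^sup>2 - l\<^sup>2) ^ 3) has_real_derivative 3 * S\<^sup>2 * (r / S)) (at r)"
      using DERIV_power[OF dS, of 3] by (simp add: S_def mult_ac)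
  qed
  moreover have "r / S - l * (l / (r * S)) - (3 * S\<^sup>2 * (r / S)) / 3 = (1 - r\<^sup>2) * S / r"
  proof -
    have "r / S - l * (l / (r * S)) - (3 * S\<^sup>2 * (r / S)) / 3 = ((r\<^sup>2 - l\<^sup>2) - S\<^sup>2 * r\<^sup>2) / (r * S)"
      using assms S(1) by (simp add: field_simps power2_eq_square)
    also have "\<dots> = S\<^sup>2 * (1 - r\<^sup>2) / (r * S)" by (simp add: S(2) algebra_simps)
    also have "\<dots> = (1 - r\<^sup>2) * S / r" using S(1) by (simp add: power2_eq_square)
    finally show ?thesis .
  qed
  ultimately show ?thesis by (simp add: S_def)
qed

text \<open>Keeps the boundary term of the calibration small at a point where |v| is close to
  \<open>l\<close>.\<close>

lemma calib_le: "0 < l \<Longrightarrow> l \<le> r \<Longrightarrow> calib l r \<le> sqrt (r\<^sup>2 - l\<^sup>2)"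
proof -
  assume l: "0 < l" "l \<le> r"
  then have "l\<^sup>2 \<le> r\<^sup>2" by (intro power_mono) auto
  then have "0 \<le> sqrt (r\<^sup>2 - l\<^sup>2)" by simp
  then have "0 \<le> l * arctan (sqrt (r\<^sup>2 - l\<^sup>2) / l)" "0 \<le> (sqrt (r\<^sup>2 - l\<^sup>2)) ^ 3 / 3"
    using l by (auto intro!: mult_nonneg_nonneg)
  then show ?thesis unfolding calib_def by linarith
qed

lemma integral_split_at:
  fixes f :: "real \<Rightarrow> real"
  assumes "integrable lborel f"
  shows "(LBINT x. f x) = (LBINT x:{..a}. f x) + (LBINT x:{a..}. f x)"
proof -
  have si: "set_integrable lborel S f" if "S \<in> sets lborel" for S
    unfolding set_integrable_def by (rule integrable_mult_indicator[OF that assms])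
  have "(LBINT x:{..a} \<union> {a..}. f x) = (LBINT x:{..a}. f x) + (LBINT x:{a..}. f x)"
  proof (rule set_integral_Un_AE)
    show "AE x in lborel. \<not> (x \<in> {..a} \<and> x \<in> {a..})" by (rule AE_I'[of "{a}"]) auto
  qed (auto intro!: si)
  moreover have "{..a} \<union> {a..} = UNIV" by auto
  ultimately show ?thesis by (simp add: set_lebesgue_integral_def)
qed

text \<open>The squares of \<open>t - \<sigma> * l * e / (sqrt 2 * r)\<close> and
  \<open>g - s * e * S / (sqrt 2 * r)\<close> are expanded; since l^2 + S^2 = r^2, the subtracted
  terms have squares adding up to e^2/2. In the application \<open>g\<close>, \<open>t\<close>,
  \<open>e\<close> are \<open>rad\<close>, \<open>ang\<close> and 1 - \<rho>^2, and \<sigma>,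
  \<open>s\<close> are signs.\<close>

lemma calibration_pointwise:
  fixes r l S g t D e :: real
  assumes r: "r > 0" and S: "S\<^sup>2 = r\<^sup>2 - l\<^sup>2" and D: "D \<ge> g\<^sup>2 + t\<^sup>2"
    and sg: "\<sigma>\<^sup>2 = 1" "s\<^sup>2 = 1"
  shows "\<sigma> * (sqrt 2 / 2 * l) * (e * t / r) + s / sqrt 2 * (g * (e * S / r)) \<le> 1/2 * D + 1/2 * (e / sqrt 2)\<^sup>2"
proof -
  define q where "q = sqrt (2::real)"
  have q: "q\<^sup>2 = 2" "q > 0" "sqrt 2 = q" by (auto simp: q_def)
  have "0 \<le> 1/2 * (t - \<sigma> * l * e / (q * r))\<^sup>2 + 1/2 * (g - s * e * S / (q * r))\<^sup>2" by simp
  also have "\<dots> = 1/2 * t\<^sup>2 - t * (\<sigma> * l * e / (q * r)) + 1/2 * (\<sigma> * l * e / (q * r))\<^sup>2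
      + 1/2 * g\<^sup>2 - g * (s * e * S / (q * r)) + 1/2 * (s * e * S / (q * r))\<^sup>2"
    unfolding power2_diff by (simp add: add_divide_distrib diff_divide_distrib)
  also have "(\<sigma> * l * e / (q * r))\<^sup>2 = l\<^sup>2 * e\<^sup>2 / (2 * r\<^sup>2)"
    by (simp add: power_mult_distrib power_divide sg q)
  also have "(s * e * S / (q * r))\<^sup>2 = (r\<^sup>2 - l\<^sup>2) * e\<^sup>2 / (2 * r\<^sup>2)"
    by (simp add: power_mult_distrib power_divide sg q S)
  finally have "t * (\<sigma> * l * e / (q * r)) + g * (s * e * S / (q * r))
      \<le> 1/2 * (g\<^sup>2 + t\<^sup>2) + 1/2 * (l\<^sup>2 * e\<^sup>2 / (2 * r\<^sup>2) + (r\<^sup>2 - l\<^sup>2) * e\<^sup>2 / (2 * r\<^sup>2))"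
    by (simp add: algebra_simps)
  also have "l\<^sup>2 * e\<^sup>2 / (2 * r\<^sup>2) + (r\<^sup>2 - l\<^sup>2) * e\<^sup>2 / (2 * r\<^sup>2) = e\<^sup>2 / 2"
    using r by (simp add: add_divide_distrib[symmetric] distrib_right[symmetric])
  finally have "t * (\<sigma> * l * e / (q * r)) + g * (s * e * S / (q * r)) \<le> 1/2 * D + 1/2 * (e\<^sup>2 / 2)"
    by (rule order_trans) (use D in simp)
  moreover have "\<sigma> * (q / 2 * l) * (e * t / r) = t * (\<sigma> * l * e / (q * r))"
    using r q by (simp add: field_simps power2_eq_square)
  moreover have "s / q * (g * (e * S / r)) = g * (s * e * S / (q * r))" by (simp add: mult_ac)
  ultimately show ?thesis unfolding q(3) by (simp only: power_divide q(1))
qed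

context finite_energy
begin

text \<open>\<sigma> is the sign of the total momentum integral, which produces the absolute value.
  The radial cross term \<open>f\<close> is the derivative of \<open>calib l \<rho>\<close>, so its
  integral on each side of \<open>x0\<close> is a boundary term.\<close>

lemma calibrated_energy_bound:
  assumes l: "0 < l" "l < 1" "\<And>x. l < norm (v x)"
  shows "sqrt 2 / 2 * l * \<bar>(LBINT x:{..x0}. outer_mom x) + (LBINT x:{x0..}. outer_mom x)\<bar>
      + sqrt 2 * (calib l 1 - calib l (norm (v x0))) \<le> en v d"
proof -
  define S where "S x = sqrt ((norm (v x))\<^sup>2 - l\<^sup>2)" for x
  define f where "f x = rad v d x * ((1 - (norm (v x))\<^sup>2) * S x / norm (v x))" for x
  define \<sigma> :: real where "\<sigma> = (if (LBINT x:{..x0}. outer_mom x) + (LBINT x:{x0..}. outer_mom x) \<ge> 0 then 1 else -1)"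
  define e where "e x = 1/2 * (norm (d x))\<^sup>2 + 1/2 * (hh v x)\<^sup>2" for x
  have vpos: "norm (v x) > 0" for x using l(1) l(3)[of x] by linarith
  have S2: "(S x)\<^sup>2 = (norm (v x))\<^sup>2 - l\<^sup>2" "S x \<ge> 0" "S x \<le> norm (v x)" for x
  proof -
    have "l\<^sup>2 \<le> (norm (v x))\<^sup>2" using l(1) l(3)[of x] by (intro power_mono) auto
    then show "(S x)\<^sup>2 = (norm (v x))\<^sup>2 - l\<^sup>2" "S x \<ge> 0" by (auto simp: S_def)
    show "S x \<le> norm (v x)" unfolding S_def by (rule real_le_lsqrt) auto
  qed
  have wdH: "wd_on a b (\<lambda>x. calib l (norm (v x))) f" for a b
  proof -
    have "wd_on a b (\<lambda>x. calib l (norm (v x)))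
       (\<lambda>x. rad v d x *\<^sub>R ((1 - (norm (v x))\<^sup>2) * sqrt ((norm (v x))\<^sup>2 - l\<^sup>2) / norm (v x)))"
    proof (rule wd_on_chain[OF wd_rho, where S="{l<..}" and \<Phi>="calib l" and \<Phi>'="\<lambda>r. (1 - r\<^sup>2) * sqrt (r\<^sup>2 - l\<^sup>2) / r"])
      show "(calib l has_vector_derivative (1 - r\<^sup>2) * sqrt (r\<^sup>2 - l\<^sup>2) / r) (at r within {l<..})" if "r \<in> {l<..}" for r
        using DERIV_calib[OF l(1), of r] that
        by (auto simp: has_real_derivative_iff_has_vector_derivative intro: has_vector_derivative_at_within)
      show "continuous_on {l<..} (\<lambda>r. (1 - r\<^sup>2) * sqrt (r\<^sup>2 - l\<^sup>2) / r)"
        using l(1) by (intro continuous_intros) auto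
    qed (use l(3) in auto)
    then show ?thesis by (simp add: f_def[abs_def] S_def)
  qed
  have mS [measurable]: "S \<in> borel_measurable borel" unfolding S_def[abs_def] by measurable
  have mf [measurable]: "f \<in> borel_measurable borel" unfolding f_def[abs_def] by measurable
  have fi: "integrable lborel f"
  proof (rule Bochner_Integration.integrable_bound)
    show "integrable lborel (\<lambda>x. sqrt 2 * (rad v d x * hh v x))" using integrable_rad_hh by simp
    show "AE x in lborel. norm (f x) \<le> norm (sqrt 2 * (rad v d x * hh v x))"
    proof (rule AE_I2)
      fix x
      have "\<bar>S x / norm (v x)\<bar> \<le> 1" using S2(2,3)[of x] vpos[of x] by simp
      then have "\<bar>rad v d x * (1 - (norm (v x))\<^sup>2)\<bar> * \<bar>S x / norm (v x)\<bar> \<le> \<bar>rad v d x * (1 - (norm (v x))\<^sup>2)\<bar> * 1"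
        by (intro mult_left_mono) auto
      then show "norm (f x) \<le> norm (sqrt 2 * (rad v d x * hh v x))"
        by (simp add: f_def hh_def abs_mult)
    qed
  qed measurable
  have Hlim: "((\<lambda>x. calib l (norm (v x))) \<longlongrightarrow> calib l 1) F" if "((\<lambda>x. norm (v x)) \<longlongrightarrow> 1) F" for F
    by (rule isCont_tendsto_compose[OF DERIV_isCont[OF DERIV_calib[OF l(1,2)]] that])
  have f1: "(LBINT x:{x0..}. f x) = calib l 1 - calib l (norm (v x0))"
    using tendsto_unique[OF _ Hlim[OF tendsto_norm_v(1)] half_line_integrals(1)[OF wdH fi, of x0]] by simp
  have f2: "(LBINT x:{..x0}. f x) = calib l (norm (v x0)) - calib l 1"
    using tendsto_unique[OF _ Hlim[OF tendsto_norm_v(2)] half_line_integrals(2)[OF wdH fi, of x0]] by simp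
  have ei: "integrable lborel e" using L2_d L2_hh by (simp add: e_def[abs_def] L2_def)
  have eint: "(LBINT x. e x) = en v d"
    using L2_d L2_hh by (simp add: e_def en_eq nL2_sq L2_def)
  have om: "set_integrable lborel A outer_mom" if "A \<in> sets lborel" for A
    using outer_mom_bound(1)[OF l(1) that] l(3) by (simp add: less_imp_le)
  have fA: "set_integrable lborel A f" if "A \<in> sets lborel" for A
    unfolding set_integrable_def by (rule integrable_mult_indicator[OF that fi])
  have eA: "set_integrable lborel A e" if "A \<in> sets lborel" for A
    unfolding set_integrable_def by (rule integrable_mult_indicator[OF that ei])
  have pw: "\<sigma> * (sqrt 2 / 2 * l) * outer_mom x + s / sqrt 2 * f x \<le> e x" if "s\<^sup>2 = 1" for s x :: real
  proof -
    have "(rad v d x)\<^sup>2 + (ang v d x)\<^sup>2 \<le> (norm (d x))\<^sup>2"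
      using norm_ort_sq[of v d x] power_mono[OF abs_ang_le[of v d x], of 2] by simp
    from calibration_pointwise[OF vpos S2(1) this _ that, of \<sigma> "1 - (norm (v x))\<^sup>2"]
    show ?thesis by (simp add: e_def outer_mom_def f_def hh_def \<sigma>_def)
  qed
  have half: "\<sigma> * (sqrt 2 / 2 * l) * (LBINT x:A. outer_mom x) + s / sqrt 2 * (LBINT x:A. f x) \<le> (LBINT x:A. e x)"
    if "s\<^sup>2 = 1" "A \<in> sets lborel" for s :: real and A
  proof -
    have i1: "set_integrable lborel A (\<lambda>x. \<sigma> * (sqrt 2 / 2 * l) * outer_mom x)"
      using om[OF that(2)] by (rule set_integrable_mult_right)
    have i2: "set_integrable lborel A (\<lambda>x. s / sqrt 2 * f x)"
      using fA[OF that(2)] by (rule set_integrable_mult_right)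
    have "(LBINT x:A. \<sigma> * (sqrt 2 / 2 * l) * outer_mom x + s / sqrt 2 * f x) \<le> (LBINT x:A. e x)"
      by (rule set_integral_mono[OF set_integral_add(1)[OF i1 i2] eA[OF that(2)]]) (rule pw[OF that(1)])
    then show ?thesis unfolding set_integral_add(2)[OF i1 i2] set_integral_mult_right .
  qed
  \<comment> \<open>The sign \<open>s\<close> is -1 to the left of \<open>x0\<close> and 1 to the
    right, so both halves contribute the increase of \<open>calib l \<rho>\<close> from
    \<open>x0\<close> to infinity.\<close>
  have "\<sigma> * (sqrt 2 / 2 * l) * (LBINT x:{..x0}. outer_mom x) + (-1) / sqrt 2 * (LBINT x:{..x0}. f x)
      + (\<sigma> * (sqrt 2 / 2 * l) * (LBINT x:{x0..}. outer_mom x) + 1 / sqrt 2 * (LBINT x:{x0..}. f x)) \<le> en v d"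
    unfolding eint[symmetric] integral_split_at[OF ei, of x0] by (intro add_mono half) auto
  moreover have "\<sigma> * (sqrt 2 / 2 * l) * (LBINT x:{..x0}. outer_mom x) + \<sigma> * (sqrt 2 / 2 * l) * (LBINT x:{x0..}. outer_mom x)
      = sqrt 2 / 2 * l * \<bar>(LBINT x:{..x0}. outer_mom x) + (LBINT x:{x0..}. outer_mom x)\<bar>"
    by (simp add: \<sigma>_def abs_if algebra_simps)
  moreover have "(-1) / sqrt 2 * (LBINT x:{..x0}. f x) + 1 / sqrt 2 * (LBINT x:{x0..}. f x)
      = sqrt 2 * (calib l 1 - calib l (norm (v x0)))"
  proof -
    define D where "D = calib l 1 - calib l (norm (v x0))"
    have "(-1) / sqrt 2 * (- D) + 1 / sqrt 2 * D = 2 / sqrt 2 * D" by (simp add: field_simps)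
    also have "\<dots> = sqrt 2 * D" by (subst real_div_sqrt) auto
    finally show ?thesis unfolding f1 f2 D_def by simp
  qed
  ultimately show ?thesis by linarith
qed

end

text \<open>For \<open>0 < l < 1\<close> this is \<open>l \<pi>/2 + calib l 1\<close>; replacing \<open>\<pi>/2 - arctan (1/x)\<close> by \<open>arctan x\<close> makes it
  differentiable at \<open>l = 0\<close>.\<close>

definition Kcal :: "real \<Rightarrow> real" where
  "Kcal l = sqrt (1 - l\<^sup>2) - (sqrt (1 - l\<^sup>2)) ^ 3 / 3 + l * arctan (l / sqrt (1 - l\<^sup>2))"

lemma Kcal_0: "Kcal 0 = 2/3"
  by (simp add: Kcal_def)

lemma calib_1: "0 < l \<Longrightarrow> l < 1 \<Longrightarrow> l * pi / 2 + calib l 1 = Kcal l"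
proof -
  assume l: "0 < l" "l < 1"
  then have "l\<^sup>2 < 1" by (simp add: power_less_one_iff)
  then have s: "sqrt (1 - l\<^sup>2) > 0" by simp
  have "arctan (sqrt (1 - l\<^sup>2) / l) = pi / 2 - arctan (l / sqrt (1 - l\<^sup>2))"
    using arctan_inverse[of "l / sqrt (1 - l\<^sup>2)"] l s by simp
  then have "l * arctan (sqrt (1 - l\<^sup>2) / l) = l * pi / 2 - l * arctan (l / sqrt (1 - l\<^sup>2))"
    by (simp add: right_diff_distrib)
  then show ?thesis unfolding calib_def Kcal_def by simp
qed

lemma DERIV_Kcal:
  assumes "0 \<le> l" "l < 1"
  shows "(Kcal has_real_derivative l * sqrt (1 - l\<^sup>2) + arctan (l / sqrt (1 - l\<^sup>2))) (at l)"
proof -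
  have "l\<^sup>2 < 1" using assms by (simp add: power_less_one_iff abs_square_less_1)
  then have pos: "1 - l\<^sup>2 > 0" by simp
  define s where "s = sqrt (1 - l\<^sup>2)"
  have s: "s > 0" "s\<^sup>2 = 1 - l\<^sup>2" using pos by (auto simp: s_def)
  have ds: "((\<lambda>l. sqrt (1 - l\<^sup>2)) has_real_derivative - l / s) (at l)"
    unfolding s_def using pos by (auto intro!: derivative_eq_intros simp: field_simps)
  have dq: "((\<lambda>l. l / sqrt (1 - l\<^sup>2)) has_real_derivative (1 * s - l * (- l / s)) / (s * s)) (at l)"
    using DERIV_divide[OF DERIV_ident ds] s by (simp add: s_def)
  have "((\<lambda>l. arctan (l / sqrt (1 - l\<^sup>2))) has_real_derivative inverse (1 + (l / s)\<^sup>2) * ((1 * s - l * (- l / s)) / (s * s))) (at l)"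
    unfolding s_def by (rule DERIV_chain2[OF DERIV_arctan dq[unfolded s_def]])
  moreover have "inverse (1 + (l / s)\<^sup>2) * ((1 * s - l * (- l / s)) / (s * s)) = 1 / s"
  proof -
    have "1 + (l / s)\<^sup>2 = 1 / s\<^sup>2" using s by (simp add: power_divide field_simps)
    moreover have "1 * s - l * (- l / s) = 1 / s" using s by (simp add: field_simps power2_eq_square)
    ultimately have "inverse (1 + (l / s)\<^sup>2) * ((1 * s - l * (- l / s)) / (s * s)) = inverse (1 / s\<^sup>2) * ((1 / s) / (s * s))"
      by (simp only:)
    also have "\<dots> = 1 / s" using s(1) by (simp add: power2_eq_square)
    finally show ?thesis .
  qed
  ultimately have da: "((\<lambda>l. arctan (l / sqrt (1 - l\<^sup>2))) has_real_derivative 1 / s) (at l)" by simp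
  have "(Kcal has_real_derivative - l / s - (3 * s\<^sup>2 * (- l / s)) / 3 + (1 * arctan (l / s) + 1 / s * l)) (at l)"
    unfolding Kcal_def[abs_def]
  proof (intro DERIV_add DERIV_diff DERIV_cdivide ds)
    show "((\<lambda>x. sqrt (1 - x\<^sup>2) ^ 3) has_real_derivative 3 * s\<^sup>2 * (- l / s)) (at l)"
      using DERIV_power[OF ds, of 3] by (simp add: s_def mult_ac)
    show "((\<lambda>x. x * arctan (x / sqrt (1 - x\<^sup>2))) has_real_derivative 1 * arctan (l / s) + 1 / s * l) (at l)"
      using DERIV_mult[OF DERIV_ident da] by (simp add: s_def)
  qed
  moreover have "- l / s - (3 * s\<^sup>2 * (- l / s)) / 3 + (1 * arctan (l / s) + 1 / s * l) = l * s + arctan (l / s)"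
    using s(1) by (simp add: power2_eq_square)
  ultimately show ?thesis by (simp add: s_def)
qed

lemma Kcal_strict_mono:
  assumes "0 \<le> a" "a < b" "b < 1"
  shows "Kcal a < Kcal b"
\<comment> \<open>The derivative of \<open>Kcal\<close> vanishes at 0, so positivity is asked for in
  the open interval only.\<close>
proof (rule DERIV_pos_imp_increasing_open[OF assms(2)])
  fix x assume x: "a < x" "x < b"
  then have "x > 0" "x < 1" using assms by auto
  then have "x\<^sup>2 < 1" by (simp add: power_less_one_iff)
  then have "x * sqrt (1 - x\<^sup>2) + arctan (x / sqrt (1 - x\<^sup>2)) > 0" using \<open>x > 0\<close> by (intro add_pos_pos) auto
  then show "\<exists>y. (Kcal has_real_derivative y) (at x) \<and> 0 < y"
    using DERIV_Kcal[of x] \<open>x > 0\<close> \<open>x < 1\<close> by auto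
next
  have "continuous (at x) Kcal" if "x \<in> {a..b}" for x
    using that assms by (intro DERIV_isCont[OF DERIV_Kcal]) auto
  then show "continuous_on {a..b} Kcal" by (simp add: continuous_at_imp_continuous_on)
qed

text \<open>Prescribing the momentum modulo \<pi> bounds every real representative away from 0,
  because \<open>cos\<close> decreases on \<open>{0..pi}\<close>; the calibration uses this lower
  bound.\<close>

lemma Re_cis_bound_imp:
  assumes "0 < e" "e < pi" "cos q \<le> - cos e"
  shows "pi - e \<le> \<bar>q\<bar>"
proof (rule ccontr)
  assume "\<not> ?thesis"
  then have "\<bar>q\<bar> < pi - e" by simp
  then have "cos (pi - e) < cos \<bar>q\<bar>" using assms by (intro cos_monotone_0_pi) auto
  then show False using assms by simp
qed

text \<open>The gap and the tolerance have to be uniform in \<open>v\<close>. The surplus \<kappa>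
  of \<open>Kcal\<close> at the level \<mu>/2 is split: a quarter pays for the momentum error
  \<epsilon>, a quarter for the boundary term at \<open>x0\<close>, and half remains as the
  gap.\<close>

lemma nonvanishing_energy_gap:
  assumes mu: "0 < \<mu>" "\<mu> < 1"
  obtains \<delta> \<epsilon> where "\<delta> > 0" "0 < \<epsilon>" "\<epsilon> < pi"
    "\<And>v. X1 v \<Longrightarrow> (\<And>x. \<mu> \<le> norm (v x)) \<Longrightarrow> Re (cis (2 * pmom v)) \<le> - cos \<epsilon> \<Longrightarrow> 2 * sqrt 2 / 3 + \<delta> \<le> energy v"
proof -
  define \<kappa> where "\<kappa> = Kcal (\<mu> / 2) - 2/3"
  have \<kappa>: "\<kappa> > 0" using Kcal_strict_mono[of 0 "\<mu>/2"] mu by (simp add: \<kappa>_def Kcal_0)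
  define \<epsilon> where "\<epsilon> = min 1 (\<kappa> / 2)"
  have \<epsilon>: "0 < \<epsilon>" "\<epsilon> < pi" "\<epsilon> / 2 \<le> \<kappa> / 4" using \<kappa> pi_gt3 by (auto simp: \<epsilon>_def)
  show thesis
  proof (rule that[of "sqrt 2 * (\<kappa> / 2)" \<epsilon>])
    fix v assume X: "X1 v" and lo: "\<And>x. \<mu> \<le> norm (v x)" and re: "Re (cis (2 * pmom v)) \<le> - cos \<epsilon>"
    interpret finite_energy v "wderiv v" by (rule X1_finite_energy[OF X])
    define m where "m = (INF x. norm (v x))"
    have bdd: "bdd_below (range (\<lambda>x. norm (v x)))" by (rule bdd_belowI[of _ 0]) auto
    have m_le: "m \<le> norm (v x)" for x unfolding m_def by (rule cINF_lower[OF bdd]) auto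
    have m_ge: "\<mu> \<le> m" unfolding m_def using lo by (intro cINF_greatest) auto
    have m1: "m \<le> 1"
      by (rule tendsto_lowerbound[OF tendsto_norm_v(1)]) (use m_le in \<open>auto intro!: always_eventually\<close>)
    \<comment> \<open>\<open>t \<le> \<mu> / 2\<close> keeps \<open>l = m - t\<close> above the
      level at which \<kappa> was computed; \<open>t \<le> \<kappa>\<^sup>2 / 64\<close> makes 4t at
      most (\<kappa>/4)^2, where 4t bounds \<open>(norm (v x0))\<^sup>2 - l\<^sup>2\<close>.\<close>
    define t where "t = min (\<mu> / 2) (\<kappa>\<^sup>2 / 64)"
    have t: "t > 0" "t \<le> \<mu> / 2" "t \<le> \<kappa>\<^sup>2 / 64" using mu \<kappa> by (auto simp: t_def)
    obtain x0 where x0: "norm (v x0) < m + t"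
      using cINF_less_iff[of UNIV "\<lambda>x. norm (v x)" "m + t"] bdd t(1) by (auto simp: m_def)
    define l where "l = m - t"
    have l: "0 < l" "l < 1" "\<mu> / 2 \<le> l" "l < m" using m1 m_ge t mu by (auto simp: l_def)
    have lv: "l < norm (v x)" for x using l(4) m_le[of x] by linarith
    define Q where "Q = (LBINT x:{..x0}. outer_mom x) + (LBINT x:{x0..}. outer_mom x)"
    have "cis (2 * pmom v) = cis (- Q)"
    proof -
      have nz: "v x0 \<noteq> 0" using lo[of x0] mu by auto
      have c1: "sgn (v x0) * cnj (sgn (v x0)) = 1"
        using nz complex_norm_square[of "sgn (v x0)"] by (simp add: norm_sgn)
      have c0: "(LBINT x:{x0..x0}. cinner (\<i> * v x) (wderiv v x)) = 0"
        using set_integral_combine[OF set_integrable_cinner[of x0 x0], of x0] by simp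
      \<comment> \<open>With \<open>x1 = x2 = x0\<close> the middle integral is over one point and
        the direction factors cancel.\<close>
      have "cis (2 * pmom v) = cis (LBINT x:{x0..x0}. cinner (\<i> * v x) (wderiv v x)) * sgn (v x0) * cnj (sgn (v x0))
         * cis (- (LBINT x:{..x0}. outer_mom x)) * cis (- (LBINT x:{x0..}. outer_mom x))"
        by (rule cis_pmom[OF X order_refl mu(1)]) (use lo in auto)
      also have "\<dots> = cis (- (LBINT x:{..x0}. outer_mom x)) * cis (- (LBINT x:{x0..}. outer_mom x))"
        unfolding c0 using c1 by simp
      finally show ?thesis by (simp add: cis_mult Q_def add.commute)
    qed
    then have "cos Q \<le> - cos \<epsilon>" using re by simp
    then have Qge: "pi - \<epsilon> \<le> \<bar>Q\<bar>" by (rule Re_cis_bound_imp[OF \<epsilon>(1,2)])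
    have r: "calib l (norm (v x0)) \<le> \<kappa> / 4"
    proof -
      have "calib l (norm (v x0)) \<le> sqrt ((norm (v x0))\<^sup>2 - l\<^sup>2)"
        using l(1) lv[of x0] by (intro calib_le) auto
      also have "\<dots> \<le> sqrt ((\<kappa> / 4)\<^sup>2)"
      proof (rule real_sqrt_le_mono)
        have "(norm (v x0))\<^sup>2 - l\<^sup>2 = (norm (v x0) - l) * (norm (v x0) + l)" by (simp add: power2_eq_square algebra_simps)
        also have "\<dots> \<le> (2 * t) * 2"
          using x0 m1 l lv[of x0] by (intro mult_mono) (auto simp: l_def)
        also have "\<dots> \<le> (\<kappa> / 4)\<^sup>2" using t by (simp add: power_divide)
        finally show "(norm (v x0))\<^sup>2 - l\<^sup>2 \<le> (\<kappa> / 4)\<^sup>2" .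
      qed
      finally show ?thesis using \<kappa> by simp
    qed
    have K: "Kcal (\<mu> / 2) \<le> Kcal l"
      using Kcal_strict_mono[of "\<mu>/2" l] l mu by (cases "l = \<mu> / 2") auto
    then have K': "\<kappa> + 2/3 \<le> Kcal l" by (simp add: \<kappa>_def)
    have "sqrt 2 * (2/3 + \<kappa> / 2) \<le> sqrt 2 * (l / 2 * (pi - \<epsilon>) + (calib l 1 - calib l (norm (v x0))))"
    proof (rule mult_left_mono)
      define A B where "A = l / 2 * (pi - \<epsilon>)" and "B = l / 2 * \<epsilon>"
      have "B \<le> \<epsilon> / 2" using l \<epsilon> by (simp add: B_def)
      moreover have "A + calib l 1 = Kcal l - B"
        using calib_1[OF l(1,2)] by (simp add: A_def B_def algebra_simps diff_divide_distrib)
      ultimately show "2/3 + \<kappa> / 2 \<le> l / 2 * (pi - \<epsilon>) + (calib l 1 - calib l (norm (v x0)))"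
        using K' r \<epsilon>(3) unfolding A_def[symmetric] by simp
    qed simp
    also have "\<dots> \<le> sqrt 2 / 2 * l * \<bar>Q\<bar> + sqrt 2 * (calib l 1 - calib l (norm (v x0)))"
      using mult_left_mono[OF Qge, of "sqrt 2 / 2 * l"] l(1) by (simp add: algebra_simps)
    also have "\<dots> \<le> en v (wderiv v)" unfolding Q_def by (rule calibrated_energy_bound[OF l(1,2) lv])
    finally show "2 * sqrt 2 / 3 + sqrt 2 * (\<kappa> / 2) \<le> energy v" by (simp add: energy_eq_en algebra_simps)
  qed (use \<kappa> \<epsilon> in auto)
qed

section \<open>Quantitative closeness to the kink\<close>

lemma nL2_shift: "nL2 (\<lambda>x. f (x + a)) = nL2 f"
  unfolding nL2_def using lborel_integral_real_affine[of 1 "\<lambda>x. (f x)\<^sup>2" a] by (simp add: add.commute)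

lemma nL2_reflect: "nL2 (\<lambda>x. f (- x)) = nL2 f"
  unfolding nL2_def using lborel_integral_real_affine[of "-1" "\<lambda>x. (f x)\<^sup>2" 0] by simp

lemma nL2_mono:
  assumes "L2 f" "L2 g" "\<And>x. \<bar>f x\<bar> \<le> \<bar>g x\<bar>"
  shows "nL2 f \<le> nL2 g"
  unfolding nL2_def
  by (intro real_sqrt_le_mono integral_mono) (use assms in \<open>auto simp: L2_def abs_le_square_iff\<close>)

lemma is_wderiv_shift:
  assumes "is_wderiv v d"
  shows "is_wderiv (\<lambda>x. v (x + a)) (\<lambda>x. d (x + a))"
  unfolding is_wderiv_def
proof (intro allI impI conjI)
  fix x y :: real assume xy: "x \<le> y"
  have s: "set_integrable lborel {x + a..y + a} d" "v (y + a) - v (x + a) = (LBINT t:{x + a..y + a}. d t)"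
    using assms xy by (auto simp: is_wderiv_def)
  have eq: "indicator {x + a..y + a} (a + 1 * t) *\<^sub>R d (a + 1 * t) = indicator {x..y} t *\<^sub>R d (t + a)" for t
    by (auto simp: indicator_def add.commute)
  show "set_integrable lborel {x..y} (\<lambda>x. d (x + a))"
    using lborel_integrable_real_affine[OF s(1)[unfolded set_integrable_def], of 1 a] eq
    by (simp add: set_integrable_def)
  show "v (y + a) - v (x + a) = (LBINT t:{x..y}. d (t + a))"
    unfolding s(2) set_lebesgue_integral_def
    by (subst lborel_integral_real_affine[of 1 _ a]) (simp_all only: eq, simp_all)
qed

lemma hh_shift: "hh (\<lambda>x. v (x + a)) = (\<lambda>x. hh v (x + a))"
  by (auto simp: hh_def)

lemma ort_shift: "ort (\<lambda>x. v (x + a)) (\<lambda>x. d (x + a)) = (\<lambda>x. ort v d (x + a))"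
  by (auto simp: ort_def rad_def)

lemma rad_reflect: "rad (\<lambda>x. v (- x)) (\<lambda>x. - d (- x)) x = - rad v d (- x)"
  by (auto simp: rad_def)

lemma tanh_scaled_abs: "\<bar>tanh (x / sqrt 2)\<bar> = tanh (\<bar>x\<bar> / sqrt 2)"
proof -
  have "\<bar>tanh y\<bar> = tanh \<bar>y\<bar>" for y :: real by (simp add: abs_if)
  from this[of "x / sqrt 2"] show ?thesis by simp
qed

context finite_energy
begin

lemma shift: "finite_energy (\<lambda>x. v (x + a)) (\<lambda>x. d (x + a))"
proof
  show "is_wderiv (\<lambda>x. v (x + a)) (\<lambda>x. d (x + a))" by (rule is_wderiv_shift[OF wderiv_v])
  show "integrable lborel (\<lambda>x. (norm (d (x + a)))\<^sup>2)"
    using lborel_integrable_real_affine[OF integrable_d, of 1 a] by (simp add: add.commute)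
  show "integrable lborel (\<lambda>x. (1 - (norm (v (x + a)))\<^sup>2)\<^sup>2)"
    using lborel_integrable_real_affine[OF integrable_pot, of 1 a] by (simp add: add.commute)
  show "bounded (range (\<lambda>x. v (x + a)))" by (rule bounded_subset[OF bounded_v]) auto
qed

lemma en_shift: "en (\<lambda>x. v (x + a)) (\<lambda>x. d (x + a)) = en v d"
proof -
  interpret S: finite_energy "\<lambda>x. v (x + a)" "\<lambda>x. d (x + a)" by (rule shift)
  show ?thesis unfolding S.en_eq en_eq hh_shift
    using nL2_shift[of "hh v" a] nL2_shift[of "\<lambda>x. norm (d x)" a] by simp
qed

lemma reflect: "finite_energy (\<lambda>x. v (- x)) (\<lambda>x. - d (- x))"
proof
  show "is_wderiv (\<lambda>x. v (- x)) (\<lambda>x. - d (- x))"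
    unfolding is_wderiv_iff_wd_on by (intro allI wd_on_reflect wd_v)
  show "integrable lborel (\<lambda>x. (norm (- d (- x)))\<^sup>2)"
    using lborel_integrable_real_affine[OF integrable_d, of "-1" 0] by simp
  show "integrable lborel (\<lambda>x. (1 - (norm (v (- x)))\<^sup>2)\<^sup>2)"
    using lborel_integrable_real_affine[OF integrable_pot, of "-1" 0] by simp
  show "bounded (range (\<lambda>x. v (- x)))" by (rule bounded_subset[OF bounded_v]) auto
qed

text \<open>Reflection changes the sign both of \<open>sgn x\<close> and of the radial derivative,
  so the norm of the defect centred at 0 is preserved; estimates on the left half-line are read off
  from the right one.\<close>

lemma reflect_eqs:
  "nL2 (hh (\<lambda>x. v (- x))) = nL2 (hh v)"
  "nL2 (finite_energy.defect (\<lambda>x. v (- x)) (\<lambda>x. - d (- x)) 0) = nL2 (defect 0)"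
proof -
  interpret S: finite_energy "\<lambda>x. v (- x)" "\<lambda>x. - d (- x)" by (rule reflect)
  have "hh (\<lambda>x. v (- x)) = (\<lambda>x. hh v (- x))" by (auto simp: hh_def)
  then show "nL2 (hh (\<lambda>x. v (- x))) = nL2 (hh v)" by (simp add: nL2_reflect)
  have "S.defect 0 = (\<lambda>x. defect 0 (- x))"
    unfolding S.defect_def[abs_def] defect_def rad_reflect by (auto simp: hh_def sgn_if)
  then show "nL2 (S.defect 0) = nL2 (defect 0)" by (simp add: nL2_reflect)
qed

lemma norm_increment_le:
  assumes "x \<le> y"
  shows "norm (v y - v x) \<le> sqrt (y - x) * nL2 (\<lambda>x. norm (d x))"
proof -
  note W = wd_onD[OF wd_v[of x y] order_refl assms order_refl]
  have "norm (v y - v x) \<le> (LBINT t:{x..y}. \<bar>norm (d t)\<bar>)"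
    unfolding W(2) using set_integral_norm_bound[OF W(1)] by simp
  also have "\<dots> \<le> sqrt (y - x) * nL2 (\<lambda>x. norm (d x))" by (rule L2_set_integral_le(2)[OF L2_d assms])
  finally show ?thesis .
qed

lemma sgn_increment_le:
  assumes "x \<le> y" "c > 0" "\<And>t. x \<le> t \<Longrightarrow> t \<le> y \<Longrightarrow> c \<le> norm (v t)"
  shows "norm (sgn (v y) - sgn (v x)) \<le> sqrt (y - x) * nL2 (\<lambda>x. norm (ort v d x)) / c"
proof -
  have nz: "v t \<noteq> 0" if "x \<le> t" "t \<le> y" for t using assms(2) assms(3)[OF that] by auto
  define I where "I = (LBINT t:{x..y}. ang v d t / norm (v t))"
  note L = sgn_lifting[OF wd_v assms(1) nz, folded I_def]
  have io: "set_integrable lborel {x..y} (\<lambda>x. norm (ort v d x))" by (rule L2_set_integral_le(1)[OF L2_ort assms(1)])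
  have "sgn (v y) - sgn (v x) = sgn (v x) * (cis I - 1)"
    using L(2) by (simp add: right_diff_distrib)
  then have "norm (sgn (v y) - sgn (v x)) \<le> \<bar>I\<bar>"
    using norm_cis_minus_1_le[of I] nz[of x] assms(1) by (simp add: norm_mult norm_sgn)
  also have "\<dots> \<le> (LBINT t:{x..y}. norm (ort v d t) / c)"
    unfolding I_def real_norm_def[symmetric]
  proof (rule norm_set_integral_le)
    show "set_integrable lborel {x..y} (\<lambda>t. ang v d t / norm (v t))" using L(1) .
    show "set_integrable lborel {x..y} (\<lambda>t. norm (ort v d t) / c)" using io by (rule set_integrable_divide)
    fix t assume "t \<in> {x..y}"
    then show "norm (ang v d t / norm (v t)) \<le> norm (ort v d t) / c"
      using assms(2,3) abs_ang_le[of v d t] by (auto intro!: frac_le)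
  qed
  also have "\<dots> = (LBINT t:{x..y}. \<bar>norm (ort v d t)\<bar>) / c" by simp
  also have "\<dots> \<le> sqrt (y - x) * nL2 (\<lambda>x. norm (ort v d x)) / c"
    using assms(2) by (intro divide_right_mono L2_set_integral_le(2) L2_ort assms(1)) auto
  finally show ?thesis .
qed

lemma nL2_rad_hh_le: "nL2 (rad v d) * nL2 (hh v) \<le> en v d"
proof -
  have "nL2 (rad v d) \<le> nL2 (\<lambda>x. norm (d x))"
    by (rule nL2_mono[OF L2_rad L2_d]) (use abs_rad_le in auto)
  then have "(nL2 (rad v d))\<^sup>2 \<le> (nL2 (\<lambda>x. norm (d x)))\<^sup>2" by (intro power_mono) auto
  moreover have "0 \<le> (nL2 (rad v d) - nL2 (hh v))\<^sup>2" by simp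
  ultimately show ?thesis unfolding en_eq power2_diff mult.assoc by linarith
qed

lemma Psi_increment_le:
  assumes "x \<le> y"
  shows "\<bar>Psi (norm (v y)) - Psi (norm (v x))\<bar> \<le> sqrt 2 * en v d"
proof -
  have "Psi (norm (v y)) - Psi (norm (v x)) = sqrt 2 * (LBINT t:{x..y}. rad v d t * hh v t)"
    using wd_onD(2)[OF wd_Psi[of x y] order_refl assms order_refl] by simp
  moreover have "\<bar>LBINT t:{x..y}. rad v d t * hh v t\<bar> \<le> nL2 (rad v d) * nL2 (hh v)"
    by (rule abs_integral_le_L2(2)[OF L2_rad L2_hh]) auto
  ultimately show ?thesis using nL2_rad_hh_le by (simp add: abs_mult)
qed

text \<open>\<open>Psi \<rho>\<close> varies by at most \<surd>2 times the energy, while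
  \<open>Psi r\<close> tends to minus infinity as r grows. The bound depends on the energy alone and
  is thus uniform along a sequence, unlike \<open>bounded_v\<close>.\<close>

lemma norm_v_le:
  assumes "norm (v 0) \<le> 1"
  shows "norm (v x) \<le> 3 + en v d"
proof (rule ccontr)
  assume "\<not> ?thesis"
  then have r: "norm (v x) > 3 + en v d" by simp
  have e0: "en v d \<ge> 0" by (simp add: en_def)
  let ?r = "norm (v x)"
  have "\<bar>Psi ?r - Psi (norm (v 0))\<bar> \<le> sqrt 2 * en v d"
    using Psi_increment_le[of 0 x] Psi_increment_le[of x 0] by (cases "x \<ge> 0") (auto simp: abs_minus_commute)
  moreover have "Psi (norm (v 0)) \<ge> 0"
  proof -
    have "norm (v 0) ^ 3 \<le> norm (v 0)" using assms power_decreasing[of 1 3 "norm (v 0)"] by simp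
    then show ?thesis unfolding Psi_def using norm_ge_zero[of "v 0"] by linarith
  qed
  ultimately have "?r ^ 3 / 3 - ?r \<le> sqrt 2 * en v d" unfolding Psi_def by linarith
  \<comment> \<open>For r \<ge> 3 this gives r^3/3 - r \<ge> 2r, hence 2r \<le> \<surd>2 E, against
    r > 3 + E.\<close>
  moreover have "3 * ?r \<le> ?r ^ 3 / 3"
  proof -
    have "3 * 3 \<le> ?r * ?r" using r e0 by (intro mult_mono) auto
    then have "9 * ?r \<le> ?r * ?r * ?r" by (intro mult_right_mono) auto
    then show ?thesis by (simp add: power3_eq_cube)
  qed
  moreover have "sqrt 2 * en v d \<le> 2 * en v d"
    using e0 real_sqrt_le_mono[of 2 4] by (intro mult_right_mono) auto
  ultimately show False using r by linarith
qed

text \<open>The difference \<open>y\<close> with the kink profile satisfies \<open>y' = - (\<rho> + tanh) y / \<surd>2 + defect\<close>. The first term is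
  damping and can be dropped, so no Gronwall argument is needed.\<close>

lemma norm_v_near_tanh_pos:
  assumes "norm (v 0) \<le> 1" "0 \<le> x"
  shows "(norm (v x) - tanh (x / sqrt 2))\<^sup>2 \<le> (norm (v 0))\<^sup>2 + 2 * (4 + en v d) * sqrt x * nL2 (defect 0)"
proof -
  define C where "C = 4 + en v d"
  define y where "y t = norm (v t) - tanh (t / sqrt 2)" for t
  have wy: "wd_on 0 x y (\<lambda>t. rad v d t - kinkd t)"
    unfolding y_def[abs_def]
  proof (rule wd_on_diff[OF wd_rho])
    show "wd_on 0 x (\<lambda>t. tanh (t / sqrt 2)) kinkd"
      using DERIV_tanh_scaled by (intro wd_on_C1 continuous_kinkd) (simp add: has_real_derivative_iff_has_vector_derivative)
  qed
  let ?k = "\<lambda>t. (rad v d t - kinkd t) * y t + y t * (rad v d t - kinkd t)"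
  have wyy: "wd_on 0 x (\<lambda>t. y t * y t) ?k" by (rule wd_on_bilinear[OF bounded_bilinear_mult wy wy])
  note W = wd_onD[OF wyy order_refl assms(2) order_refl]
  have yC: "\<bar>y t\<bar> \<le> C" for t
    using norm_v_le[OF assms(1), of t] tanh_real_lt_1[of "t / sqrt 2"] tanh_real_gt_neg1[of "t / sqrt 2"] norm_ge_zero[of "v t"]
    unfolding y_def C_def by linarith
  have C0: "C \<ge> 0" using yC[of 0] by linarith
  have ab: "set_integrable lborel {0..x} (\<lambda>t. \<bar>defect 0 t\<bar>)"
    by (rule L2_set_integral_le(1)[OF L2_abs[OF L2_defect] assms(2)])
  have pw: "?k t \<le> 2 * C * \<bar>defect 0 t\<bar>" if "t > 0" for t
  proof -
    have "rad v d t = defect 0 t + hh v t" using that by (simp add: defect_def)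
    \<comment> \<open>Factoring (1 - \<rho>^2) - (1 - tanh^2) = -(\<rho> + tanh)(\<rho> - tanh)
      isolates the damping coefficient \<open>p\<close>, nonnegative because
      \<open>t > 0\<close>.\<close>
    define p where "p = (norm (v t) + tanh (t / sqrt 2)) / sqrt 2"
    have "hh v t - kinkd t = - (p * y t)"
      by (simp add: hh_def kinkd_def y_def p_def power2_eq_square algebra_simps add_divide_distrib diff_divide_distrib)
    with \<open>rad v d t = defect 0 t + hh v t\<close> have "rad v d t - kinkd t = defect 0 t - p * y t" by simp
    then have "?k t = 2 * (defect 0 t * y t) - 2 * (p * (y t * y t))"
      by (simp only:) (simp add: algebra_simps)
    moreover have "0 \<le> p * (y t * y t)"
      unfolding p_def using that
      by (intro mult_nonneg_nonneg[OF divide_nonneg_nonneg[OF add_nonneg_nonneg]] zero_le_square) auto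
    moreover have "defect 0 t * y t \<le> \<bar>defect 0 t\<bar> * C"
      using mult_left_mono[OF yC[of t], of "\<bar>defect 0 t\<bar>"] abs_ge_self[of "defect 0 t * y t"] by (simp add: abs_mult)
    ultimately show ?thesis by (simp add: algebra_simps)
  qed
  have "y x * y x - y 0 * y 0 \<le> (LBINT t:{0..x}. 2 * C * \<bar>defect 0 t\<bar>)"
    unfolding W(2)
  proof (rule set_integral_mono_AE)
    \<comment> \<open>The point 0 is excluded: there \<open>sgn 0 = 0\<close> and the defect does
      not determine \<open>rad\<close>.\<close>
    show "AE t \<in> {0..x} in lborel. ?k t \<le> 2 * C * \<bar>defect 0 t\<bar>"
    proof (rule AE_I'[of "{0}"])
      show "{t \<in> space lborel. \<not> (t \<in> {0..x} \<longrightarrow> ?k t \<le> 2 * C * \<bar>defect 0 t\<bar>)} \<subseteq> {0}"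
        using pw by force
    qed auto
  qed (use W(1) ab in auto)
  also have "\<dots> = 2 * C * (LBINT t:{0..x}. \<bar>defect 0 t\<bar>)" by simp
  also have "\<dots> \<le> 2 * C * (sqrt (x - 0) * nL2 (defect 0))"
    using C0 by (intro mult_left_mono L2_set_integral_le(2) L2_defect assms(2)) auto
  finally show ?thesis by (simp add: y_def C_def power2_eq_square mult.assoc)
qed

lemma norm_v_near_tanh:
  assumes "norm (v 0) \<le> 1"
  shows "(norm (v x) - \<bar>tanh (x / sqrt 2)\<bar>)\<^sup>2 \<le> (norm (v 0))\<^sup>2 + 2 * (4 + en v d) * sqrt \<bar>x\<bar> * nL2 (defect 0)"
proof (cases "x \<ge> 0")
  case True
  then show ?thesis using norm_v_near_tanh_pos[OF assms True] by (simp add: tanh_scaled_abs)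
next
  case False
  interpret S: finite_energy "\<lambda>x. v (- x)" "\<lambda>x. - d (- x)" by (rule reflect)
  have "en (\<lambda>x. v (- x)) (\<lambda>x. - d (- x)) = en v d"
    unfolding S.en_eq en_eq reflect_eqs using nL2_reflect[of "\<lambda>x. norm (d x)"] by simp
  then show ?thesis using S.norm_v_near_tanh_pos[of "- x"] assms False
    by (simp add: tanh_scaled_abs reflect_eqs)
qed

text \<open>To the right of 0, \<open>rad = defect + hh\<close>, so \<open>Psi \<rho>\<close>
  increases up to an error, the integral of \<open>defect * hh\<close>. This lower bound is uniform
  on the half-line, whereas the error in \<open>norm_v_near_tanh\<close> grows with the distance
  from 0.\<close>

lemma Psi_lower_pos:
  assumes "0 < x" "x \<le> y"
  shows "Psi (norm (v x)) - sqrt 2 * (nL2 (defect 0) * nL2 (hh v)) \<le> Psi (norm (v y))"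
proof -
  have i1: "set_integrable lborel {x..y} (\<lambda>t. rad v d t * hh v t)"
    unfolding set_integrable_def by (rule integrable_mult_indicator[OF _ integrable_rad_hh]) simp
  have i2: "set_integrable lborel {x..y} (\<lambda>t. defect 0 t * hh v t)"
    by (rule abs_integral_le_L2(1)[OF L2_defect L2_hh]) auto
  have "- (nL2 (defect 0) * nL2 (hh v)) \<le> (LBINT t:{x..y}. defect 0 t * hh v t)"
    using abs_integral_le_L2(2)[OF L2_defect[of 0] L2_hh, of "\<lambda>t. defect 0 t * hh v t" "{x..y}"] by simp
  also have "\<dots> \<le> (LBINT t:{x..y}. rad v d t * hh v t)"
  proof (rule set_integral_mono[OF i2 i1])
    fix t assume "t \<in> {x..y}"
    then have "rad v d t = defect 0 t + hh v t" using assms by (simp add: defect_def)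
    then show "defect 0 t * hh v t \<le> rad v d t * hh v t" by (simp add: distrib_right)
  qed
  finally have "- (nL2 (defect 0) * nL2 (hh v)) \<le> (LBINT t:{x..y}. rad v d t * hh v t)" .
  then have "sqrt 2 * - (nL2 (defect 0) * nL2 (hh v)) \<le> sqrt 2 * (LBINT t:{x..y}. rad v d t * hh v t)"
    by (intro mult_left_mono) auto
  also have "\<dots> = Psi (norm (v y)) - Psi (norm (v x))"
    using wd_onD(2)[OF wd_Psi[of x y] order_refl assms(2) order_refl] by simp
  finally show ?thesis by simp
qed

lemma Psi_lower_neg:
  assumes "x < 0" "y \<le> x"
  shows "Psi (norm (v x)) - sqrt 2 * (nL2 (defect 0) * nL2 (hh v)) \<le> Psi (norm (v y))"
proof -
  interpret S: finite_energy "\<lambda>x. v (- x)" "\<lambda>x. - d (- x)" by (rule reflect)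
  show ?thesis using S.Psi_lower_pos[of "- x" "- y"] assms by (simp add: reflect_eqs)
qed

end

lemma Psi_le: "0 \<le> r \<Longrightarrow> Psi r \<le> r"
  by (simp add: Psi_def)

section \<open>Convergence\<close>

abbreviation nort :: "(real \<Rightarrow> complex) \<Rightarrow> (real \<Rightarrow> complex) \<Rightarrow> real" where
  "nort v d \<equiv> nL2 (\<lambda>x. norm (ort v d x))"

lemma Psi_pos: "0 < r \<Longrightarrow> r \<le> 1 \<Longrightarrow> 0 < Psi r"
  using power_decreasing[of 1 3 r] by (simp add: Psi_def)

text \<open>The limit inherits the common modulus of continuity, so convergence on a finite net of
  \<open>K\<close> controls everything in between.\<close>

lemma uniform_limit_of_equicontinuous:
  fixes f :: "nat \<Rightarrow> real \<Rightarrow> 'a::real_normed_vector"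
  assumes f: "\<And>n x y. norm (f n x - f n y) \<le> L * sqrt \<bar>x - y\<bar>"
    and lim: "\<And>x. (\<lambda>n. f n x) \<longlonglongrightarrow> g x" and "compact K"
  shows "uniform_limit K f g sequentially"
proof (rule uniform_limitI)
  fix e :: real assume e: "e > 0"
  have g: "norm (g x - g y) \<le> L * sqrt \<bar>x - y\<bar>" for x y
    by (rule tendsto_upperbound[OF tendsto_norm[OF tendsto_diff[OF lim lim]]]) (auto simp: f)
  have "L \<ge> 0" using order_trans[OF norm_ge_zero f[of 0 1 0]] by simp
  \<comment> \<open>\<open>L + 1\<close> instead of \<open>L\<close> covers \<open>L = 0\<close> and
    makes the inequality below strict.\<close>
  define d where "d = (e / (3 * (L + 1)))\<^sup>2"
  have d: "d > 0" using e \<open>L \<ge> 0\<close> by (simp add: d_def)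
  have small: "L * sqrt \<bar>x - y\<bar> < e / 3" if "\<bar>x - y\<bar> < d" for x y
  proof -
    have "sqrt \<bar>x - y\<bar> \<le> e / (3 * (L + 1))"
      using real_sqrt_le_mono[OF less_imp_le[OF that]] e \<open>L \<ge> 0\<close> by (simp add: d_def)
    then have "L * sqrt \<bar>x - y\<bar> \<le> L * (e / (3 * (L + 1)))" using \<open>L \<ge> 0\<close> by (rule mult_left_mono)
    also have "\<dots> < (L + 1) * (e / (3 * (L + 1)))" using e \<open>L \<ge> 0\<close> by (intro mult_strict_right_mono) auto
    also have "\<dots> = e / 3" using \<open>L \<ge> 0\<close> by (simp add: field_simps)
    finally show ?thesis .
  qed
  obtain P where P: "finite P" "K \<subseteq> (\<Union>p\<in>P. ball p d)"
    using \<open>compact K\<close> d unfolding compact_eq_totally_bounded by meson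
  have "eventually (\<lambda>n. \<forall>p\<in>P. dist (f n p) (g p) < e / 3) sequentially"
    using P(1) e by (intro eventually_ball_finite ballI tendstoD[OF lim]) auto
  then show "\<forall>\<^sub>F n in sequentially. \<forall>x\<in>K. dist (f n x) (g x) < e"
  proof eventually_elim
    case (elim n)
    show ?case
    proof
      fix x assume "x \<in> K"
      then obtain p where p: "p \<in> P" "\<bar>x - p\<bar> < d" using P(2) by (auto simp: dist_real_def abs_minus_commute)
      have "dist (f n x) (g x) \<le> dist (f n x) (f n p) + dist (f n p) (g p) + dist (g p) (g x)"
        by (meson dist_triangle order_trans add_mono order_refl dist_triangle2 dist_triangle_le)
      also have "\<dots> < e / 3 + e / 3 + e / 3"
        using elim p small[OF p(2)] f[of n x p] g[of x p]
        by (intro add_strict_mono) (auto simp: dist_norm norm_minus_commute)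
      finally show "dist (f n x) (g x) < e" by simp
    qed
  qed
qed

text \<open>The recentred subsequence before its phases are related: that relation is derived with
  \<open>lower_bound_away\<close>, proved here, and only then can \<open>kink_seq_phase\<close> be
  entered.\<close>

locale kink_seq =
  fixes w D :: "nat \<Rightarrow> real \<Rightarrow> complex" and B :: real
  assumes fe: "\<And>n. finite_energy (w n) (D n)"
    and en_le: "\<And>n. en (w n) (D n) \<le> B"
    and le1: "\<And>n. norm (w n 0) \<le> 1"
    and m0: "(\<lambda>n. norm (w n 0)) \<longlonglongrightarrow> 0"
    and ort0: "(\<lambda>n. nort (w n) (D n)) \<longlonglongrightarrow> 0"
    and def0: "(\<lambda>n. nL2 (finite_energy.defect (w n) (D n) 0)) \<longlonglongrightarrow> 0"
begin

lemma nL2_bounds: "nL2 (hh (w n)) \<le> sqrt (2 * B)" "nL2 (\<lambda>x. norm (D n x)) \<le> sqrt (2 * B)"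
  using finite_energy.nL2_le_en[OF fe, of n] en_le[of n] by (auto intro!: real_le_rsqrt)

lemma norm_tendsto: "(\<lambda>n. norm (w n x)) \<longlonglongrightarrow> \<bar>tanh (x / sqrt 2)\<bar>"
proof -
  let ?R = "\<lambda>n. nL2 (finite_energy.defect (w n) (D n) 0)"
  have le: "(norm (w n x) - \<bar>tanh (x / sqrt 2)\<bar>)\<^sup>2 \<le> (norm (w n 0))\<^sup>2 + 2 * (4 + B) * sqrt \<bar>x\<bar> * ?R n" for n
  proof -
    have "(norm (w n x) - \<bar>tanh (x / sqrt 2)\<bar>)\<^sup>2 \<le> (norm (w n 0))\<^sup>2 + 2 * (4 + en (w n) (D n)) * sqrt \<bar>x\<bar> * ?R n"
      by (rule finite_energy.norm_v_near_tanh[OF fe le1])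
    also have "\<dots> \<le> (norm (w n 0))\<^sup>2 + 2 * (4 + B) * sqrt \<bar>x\<bar> * ?R n"
      using en_le[of n] by (intro add_left_mono mult_right_mono) auto
    finally show ?thesis .
  qed
  have "(\<lambda>n. (norm (w n 0))\<^sup>2 + 2 * (4 + B) * sqrt \<bar>x\<bar> * ?R n) \<longlonglongrightarrow> 0\<^sup>2 + 2 * (4 + B) * sqrt \<bar>x\<bar> * 0"
    by (intro tendsto_intros m0 def0)
  then have up: "(\<lambda>n. (norm (w n 0))\<^sup>2 + 2 * (4 + B) * sqrt \<bar>x\<bar> * ?R n) \<longlonglongrightarrow> 0" by simp
  have "(\<lambda>n. (norm (w n x) - \<bar>tanh (x / sqrt 2)\<bar>)\<^sup>2) \<longlonglongrightarrow> 0"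
    by (rule tendsto_sandwich[OF _ _ tendsto_const up]) (use le in \<open>auto intro!: always_eventually\<close>)
  then have "(\<lambda>n. sqrt ((norm (w n x) - \<bar>tanh (x / sqrt 2)\<bar>)\<^sup>2)) \<longlonglongrightarrow> sqrt 0" by (rule tendsto_real_sqrt)
  then have "(\<lambda>n. norm (w n x) - \<bar>tanh (x / sqrt 2)\<bar>) \<longlonglongrightarrow> 0" by (simp add: tendsto_rabs_zero_iff)
  then show ?thesis by (simp add: LIM_zero_iff)
qed

text \<open>At \<plusminus>\<open>x0\<close> the modulus tends to a positive value, and further out
  \<open>Psi \<rho>\<close> can drop only by a vanishing amount; \<open>Psi r \<le> r\<close> turns
  this into a bound for the modulus.\<close>

lemma lower_bound_away:
  assumes "x0 > 0"
  obtains c where "c > 0" "eventually (\<lambda>n. \<forall>y. x0 \<le> \<bar>y\<bar> \<longrightarrow> c \<le> norm (w n y)) sequentially"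
proof -
  let ?R = "\<lambda>n. nL2 (finite_energy.defect (w n) (D n) 0)"
  define T where "T = tanh (x0 / sqrt 2)"
  have T: "0 < T" "T \<le> 1" using assms tanh_real_lt_1[of "x0 / sqrt 2"] by (auto simp: T_def)
  then have P: "Psi T > 0" by (rule Psi_pos)
  have lim: "(\<lambda>n. Psi (norm (w n x)) - sqrt 2 * (?R n * sqrt (2 * B))) \<longlonglongrightarrow> Psi T" if "\<bar>x\<bar> = x0" for x
  proof -
    have "(\<lambda>n. norm (w n x)) \<longlonglongrightarrow> T" using norm_tendsto[of x] that by (simp add: tanh_scaled_abs T_def)
    then have "(\<lambda>n. norm (w n x) - norm (w n x) ^ 3 / 3 - sqrt 2 * (?R n * sqrt (2 * B))) \<longlonglongrightarrow> T - T ^ 3 / 3 - sqrt 2 * (0 * sqrt (2 * B))"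
      by (intro tendsto_intros def0) auto
    then show ?thesis by (simp add: Psi_def)
  qed
  have ev: "eventually (\<lambda>n. Psi T / 2 < Psi (norm (w n x)) - sqrt 2 * (?R n * sqrt (2 * B))) sequentially" if "\<bar>x\<bar> = x0" for x
    using order_tendstoD(1)[OF lim[OF that], of "Psi T / 2"] P by simp
  have x0s: "\<bar>x0\<bar> = x0" "\<bar>- x0\<bar> = x0" using assms by auto
  have hb: "sqrt 2 * (?R n * nL2 (hh (w n))) \<le> sqrt 2 * (?R n * sqrt (2 * B))" for n
    by (intro mult_left_mono nL2_bounds) auto
  show thesis
  proof (rule that[of "Psi T / 2"])
    show "eventually (\<lambda>n. \<forall>y. x0 \<le> \<bar>y\<bar> \<longrightarrow> Psi T / 2 \<le> norm (w n y)) sequentially"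
      using ev[OF x0s(1)] ev[OF x0s(2)]
    proof eventually_elim
      case (elim n)
      show ?case
      proof (intro allI impI)
        fix y assume "x0 \<le> \<bar>y\<bar>"
        then consider "x0 \<le> y" | "y \<le> - x0" by linarith
        then have "Psi T / 2 \<le> Psi (norm (w n y))"
        proof cases
          case 1
          show ?thesis using finite_energy.Psi_lower_pos[OF fe assms 1, of n] elim(1) hb[of n] by linarith
        next
          case 2
          have "- x0 < 0" using assms by simp
          from finite_energy.Psi_lower_neg[OF fe this 2, of n] show ?thesis using elim(2) hb[of n] by linarith
        qed
        then show "Psi T / 2 \<le> norm (w n y)" using Psi_le[of "norm (w n y)"] by simp
      qed
    qed
  qed (use P in simp)
qed

lemma hh_tendsto: "(\<lambda>n. hh (w n) x) \<longlonglongrightarrow> kinkd x"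
proof -
  have "(\<lambda>n. (1 - (norm (w n x))\<^sup>2) / sqrt 2) \<longlonglongrightarrow> (1 - \<bar>tanh (x / sqrt 2)\<bar>\<^sup>2) / sqrt 2"
    by (intro tendsto_intros norm_tendsto) auto
  then show ?thesis by (simp add: hh_def kinkd_def)
qed

text \<open>\<open>hh\<^sup>2\<close> is the signed product, whose integral depends on
  \<open>norm (w n 0)\<close> alone, minus \<open>defect * hh\<close>, which is negligible. So no
  potential energy escapes to infinity.\<close>

lemma nL2_hh_tendsto: "(\<lambda>n. (nL2 (hh (w n)))\<^sup>2) \<longlonglongrightarrow> (nL2 kinkd)\<^sup>2"
proof -
  define R where "R n = nL2 (finite_energy.defect (w n) (D n) 0)" for n
  define I where "I n = (LBINT x. finite_energy.defect (w n) (D n) 0 x * hh (w n) x)" for n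
  have eq: "(nL2 (hh (w n)))\<^sup>2 = (4/3 - 2 * Psi (norm (w n 0))) / sqrt 2 - I n" for n
  proof -
    interpret F: finite_energy "w n" "D n" by (rule fe)
    have "(hh (w n) x)\<^sup>2 = sgn (x - 0) * (rad (w n) (D n) x * hh (w n) x) - F.defect 0 x * hh (w n) x" for x
      by (simp add: F.defect_def power2_eq_square algebra_simps)
    then have "(nL2 (hh (w n)))\<^sup>2 = (LBINT x. sgn (x - 0) * (rad (w n) (D n) x * hh (w n) x) - F.defect 0 x * hh (w n) x)"
      by (simp add: nL2_sq)
    also have "\<dots> = (LBINT x. sgn (x - 0) * (rad (w n) (D n) x * hh (w n) x)) - (LBINT x. F.defect 0 x * hh (w n) x)"
      by (rule Bochner_Integration.integral_diff[OF F.signed_integral(1) L2_integrable_mult[OF F.L2_defect F.L2_hh]])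
    finally show ?thesis unfolding F.signed_integral(2) I_def .
  qed
  have "I \<longlonglongrightarrow> 0"
  proof (rule Lim_null_comparison)
    have "\<bar>I n\<bar> \<le> R n * sqrt (2 * B)" for n
    proof -
      interpret F: finite_energy "w n" "D n" by (rule fe)
      have "\<bar>I n\<bar> \<le> R n * nL2 (hh (w n))" unfolding I_def R_def by (rule L2_Cauchy_Schwarz[OF F.L2_defect F.L2_hh])
      also have "\<dots> \<le> R n * sqrt (2 * B)" by (intro mult_left_mono nL2_bounds) (simp add: R_def)
      finally show ?thesis .
    qed
    then show "\<forall>\<^sub>F n in sequentially. norm (I n) \<le> R n * sqrt (2 * B)" by simp
    show "(\<lambda>n. R n * sqrt (2 * B)) \<longlonglongrightarrow> 0" using tendsto_mult_left_zero[OF def0] by (simp add: R_def)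
  qed
  moreover have "(\<lambda>n. Psi (norm (w n 0))) \<longlonglongrightarrow> 0 - 0 ^ 3 / 3"
    unfolding Psi_def by (intro tendsto_intros m0) auto
  ultimately have "(\<lambda>n. (4/3 - 2 * Psi (norm (w n 0))) / sqrt 2 - I n) \<longlonglongrightarrow> (4/3 - 2 * (0 - 0 ^ 3 / 3)) / sqrt 2 - 0"
    by (intro tendsto_intros) auto
  moreover have "(4/3 - 2 * (0 - 0 ^ 3 / 3)) / sqrt 2 - 0 = (nL2 kinkd)\<^sup>2"
    unfolding nL2_kinkd by (simp add: field_simps)
  ultimately show ?thesis by (simp add: eq)
qed

text \<open>After expanding the square, the norms converge by \<open>nL2_hh_tendsto\<close> and the
  cross term by domination: \<open>hh\<close> is uniformly bounded and \<open>kinkd\<close> is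
  integrable.\<close>

lemma hh_L2_convergence: "(\<lambda>n. LBINT x. (hh (w n) x - kinkd x)\<^sup>2) \<longlonglongrightarrow> 0"
proof -
  define C where "C = (1 + (3 + B)\<^sup>2) / sqrt 2"
  have hb: "\<bar>hh (w n) x\<bar> \<le> C" for n x
  proof -
    have "norm (w n x) \<le> 3 + B" using finite_energy.norm_v_le[OF fe le1, of n x] en_le[of n] by linarith
    then have "(norm (w n x))\<^sup>2 \<le> (3 + B)\<^sup>2" by (intro power_mono) auto
    then have "\<bar>1 - (norm (w n x))\<^sup>2\<bar> \<le> 1 + (3 + B)\<^sup>2" by (simp add: abs_le_iff)
    then show ?thesis by (simp add: hh_def C_def divide_right_mono)
  qed
  have m: "hh (w n) \<in> borel_measurable borel" for n by (rule finite_energy.measurable_parts(4)[OF fe])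
  have cross: "(\<lambda>n. LBINT x. hh (w n) x * kinkd x) \<longlonglongrightarrow> (LBINT x. kinkd x * kinkd x)"
  proof (rule integral_dominated_convergence[where w="\<lambda>x. C * kinkd x"])
    show "AE x in lborel. norm (hh (w n) x * kinkd x) \<le> C * kinkd x" for n
      using hb[of n] less_imp_le[OF kinkd_pos] by (auto simp: abs_mult intro!: mult_right_mono)
    show "AE x in lborel. (\<lambda>n. hh (w n) x * kinkd x) \<longlonglongrightarrow> kinkd x * kinkd x"
      by (intro AE_I2 tendsto_intros hh_tendsto)
  qed (use m integrable_kinkd in auto)
  have eq: "(LBINT x. (hh (w n) x - kinkd x)\<^sup>2) = (nL2 (hh (w n)))\<^sup>2 - 2 * (LBINT x. hh (w n) x * kinkd x) + (nL2 kinkd)\<^sup>2" for n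
  proof -
    interpret F: finite_energy "w n" "D n" by (rule fe)
    have i: "integrable lborel (\<lambda>x. (hh (w n) x)\<^sup>2)" "integrable lborel (\<lambda>x. hh (w n) x * kinkd x)" "integrable lborel (\<lambda>x. (kinkd x)\<^sup>2)"
      using F.L2_hh L2_kinkd L2_integrable_mult[OF F.L2_hh L2_kinkd] by (auto simp: L2_def)
    have "(LBINT x. (hh (w n) x - kinkd x)\<^sup>2) = (LBINT x. (hh (w n) x)\<^sup>2 - 2 * (hh (w n) x * kinkd x) + (kinkd x)\<^sup>2)"
      by (rule Bochner_Integration.integral_cong) (auto simp: power2_diff)
    then show ?thesis using i by (simp add: nL2_sq)
  qed
  have "(\<lambda>n. (nL2 (hh (w n)))\<^sup>2 - 2 * (LBINT x. hh (w n) x * kinkd x) + (nL2 kinkd)\<^sup>2)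
      \<longlonglongrightarrow> (nL2 kinkd)\<^sup>2 - 2 * (LBINT x. kinkd x * kinkd x) + (nL2 kinkd)\<^sup>2"
    by (intro tendsto_intros cross nL2_hh_tendsto)
  moreover have "(LBINT x. kinkd x * kinkd x) = (nL2 kinkd)\<^sup>2" unfolding nL2_sq by (simp add: power2_eq_square)
  ultimately show ?thesis by (simp add: eq)
qed

end

text \<open>The points \<plusminus>1 stand for the two half-lines; the opposite signs encode the
  momentum constraint.\<close>

locale kink_seq_phase = kink_seq +
  fixes z :: complex
  assumes z1: "norm z = 1"
    and phase_pos: "(\<lambda>n. sgn (w n 1)) \<longlonglongrightarrow> z"
    and phase_neg: "(\<lambda>n. sgn (w n (-1))) \<longlonglongrightarrow> - z"
begin

text \<open>Between two points on the same side of 0 the modulus stays away from 0 and the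
  non-radial part tends to 0, so the direction hardly turns.\<close>

lemma sgn_diff_tendsto:
  assumes "0 < x * y"
  shows "(\<lambda>n. sgn (w n y) - sgn (w n x)) \<longlonglongrightarrow> 0"
proof -
  have *: "(\<lambda>n. sgn (w n q) - sgn (w n p)) \<longlonglongrightarrow> 0" if pq: "p \<le> q" "0 < p * q" for p q
  proof -
    define x0 where "x0 = min \<bar>p\<bar> \<bar>q\<bar>"
    have x0: "x0 > 0" using pq(2) by (auto simp: x0_def)
    obtain c where c: "c > 0" "eventually (\<lambda>n. \<forall>y. x0 \<le> \<bar>y\<bar> \<longrightarrow> c \<le> norm (w n y)) sequentially"
      using lower_bound_away[OF x0] by blast
    have out: "x0 \<le> \<bar>t\<bar>" if "p \<le> t" "t \<le> q" for t
      using pq that by (auto simp: x0_def zero_less_mult_iff)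
    show ?thesis
    proof (rule Lim_null_comparison)
      show "eventually (\<lambda>n. norm (sgn (w n q) - sgn (w n p)) \<le> sqrt (q - p) * nort (w n) (D n) / c) sequentially"
        using c(2)
      proof eventually_elim
        case (elim n)
        then show ?case using out by (intro finite_energy.sgn_increment_le[OF fe pq(1) c(1)]) auto
      qed
      have "(\<lambda>n. sqrt (q - p) * nort (w n) (D n) / c) \<longlonglongrightarrow> sqrt (q - p) * 0 / c"
        using c(1) by (intro tendsto_intros ort0) auto
      then show "(\<lambda>n. sqrt (q - p) * nort (w n) (D n) / c) \<longlonglongrightarrow> 0" by simp
    qed
  qed
  show ?thesis
  proof (cases "x \<le> y")
    case True then show ?thesis using *[OF True assms] by simp
  next
    case False
    then have "(\<lambda>n. sgn (w n x) - sgn (w n y)) \<longlonglongrightarrow> 0" using *[of y x] assms by (simp add: mult.commute)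
    from tendsto_minus[OF this] show ?thesis by simp
  qed
qed

lemma sgn_tendsto: "x \<noteq> 0 \<Longrightarrow> (\<lambda>n. sgn x *\<^sub>R sgn (w n x)) \<longlonglongrightarrow> z"
proof -
  assume "x \<noteq> 0"
  then consider "x > 0" | "x < 0" by linarith
  then show ?thesis
  proof cases
    case 1
    have "(\<lambda>n. (sgn (w n x) - sgn (w n 1)) + sgn (w n 1)) \<longlonglongrightarrow> 0 + z"
      using 1 by (intro tendsto_add sgn_diff_tendsto phase_pos) auto
    then show ?thesis using 1 by simp
  next
    case 2
    have "(\<lambda>n. - ((sgn (w n x) - sgn (w n (-1))) + sgn (w n (-1)))) \<longlonglongrightarrow> - (0 + - z)"
      using 2 by (intro tendsto_minus tendsto_add sgn_diff_tendsto phase_neg) auto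
    then show ?thesis using 2 by simp
  qed
qed

lemma pointwise_convergence: "(\<lambda>n. w n x) \<longlonglongrightarrow> z * kink x"
proof (cases "x = 0")
  case True
  then show ?thesis using m0 by (simp add: kink_def tendsto_norm_zero_iff)
next
  case False
  have "(\<lambda>n. (sgn x * norm (w n x)) *\<^sub>R (sgn x *\<^sub>R sgn (w n x))) \<longlonglongrightarrow> (sgn x * \<bar>tanh (x / sqrt 2)\<bar>) *\<^sub>R z"
    by (intro tendsto_intros norm_tendsto sgn_tendsto False)
  moreover have "(sgn x * norm (w n x)) *\<^sub>R (sgn x *\<^sub>R sgn (w n x)) = w n x" for n
    using False by (cases "w n x = 0") (auto simp: sgn_if sgn_div_norm)
  moreover have "(sgn x * \<bar>tanh (x / sqrt 2)\<bar>) *\<^sub>R z = z * kink x"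
  proof -
    have "sgn x * \<bar>tanh (x / sqrt 2)\<bar> = tanh (x / sqrt 2)"
      using False by (simp add: sgn_if abs_if divide_less_0_iff)
    then show ?thesis by (simp add: kink_def scaleR_conv_of_real)
  qed
  ultimately show ?thesis by simp
qed

lemma locally_uniform_convergence: "compact K \<Longrightarrow> uniform_limit K w (\<lambda>x. z * kink x) sequentially"
proof (rule uniform_limit_of_equicontinuous[where L="sqrt (2 * B)"])
  fix n x y
  have *: "norm (w n q - w n p) \<le> sqrt (2 * B) * sqrt \<bar>q - p\<bar>" if "p \<le> q" for p q
  proof -
    have "norm (w n q - w n p) \<le> sqrt (q - p) * nL2 (\<lambda>x. norm (D n x))"
      by (rule finite_energy.norm_increment_le[OF fe that])
    also have "\<dots> \<le> sqrt (q - p) * sqrt (2 * B)" using that by (intro mult_left_mono nL2_bounds) auto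
    finally show ?thesis using that by (simp add: mult.commute)
  qed
  show "norm (w n x - w n y) \<le> sqrt (2 * B) * sqrt \<bar>x - y\<bar>"
    using *[of y x] *[of x y] by (cases "y \<le> x") (auto simp: norm_minus_commute abs_minus_commute)
qed (use pointwise_convergence in auto)

lemma potential_convergence:
  "(\<lambda>n. LBINT x. ((1 - (norm (w n x))\<^sup>2) - (1 - (norm (kink x))\<^sup>2))\<^sup>2) \<longlonglongrightarrow> 0"
proof -
  have "((1 - (norm (w n x))\<^sup>2) - (1 - (norm (kink x))\<^sup>2))\<^sup>2 = 2 * (hh (w n) x - kinkd x)\<^sup>2" for n x
    by (simp add: hh_def kinkd_def kink_def diff_divide_distrib[symmetric] power_divide)
  then show ?thesis using tendsto_mult_right_zero[OF hh_L2_convergence, of 2] by simp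
qed

text \<open>With \<open>s = sgn x\<close>, the difference splits into \<open>ort\<close>,
  \<open>s * defect * sgn w\<close>, \<open>s * (hh - kinkd) * sgn w\<close> and
  \<open>kinkd * (s * sgn w - z)\<close>. The first three are small in L2 by what precedes, the last
  by dominated convergence.\<close>

lemma derivative_convergence:
  "(\<lambda>n. LBINT x. (norm (D n x - z * of_real (kinkd x)))\<^sup>2) \<longlonglongrightarrow> 0"
proof -
  let ?P = "\<lambda>n x. kinkd x ^ 2 * (norm (sgn x *\<^sub>R sgn (w n x) - z))\<^sup>2"
  let ?R = "\<lambda>n. finite_energy.defect (w n) (D n) 0"
  have ms: "(\<lambda>x. sgn x *\<^sub>R sgn (w n x)) \<in> borel_measurable borel" for n
    using finite_energy.measurable_sgn_v[OF fe, of n] finite_energy.measurable_sgn_shift[OF fe, where a=0] by simp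
  have mP: "?P n \<in> borel_measurable borel" for n
    using ms[of n] by measurable
  have Pb: "\<bar>?P n x\<bar> \<le> 4 * kinkd x ^ 2" for n x
  proof -
    have "norm (sgn x *\<^sub>R sgn (w n x) - z) \<le> norm (sgn x *\<^sub>R sgn (w n x)) + norm z" by (rule norm_triangle_ineq4)
    also have "\<dots> \<le> 2" by (auto simp: z1 norm_sgn)
    finally have "(norm (sgn x *\<^sub>R sgn (w n x) - z))\<^sup>2 \<le> 2\<^sup>2" by (intro power_mono) auto
    then have "kinkd x ^ 2 * (norm (sgn x *\<^sub>R sgn (w n x) - z))\<^sup>2 \<le> kinkd x ^ 2 * 2\<^sup>2" by (intro mult_left_mono) auto
    then show ?thesis by simp
  qed
  have k2: "integrable lborel (\<lambda>x. 4 * kinkd x ^ 2)" using L2_kinkd by (simp add: L2_def)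
  have Pi: "integrable lborel (?P n)" for n
    by (rule Bochner_Integration.integrable_bound[OF k2]) (use mP[of n] Pb[where n=n] in auto)
  have P0: "(\<lambda>n. LBINT x. ?P n x) \<longlonglongrightarrow> (LBINT x::real. 0)"
  proof (rule integral_dominated_convergence[OF _ _ k2])
    show "AE x in lborel. (\<lambda>n. ?P n x) \<longlonglongrightarrow> 0"
    proof (rule AE_I'[of "{0}"])
      have "(\<lambda>n. ?P n x) \<longlonglongrightarrow> 0" if "x \<noteq> 0" for x
      proof -
        have "(\<lambda>n. ?P n x) \<longlonglongrightarrow> kinkd x ^ 2 * (norm (z - z))\<^sup>2" by (intro tendsto_intros sgn_tendsto that)
        then show ?thesis by simp
      qed
      then show "{x \<in> space lborel. \<not> (\<lambda>n. ?P n x) \<longlonglongrightarrow> 0} \<subseteq> {0}" by blast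
    qed auto
    show "AE x in lborel. norm (?P n x) \<le> 4 * kinkd x ^ 2" for n using Pb[where n=n] by simp
  qed (use mP in auto)
  \<comment> \<open>The factor 4 comes from squaring a sum of four terms.\<close>
  define U where "U n = 4 * ((nort (w n) (D n))\<^sup>2 + (nL2 (?R n))\<^sup>2 + (LBINT x. (hh (w n) x - kinkd x)\<^sup>2) + (LBINT x. ?P n x))" for n
  have le: "(LBINT x. (norm (D n x - z * of_real (kinkd x)))\<^sup>2) \<le> U n" for n
  proof -
    interpret F: finite_energy "w n" "D n" by (rule fe)
    have i: "integrable lborel (\<lambda>x. (norm (ort (w n) (D n) x))\<^sup>2)" "integrable lborel (\<lambda>x. (F.defect 0 x)\<^sup>2)"
      "integrable lborel (\<lambda>x. (hh (w n) x - kinkd x)\<^sup>2)"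
      using F.L2_ort F.L2_defect[of 0] L2_diff[OF F.L2_hh L2_kinkd] by (auto simp: L2_def)
    let ?G = "\<lambda>x. 4 * ((norm (ort (w n) (D n) x))\<^sup>2 + (F.defect 0 x)\<^sup>2 + (hh (w n) x - kinkd x)\<^sup>2 + ?P n x)"
    have pw: "(norm (D n x - z * of_real (kinkd x)))\<^sup>2 \<le> ?G x" if "x \<noteq> 0" for x
    proof -
      define s where "s = sgn x"
      have s: "s * s = 1" "\<bar>s\<bar> = 1" using that by (auto simp: s_def sgn_if)
      define a where "a = ort (w n) (D n) x"
      define b where "b = (s * F.defect 0 x) *\<^sub>R sgn (w n x)"
      define c where "c = (s * (hh (w n) x - kinkd x)) *\<^sub>R sgn (w n x)"
      define e where "e = kinkd x *\<^sub>R (s *\<^sub>R sgn (w n x) - z)"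
      have "rad (w n) (D n) x = s * F.defect 0 x + s * hh (w n) x"
        using s by (simp add: F.defect_def s_def[symmetric] right_diff_distrib mult.assoc[symmetric])
      then have "D n x - z * of_real (kinkd x) = a + b + c + e"
        by (simp only: a_def b_def c_def e_def ort_def) (simp add: scaleR_conv_of_real algebra_simps)
      then have "norm (D n x - z * of_real (kinkd x)) \<le> norm a + norm b + norm c + norm e"
        by (metis norm_triangle_le norm_triangle_ineq add_right_mono order_trans)
      then have "(norm (D n x - z * of_real (kinkd x)))\<^sup>2 \<le> (norm a + norm b + norm c + norm e)\<^sup>2"
        by (intro power_mono) auto
      also have "\<dots> \<le> 4 * ((norm a)\<^sup>2 + (norm b)\<^sup>2 + (norm c)\<^sup>2 + (norm e)\<^sup>2)"
      proof -
        have "(p + q + r + t)\<^sup>2 \<le> 4 * (p\<^sup>2 + q\<^sup>2 + r\<^sup>2 + t\<^sup>2)" for p q r t :: real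
        proof -
          have "0 \<le> (p - q)\<^sup>2 + (p - r)\<^sup>2 + (p - t)\<^sup>2 + (q - r)\<^sup>2 + (q - t)\<^sup>2 + (r - t)\<^sup>2" by simp
          then show ?thesis by (simp add: power2_eq_square algebra_simps)
        qed
        then show ?thesis .
      qed
      also have "\<dots> \<le> ?G x"
      proof -
        have sg: "norm (sgn (w n x)) \<le> 1" by (simp add: norm_sgn)
        have nb: "norm b \<le> \<bar>F.defect 0 x\<bar>" "norm c \<le> \<bar>hh (w n) x - kinkd x\<bar>"
          using sg s(2) by (auto simp: b_def c_def abs_mult mult_left_le)
        have "(norm b)\<^sup>2 \<le> (F.defect 0 x)\<^sup>2" "(norm c)\<^sup>2 \<le> (hh (w n) x - kinkd x)\<^sup>2"
          using power_mono[OF nb(1), of 2] power_mono[OF nb(2), of 2] by auto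
        moreover have "(norm e)\<^sup>2 = ?P n x" by (simp add: e_def s_def power_mult_distrib)
        ultimately show ?thesis unfolding a_def by simp
      qed
      finally show ?thesis .
    qed
    have "(LBINT x. (norm (D n x - z * of_real (kinkd x)))\<^sup>2) \<le> (LBINT x. ?G x)"
    proof (rule integral_mono_AE')
      show "integrable lborel ?G" using i Pi[of n] by simp
      show "AE x in lborel. (norm (D n x - z * of_real (kinkd x)))\<^sup>2 \<le> ?G x"
        by (rule AE_I'[of "{0}"]) (use pw in auto)
    qed auto
    also have "\<dots> = U n" unfolding U_def nL2_sq using i Pi[of n] by simp
    finally show ?thesis .
  qed
  have "U \<longlonglongrightarrow> 4 * (0\<^sup>2 + 0\<^sup>2 + 0 + (LBINT x::real. 0))"
    unfolding U_def by (intro tendsto_intros ort0 def0 hh_L2_convergence P0)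
  then have U0: "U \<longlonglongrightarrow> 0" by simp
  show ?thesis
    by (rule tendsto_sandwich[OF _ _ tendsto_const U0]) (use le in \<open>auto intro!: always_eventually\<close>)
qed

end

section \<open>Centres, subsequence and phase of the minimizing sequence\<close>

theorem theorem4:
  fixes u :: "nat \<Rightarrow> real \<Rightarrow> complex"
  assumes "\<And>n. X1 (u n)"
    and "(\<lambda>n. modpi_dist (pmom (u n)) (pi/2)) \<longlonglongrightarrow> 0"
    and "(\<lambda>n. energy (u n)) \<longlonglongrightarrow> Emin_half_pi"
  shows "\<exists>\<sigma>::nat \<Rightarrow> nat. \<exists>a::nat \<Rightarrow> real. \<exists>\<theta>::real. strict_mono \<sigma> \<and>
    (\<forall>K. compact K \<longrightarrow>
       uniform_limit K (\<lambda>n x. u (\<sigma> n) (x + a (\<sigma> n))) (\<lambda>x. cis \<theta> * kink x) sequentially) \<and>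
    (\<lambda>n. LINT x|lborel. ((1 - (norm (u (\<sigma> n) (x + a (\<sigma> n))))\<^sup>2) - (1 - (norm (kink x))\<^sup>2))\<^sup>2)
       \<longlonglongrightarrow> 0 \<and>
    (\<lambda>n. LINT x|lborel. (norm (wderiv (u (\<sigma> n)) (x + a (\<sigma> n))
                             - cis \<theta> * vector_derivative kink (at x)))\<^sup>2)
       \<longlonglongrightarrow> 0"
proof -
  have feu: "finite_energy (u n) (wderiv (u n))" for n by (rule X1_finite_energy[OF assms(1)])
  have mom: "(\<lambda>n. cis (2 * pmom (u n))) \<longlonglongrightarrow> -1"
    using assms(2) unfolding tendsto_modpi_iff by simp
  have near_zero: "\<forall>\<^sub>F n in sequentially. \<exists>x. norm (u n x) < \<mu>" if "\<mu> > 0" for \<mu>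
  proof -
    \<comment> \<open>The gap lemma asks for a level below 1.\<close>
    define \<nu> where "\<nu> = min \<mu> (1/2)"
    have \<nu>: "0 < \<nu>" "\<nu> < 1" "\<nu> \<le> \<mu>" using that by (auto simp: \<nu>_def)
    obtain \<delta> \<epsilon> where gap: "\<delta> > 0" "0 < \<epsilon>" "\<epsilon> < pi"
      "\<And>v. X1 v \<Longrightarrow> (\<And>x. \<nu> \<le> norm (v x)) \<Longrightarrow> Re (cis (2 * pmom v)) \<le> - cos \<epsilon> \<Longrightarrow> 2 * sqrt 2 / 3 + \<delta> \<le> energy v"
      using nonvanishing_energy_gap[OF \<nu>(1,2)] by blast
    have "cos \<epsilon> < cos 0" using gap by (intro cos_monotone_0_pi) auto
    then have "-1 < - cos \<epsilon>" by simp
    moreover have "(\<lambda>n. Re (cis (2 * pmom (u n)))) \<longlonglongrightarrow> Re (-1)" by (rule tendsto_Re[OF mom])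
    ultimately have "\<forall>\<^sub>F n in sequentially. Re (cis (2 * pmom (u n))) < - cos \<epsilon>"
      by (intro order_tendstoD(2)) auto
    moreover have "\<forall>\<^sub>F n in sequentially. energy (u n) < 2 * sqrt 2 / 3 + \<delta>"
      using Emin_le gap(1) by (intro order_tendstoD(2)[OF assms(3)]) linarith
    ultimately show ?thesis
    proof eventually_elim
      case (elim n)
      show ?case
      proof (rule ccontr)
        assume "\<not> ?thesis"
        then have "\<nu> \<le> norm (u n x)" for x using \<nu>(3) by (meson not_less order_trans)
        from gap(4)[OF assms(1) this] elim show False by simp
      qed
    qed
  qed
  define I where "I n = (INF x. norm (u n x))" for n
  have bdd: "bdd_below (range (\<lambda>x. norm (u n x)))" for n by (rule bdd_belowI[of _ 0]) auto
  \<comment> \<open>The infimum may fail to be attained; an error tending to 0 is enough.\<close>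
  have "\<exists>x. norm (u n x) < I n + 1 / real (Suc n)" for n
    using cINF_less_iff[OF _ bdd, of n "I n + 1 / real (Suc n)"] by (auto simp: I_def)
  then obtain a where a: "\<And>n. norm (u n (a n)) < I n + 1 / real (Suc n)" by metis
  define w where "w n x = u n (x + a n)" for n x
  define D where "D n x = wderiv (u n) (x + a n)" for n x
  have fe: "finite_energy (w n) (D n)" for n
    unfolding w_def[abs_def] D_def[abs_def] by (rule finite_energy.shift[OF feu])
  have en_w: "en (w n) (D n) = energy (u n)" for n
    unfolding w_def[abs_def] D_def[abs_def] energy_eq_en by (rule finite_energy.en_shift[OF feu])
  have m0: "(\<lambda>n. norm (w n 0)) \<longlonglongrightarrow> 0"
  proof (rule LIMSEQ_I)
    fix e :: real assume e: "e > 0"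
    have "\<forall>\<^sub>F n in sequentially. 1 / real (Suc n) < e / 2"
      using order_tendstoD(2)[OF LIMSEQ_inverse_real_of_nat, of "e / 2"] e by (simp add: inverse_eq_divide)
    then have "\<forall>\<^sub>F n in sequentially. norm (norm (w n 0) - 0) < e"
      using near_zero[OF half_gt_zero[OF e]]
    proof eventually_elim
      case (elim n)
      then obtain x where "norm (u n x) < e / 2" by auto
      moreover have "I n \<le> norm (u n x)" unfolding I_def by (rule cINF_lower[OF bdd]) auto
      ultimately show ?case using a[of n] elim(1) by (simp add: w_def)
    qed
    then show "\<exists>no. \<forall>n\<ge>no. norm (norm (w n 0) - 0) < e" by (simp add: eventually_sequentially)
  qed
  define N where "N n = nort (w n) (D n)" for n
  define R where "R n = nL2 (finite_energy.defect (w n) (D n) 0)" for n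
  define S where "S n = (N n)\<^sup>2 + (R n)\<^sup>2" for n
  have S_eq: "S n = 2 * energy (u n) - sqrt 2 * (4/3 - 2 * Psi (norm (w n 0)))" for n
    unfolding S_def N_def R_def en_w[symmetric] by (rule finite_energy.energy_identity[OF fe])
  have Psi0: "(\<lambda>n. Psi (norm (w n 0))) \<longlonglongrightarrow> 0 - 0 ^ 3 / 3"
    unfolding Psi_def by (intro tendsto_intros m0) auto
  have "S \<longlonglongrightarrow> 2 * Emin_half_pi - sqrt 2 * (4/3 - 2 * (0 - 0 ^ 3 / 3))"
    unfolding S_eq[abs_def] by (intro tendsto_intros assms(3) Psi0)
  then have S_lim: "S \<longlonglongrightarrow> 2 * Emin_half_pi - sqrt 2 * (4/3)" by simp
  \<comment> \<open>A limit of sums of squares is nonnegative; with \<open>Emin_le\<close> this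
    gives \<open>Emin_half_pi = 2 * sqrt 2 / 3\<close>, and both squares vanish in the
    limit.\<close>
  have "0 \<le> 2 * Emin_half_pi - sqrt 2 * (4/3)"
    by (rule tendsto_lowerbound[OF S_lim]) (auto simp: S_def)
  with Emin_le have "2 * Emin_half_pi - sqrt 2 * (4/3) = 0" by simp
  with S_lim have S0: "S \<longlonglongrightarrow> 0" by (simp only:)
  have sq0: "f \<longlonglongrightarrow> 0" if "\<And>n. 0 \<le> f n" "\<And>n. (f n)\<^sup>2 \<le> S n" for f
  proof -
    have "(\<lambda>n. (f n)\<^sup>2) \<longlonglongrightarrow> 0"
      by (rule tendsto_sandwich[OF _ _ tendsto_const S0]) (use that in \<open>auto intro!: always_eventually\<close>)
    from tendsto_real_sqrt[OF this] show ?thesis using that(1) by simp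
  qed
  have N0: "N \<longlonglongrightarrow> 0" and R0: "R \<longlonglongrightarrow> 0" by (auto intro!: sq0 simp: S_def N_def R_def)
  define B where "B = Emin_half_pi + 1"
  have "\<forall>\<^sub>F n in sequentially. norm (w n 0) < 1 \<and> energy (u n) < B"
    using order_tendstoD(2)[OF m0, of 1] order_tendstoD(2)[OF assms(3), of B] by (auto simp: B_def eventually_conj_iff)
  then obtain n0 where n0: "\<And>n. n \<ge> n0 \<Longrightarrow> norm (w n 0) < 1 \<and> energy (u n) < B"
    by (auto simp: eventually_sequentially)
  have B0: "B \<ge> 0" using n0[of n0] energy_nonneg[of "u n0"] by simp
  \<comment> \<open>The bounds hold from \<open>n0\<close> on, so indices are shifted before
    extraction; the two directions are paired so that one subsequence serves both.\<close>
  define p where "p n = (sgn (w (n + n0) 1), sgn (w (n + n0) (-1)))" for n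
  have "compact (cball (0::complex) 1 \<times> cball (0::complex) 1)" by (intro compact_Times compact_cball)
  moreover have "\<forall>n. p n \<in> cball 0 1 \<times> cball 0 1" by (auto simp: p_def norm_sgn)
  ultimately obtain l r where r: "strict_mono (r :: nat \<Rightarrow> nat)" and pl: "(p \<circ> r) \<longlonglongrightarrow> l"
    unfolding compact_def by metis
  define \<sigma> where "\<sigma> k = r k + n0" for k
  have \<sigma>: "strict_mono \<sigma>" using r by (auto simp: \<sigma>_def strict_mono_def)
  have sub: "(\<lambda>k. f (\<sigma> k)) \<longlonglongrightarrow> L" if "f \<longlonglongrightarrow> L" for f :: "nat \<Rightarrow> 'b::topological_space" and L
    using LIMSEQ_subseq_LIMSEQ[OF that \<sigma>] by (simp add: o_def)
  define z where "z = fst l"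
  have z_pos: "(\<lambda>k. sgn (w (\<sigma> k) 1)) \<longlonglongrightarrow> z" and z_neg: "(\<lambda>k. sgn (w (\<sigma> k) (-1))) \<longlonglongrightarrow> snd l"
    using tendsto_fst[OF pl] tendsto_snd[OF pl] by (auto simp: p_def \<sigma>_def z_def o_def)
  interpret K: kink_seq "\<lambda>k. w (\<sigma> k)" "\<lambda>k. D (\<sigma> k)" B
  proof (rule kink_seq.intro)
    show "finite_energy (w (\<sigma> n)) (D (\<sigma> n))" for n by (rule fe)
    show "en (w (\<sigma> n)) (D (\<sigma> n)) \<le> B" "norm (w (\<sigma> n) 0) \<le> 1" for n
      using n0[of "\<sigma> n"] by (auto simp: en_w \<sigma>_def)
    show "(\<lambda>n. norm (w (\<sigma> n) 0)) \<longlonglongrightarrow> 0" by (rule sub[OF m0])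
    show "(\<lambda>n. nort (w (\<sigma> n)) (D (\<sigma> n))) \<longlonglongrightarrow> 0" using sub[OF N0] by (simp add: N_def)
    show "(\<lambda>n. nL2 (finite_energy.defect (w (\<sigma> n)) (D (\<sigma> n)) 0)) \<longlonglongrightarrow> 0" using sub[OF R0] by (simp add: R_def)
  qed
  obtain c where c: "c > 0" "\<forall>\<^sub>F k in sequentially. \<forall>y. 1 \<le> \<bar>y\<bar> \<longrightarrow> c \<le> norm (w (\<sigma> k) y)"
    using K.lower_bound_away[of 1] by auto
  have z1: "norm z = 1"
  proof (rule tendsto_unique[OF _ tendsto_norm[OF z_pos]])
    show "(\<lambda>k. norm (sgn (w (\<sigma> k) 1))) \<longlonglongrightarrow> 1"
    proof (rule tendsto_eventually)
      show "\<forall>\<^sub>F k in sequentially. norm (sgn (w (\<sigma> k) 1)) = 1"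
        using c(2)
      proof eventually_elim
        case (elim k)
        then have "c \<le> norm (w (\<sigma> k) 1)" by simp
        then show ?case using c(1) by (auto simp: norm_sgn)
      qed
    qed
  qed auto
  \<comment> \<open>\<open>3 + B\<close> bounds the modulus, and \<open>sqrt 2\<close> comes from
    the interval of length 2 around \<open>a n\<close>.\<close>
  define C where "C = (3 + B) * sqrt 2 + 2 * (sqrt 2 / c * sqrt (2 * B))"
  \<comment> \<open>The estimate is applied to \<open>u n\<close> around \<open>a n\<close>, not to
    the translate \<open>w n\<close>, because \<open>pmom\<close> of a translate rests on another
    choice of \<open>wderiv\<close>.\<close>
  have est: "\<forall>\<^sub>F k in sequentially. norm (cis (2 * pmom (u (\<sigma> k))) - sgn (w (\<sigma> k) (-1)) * cnj (sgn (w (\<sigma> k) 1))) \<le> C * N (\<sigma> k)"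
    using c(2)
  proof eventually_elim
    case (elim k)
    define n where "n = \<sigma> k"
    have uw: "u n x = w n (x - a n)" for x by (simp add: w_def)
    have hn: "nL2 (hh (u n)) = nL2 (hh (w n))" unfolding w_def[abs_def] hh_shift by (simp add: nL2_shift)
    have on: "nort (u n) (wderiv (u n)) = N n"
      unfolding N_def w_def[abs_def] D_def[abs_def] ort_shift using nL2_shift[of "\<lambda>x. norm (ort (u n) (wderiv (u n)) x)" "a n"] by simp
    have "norm (cis (2 * pmom (u n)) - sgn (u n (a n - 1)) * cnj (sgn (u n (a n + 1))))
      \<le> ((3 + B) * sqrt ((a n + 1) - (a n - 1)) + 2 * (sqrt 2 / c * nL2 (hh (u n)))) * nort (u n) (wderiv (u n))"
    proof (rule cis_pmom_estimate[OF assms(1) _ c(1)])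
      show "c \<le> norm (u n x)" if "x \<le> a n - 1" for x using elim[folded n_def, rule_format, of "x - a n"] that by (simp add: uw)
      show "c \<le> norm (u n x)" if "a n + 1 \<le> x" for x using elim[folded n_def, rule_format, of "x - a n"] that by (simp add: uw)
      show "norm (u n x) \<le> 3 + B" for x
        using finite_energy.norm_v_le[OF K.fe K.le1, of k "x - a n"] K.en_le[of k] unfolding uw n_def[symmetric] by linarith
    qed auto
    also have "\<dots> \<le> C * N n"
      unfolding on hn C_def using K.nL2_bounds(1)[of k] c(1) B0
      by (intro mult_right_mono add_mono mult_left_mono) (auto simp: n_def N_def)
    finally show ?case unfolding uw n_def[symmetric] by simp
  qed
  have "(\<lambda>k. cis (2 * pmom (u (\<sigma> k))) - sgn (w (\<sigma> k) (-1)) * cnj (sgn (w (\<sigma> k) 1))) \<longlonglongrightarrow> 0"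
    by (rule Lim_null_comparison[OF est tendsto_mult_right_zero[OF sub[OF N0]]])
  moreover have "(\<lambda>k. cis (2 * pmom (u (\<sigma> k))) - sgn (w (\<sigma> k) (-1)) * cnj (sgn (w (\<sigma> k) 1))) \<longlonglongrightarrow> -1 - snd l * cnj z"
    by (intro tendsto_intros sub[OF mom] z_neg z_pos)
  \<comment> \<open>In the limit the quotient of the two directions equals
    \<open>cis (2 * (pi / 2)) = -1\<close>.\<close>
  ultimately have "-1 - snd l * cnj z = 0" using LIMSEQ_unique by blast
  then have "snd l * cnj z = -1" by (simp add: algebra_simps)
  then have "snd l * (cnj z * z) = - z" by (metis mult.assoc mult_minus1)
  moreover have "cnj z * z = 1" using complex_norm_square[of z] z1 by (simp add: mult.commute)
  ultimately have lz: "snd l = - z" by simp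
  interpret P: kink_seq_phase "\<lambda>k. w (\<sigma> k)" "\<lambda>k. D (\<sigma> k)" B z
    by unfold_locales (use z1 z_pos z_neg lz in auto)
  have "z \<noteq> 0" using z1 by auto
  then have zc: "cis (Arg z) = z" using z1 by (simp add: cis_Arg sgn_div_norm)
  show ?thesis
  proof (intro exI conjI allI impI)
    show "strict_mono \<sigma>" by (rule \<sigma>)
    show "uniform_limit K (\<lambda>n x. u (\<sigma> n) (x + a (\<sigma> n))) (\<lambda>x. cis (Arg z) * kink x) sequentially" if "compact K" for K
      using P.locally_uniform_convergence[OF that] by (simp add: zc w_def[abs_def])
    show "(\<lambda>n. LINT x|lborel. ((1 - (norm (u (\<sigma> n) (x + a (\<sigma> n))))\<^sup>2) - (1 - (norm (kink x))\<^sup>2))\<^sup>2) \<longlonglongrightarrow> 0"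
      using P.potential_convergence by (simp add: w_def)
    show "(\<lambda>n. LINT x|lborel. (norm (wderiv (u (\<sigma> n)) (x + a (\<sigma> n)) - cis (Arg z) * vector_derivative kink (at x)))\<^sup>2) \<longlonglongrightarrow> 0"
      using P.derivative_convergence by (simp add: D_def zc vector_derivative_kink)
  qed
qed

end
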